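(* Let $K$ be an algebraically closed field with uncountably many elements and $n\ge1$. Let $X$ be an irreducible projective scheme over $K$ and let $\Sigma$ be a closed subscheme of $X\times\mathbb{A}^n_K$ such that the projection $\operatorname{pr}_1:\Sigma\to X$ is flat. If there is a nonempty open subset $U\subset X(K)$ such that for all $x\in U$ the fiber $\operatorname{pr}_1^{-1}(x)$ is irreducible, then $\operatorname{Seq}(\Sigma)$ is irreducible. In particular, the generic point $\operatorname{sq}(\Sigma)\in\mathbb{A}^n_{K,\infty}$ of the closure of $\operatorname{Seq}(\Sigma)$ is a fixed point of the action of $\operatorname{Sym}(\infty)$.
   Context: $\mathbb{A}^n_{K,\infty}=\operatorname{Spec}(K[x_{ij}:i\in\mathbb{N},j\in\{1,\dots,n\}])$, on which $\operatorname{Sym}(\infty)=\bigcup_k\operatorname{Sym}(k)$ acts via $\sigma(x_{ij})=x_{\sigma(i)j}$; its $K$-rational points $\mathbb{A}^n_{K,\infty}(K)$ are identified with sequences $(p_i)_{i\in\mathbb{N}}$ in $\mathbb{A}^n_K(K)=K^n$, and are given the Zariski topology (the subspace topology via the injection $\mathbb{A}^n_{K,\infty}(K)\to\mathbb{A}^n_{K,\infty}$). Sets of $K$-points carry the Zariski topology. For a projective scheme $X$ over $K$ and a closed subscheme $\Sigma\subset X\times\mathbb{A}^n_K$ with projections $\operatorname{pr}_1:\Sigma\to X$ and $\operatorname{pr}_2:\Sigma\to\mathbb{A}^n_K$, for $x\in X(K)$ the set $\operatorname{pr}_2(\operatorname{pr}_1^{-1}(x))$ is regarded as a closed subset of $\mathbb{A}^n_K(K)$,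 and $$\operatorname{Seq}(\Sigma)=\{(p_i)_{i\in\mathbb{N}}\subset\mathbb{A}^n_K(K):\ \exists x\in X(K)\ \forall i\in\mathbb{N}:\ p_i\in\operatorname{pr}_2(\operatorname{pr}_1^{-1}(x))\}\subset\mathbb{A}^n_{K,\infty}(K).$$ If $\operatorname{Seq}(\Sigma)$ is irreducible, $\operatorname{sq}(\Sigma)\in\mathbb{A}^n_{K,\infty}$ denotes the generic point of its closure in $\mathbb{A}^n_{K,\infty}$. Irreducible spaces are nonempty by convention. *)

theory Defs
  imports
    "HOL-Analysis.Analysis"
    "HOL-Algebra.Algebra"
    "HOL-Algebra.Algebraic_Closure_Type"
    "HOL-Combinatorics.Permutations"
    "HOL-Library.Poly_Mapping"
begin

section \<open>Topological notions\<close>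

definition irreducible_space :: "'a topology \<Rightarrow> bool" where
  "irreducible_space T \<longleftrightarrow> topspace T \<noteq> {} \<and>
     (\<forall>C D. closedin T C \<and> closedin T D \<and> topspace T = C \<union> D \<longrightarrow>
        C = topspace T \<or> D = topspace T)"

definition generic_point :: "'a topology \<Rightarrow> 'a set \<Rightarrow> 'a \<Rightarrow> bool" where
  "generic_point T C x \<longleftrightarrow> x \<in> topspace T \<and> T closure_of {x} = C"

text \<open>The Zariski topology on a set of prime ideals of \<open>A\<close>.  Its basic open sets are the
  \<open>D(f)\<close>; for homogeneous primes, \<open>D(f)\<close> is the union of the \<open>D(g)\<close>, with \<open>g\<close> running through
  the homogeneous components of \<open>f\<close>, so nothing changes if \<open>f\<close> is not restricted to be
  homogeneous.\<close>

definition zariski :: "('a, 'b) ring_scheme \<Rightarrow> 'a set set \<Rightarrow> 'a set topology" where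
  "zariski A pts = topology_generated_by ((\<lambda>f. {P \<in> pts. f \<notin> P}) ` carrier A)"

definition Spec :: "('a, 'b) ring_scheme \<Rightarrow> 'a set topology" where
  "Spec A = zariski A {P. primeideal P A}"

section \<open>Polynomials\<close>

type_synonym ('v, 'c) mpoly = "('v \<Rightarrow>\<^sub>0 nat) \<Rightarrow>\<^sub>0 'c"

definition Const :: "'c::zero \<Rightarrow> ('v, 'c) mpoly" where
  "Const c = Poly_Mapping.single 0 c"

definition Var :: "'v \<Rightarrow> ('v, 'c::zero_neq_one) mpoly" where
  "Var v = Poly_Mapping.single (Poly_Mapping.single v 1) 1"

definition tdeg :: "('v \<Rightarrow>\<^sub>0 nat) \<Rightarrow> nat" where
  "tdeg m = (\<Sum>v\<in>Poly_Mapping.keys m. Poly_Mapping.lookup m v)"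

text \<open>Apply \<open>h\<close> to the coefficients and put \<open>s v\<close> in place of the variable \<open>v\<close>.\<close>

definition poly_subst :: "('c \<Rightarrow> 'd) \<Rightarrow> ('v \<Rightarrow> 'd) \<Rightarrow> ('v, 'c::zero) mpoly \<Rightarrow> 'd::comm_semiring_1" where
  "poly_subst h s f = (\<Sum>m\<in>Poly_Mapping.keys f. h (Poly_Mapping.lookup f m) *
     (\<Prod>v\<in>Poly_Mapping.keys m. s v ^ Poly_Mapping.lookup m v))"

text \<open>The \<open>K\<close>-rational point of affine space (with coordinates indexed by \<open>'v\<close>) that has
  coordinates \<open>a\<close>, as a prime ideal.\<close>

definition affine_point :: "('v \<Rightarrow> 'k) \<Rightarrow> ('v, 'k::comm_ring_1) mpoly set" where
  "affine_point a = {f. poly_subst (\<lambda>c. c) a f = 0}"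

section \<open>Graded rings and Proj\<close>

text \<open>Graded rings; \<open>hcomp A d\<close> is the homogeneous component of degree \<open>d\<close>.\<close>

record 'a gring = "'a ring" +
  hcomp :: "nat \<Rightarrow> 'a set"

definition with_grading :: "'a ring \<Rightarrow> (nat \<Rightarrow> 'a set) \<Rightarrow> 'a gring" where
  "with_grading A G = ring.extend A (gring.fields G)"

definition poly_gring :: "('v, 'c::comm_ring_1) mpoly gring" where
  "poly_gring = with_grading ring_of_type_algebra (\<lambda>d. {f. \<forall>m\<in>Poly_Mapping.keys f. tdeg m = d})"

definition gquot :: "'a gring \<Rightarrow> 'a set \<Rightarrow> 'a set gring" where
  "gquot A I = with_grading (A Quot I) (\<lambda>d. (\<lambda>f. I +>\<^bsub>A\<^esub> f) ` hcomp A d)"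

definition homogeneous_ideal :: "'a gring \<Rightarrow> 'a set \<Rightarrow> bool" where
  "homogeneous_ideal A I \<longleftrightarrow> ideal I A \<and> I = Idl\<^bsub>A\<^esub> (I \<inter> (\<Union>d. hcomp A d))"

definition Proj_points :: "'a gring \<Rightarrow> 'a set set" where
  "Proj_points A = {P. primeideal P A \<and> homogeneous_ideal A P \<and> \<not> (\<Union>d\<in>{0<..}. hcomp A d) \<subseteq> P}"

definition Proj :: "'a gring \<Rightarrow> 'a set topology" where
  "Proj A = zariski A (Proj_points A)"

text \<open>The local ring of \<open>Proj A\<close> at \<open>P\<close>: the ring of fractions \<open>a/s\<close> with \<open>a, s\<close> homogeneous of
  the same degree and \<open>s \<notin> P\<close>.  A fraction is an equivalence class of pairs.\<close>

definition hfracs :: "'a gring \<Rightarrow> 'a set \<Rightarrow> ('a \<times> 'a) set" where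
  "hfracs A P = (\<Union>d. hcomp A d \<times> (hcomp A d - P))"

definition hfrac :: "'a gring \<Rightarrow> 'a set \<Rightarrow> 'a \<Rightarrow> 'a \<Rightarrow> ('a \<times> 'a) set" where
  "hfrac A P a s = {(b, t) \<in> hfracs A P.
     \<exists>u \<in> (\<Union>d. hcomp A d) - P. u \<otimes>\<^bsub>A\<^esub> (a \<otimes>\<^bsub>A\<^esub> t \<ominus>\<^bsub>A\<^esub> b \<otimes>\<^bsub>A\<^esub> s) = \<zero>\<^bsub>A\<^esub>}"

definition Proj_local_ring :: "'a gring \<Rightarrow> 'a set \<Rightarrow> ('a \<times> 'a) set ring" where
  "Proj_local_ring A P =
     \<lparr> carrier = (\<lambda>(a, s). hfrac A P a s) ` hfracs A P,
       monoid.mult = (\<lambda>x y. \<Union>(a, s)\<in>x. \<Union>(b, t)\<in>y. hfrac A P (a \<otimes>\<^bsub>A\<^esub> b) (s \<otimes>\<^bsub>A\<^esub> t)),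
       one = hfrac A P \<one>\<^bsub>A\<^esub> \<one>\<^bsub>A\<^esub>,
       ring.zero = hfrac A P \<zero>\<^bsub>A\<^esub> \<one>\<^bsub>A\<^esub>,
       add = (\<lambda>x y. \<Union>(a, s)\<in>x. \<Union>(b, t)\<in>y.
                hfrac A P (a \<otimes>\<^bsub>A\<^esub> t \<oplus>\<^bsub>A\<^esub> b \<otimes>\<^bsub>A\<^esub> s) (s \<otimes>\<^bsub>A\<^esub> t)) \<rparr>"

text \<open>The map \<open>Proj B \<rightarrow> Proj A\<close> induced by a homomorphism \<open>\<phi> : A \<rightarrow> B\<close> of graded rings (everywhere
  defined if the elements of positive degree of \<open>A\<close> generate those of \<open>B\<close>), and the maps it
  induces on local rings.\<close>

definition Proj_map :: "'a gring \<Rightarrow> ('a \<Rightarrow> 'b) \<Rightarrow> 'b set \<Rightarrow> 'a set" where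
  "Proj_map A \<phi> P = {a \<in> carrier A. \<phi> a \<in> P}"

definition Proj_local_map :: "'b gring \<Rightarrow> ('a \<Rightarrow> 'b) \<Rightarrow> 'b set \<Rightarrow> ('a \<times> 'a) set \<Rightarrow> ('b \<times> 'b) set" where
  "Proj_local_map B \<phi> P x = (\<Union>(a, s)\<in>x. hfrac B P (\<phi> a) (\<phi> s))"

section \<open>Flatness\<close>

definition tensor_relations ::
  "('r, 'c) ring_scheme \<Rightarrow> ('r, 'm, 'd) module_scheme \<Rightarrow> ('r, 'n, 'e) module_scheme \<Rightarrow>
     (('m \<times> 'n) \<Rightarrow>\<^sub>0 int) set" where
  "tensor_relations A M N = generate (free_Abelian_group (carrier M \<times> carrier N))
     ({frag_of (x \<oplus>\<^bsub>M\<^esub> x', y) - frag_of (x, y) - frag_of (x', y) | x x' y.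
         x \<in> carrier M \<and> x' \<in> carrier M \<and> y \<in> carrier N} \<union>
      {frag_of (x, y \<oplus>\<^bsub>N\<^esub> y') - frag_of (x, y) - frag_of (x, y') | x y y'.
         x \<in> carrier M \<and> y \<in> carrier N \<and> y' \<in> carrier N} \<union>
      {frag_of (a \<odot>\<^bsub>M\<^esub> x, y) - frag_of (x, a \<odot>\<^bsub>N\<^esub> y) | a x y.
         a \<in> carrier A \<and> x \<in> carrier M \<and> y \<in> carrier N})"

definition tensor ::
  "('r, 'c) ring_scheme \<Rightarrow> ('r, 'm, 'd) module_scheme \<Rightarrow> ('r, 'n, 'e) module_scheme \<Rightarrow>
     (('m \<times> 'n) \<Rightarrow>\<^sub>0 int) set monoid" where
  "tensor A M N = free_Abelian_group (carrier M \<times> carrier N) Mod tensor_relations A M N"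

text \<open>The homomorphism from the tensor product of \<open>M\<close> and \<open>N\<close> to that of \<open>M'\<close> and \<open>N\<close> induced
  by \<open>h : M \<rightarrow> M'\<close>, on cosets.\<close>

definition tensor_map ::
  "('r, 'c) ring_scheme \<Rightarrow> ('r, 'm, 'd) module_scheme \<Rightarrow> ('r, 'n, 'e) module_scheme \<Rightarrow> ('l \<Rightarrow> 'm) \<Rightarrow>
     (('l \<times> 'n) \<Rightarrow>\<^sub>0 int) set \<Rightarrow> (('m \<times> 'n) \<Rightarrow>\<^sub>0 int) set" where
  "tensor_map A M' N h c = (\<Union>z\<in>c. tensor_relations A M' N
     #>\<^bsub>free_Abelian_group (carrier M' \<times> carrier N)\<^esub> frag_extend (\<lambda>(x, y). frag_of (h x, y)) z)"

definition module_hom ::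
  "('r, 'c) ring_scheme \<Rightarrow> ('r, 'm, 'd) module_scheme \<Rightarrow> ('r, 'n, 'e) module_scheme \<Rightarrow> ('m \<Rightarrow> 'n) set" where
  "module_hom A M N = {h \<in> carrier M \<rightarrow> carrier N.
     (\<forall>x\<in>carrier M. \<forall>y\<in>carrier M. h (x \<oplus>\<^bsub>M\<^esub> y) = h x \<oplus>\<^bsub>N\<^esub> h y) \<and>
     (\<forall>a\<in>carrier A. \<forall>x\<in>carrier M. h (a \<odot>\<^bsub>M\<^esub> x) = a \<odot>\<^bsub>N\<^esub> h x)}"

text \<open>\<open>N\<close> is flat if tensoring with \<open>N\<close> preserves injectivity of homomorphisms.  A definition
  cannot quantify over types, so the homomorphisms are those between modules whose elements are
  sets of sequences in \<open>A\<close>.  Every countably generated \<open>A\<close>-module is isomorphic to such a module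
  (a quotient of a submodule of the module of all sequences), and flatness is already detected by
  the inclusions of the finitely generated ideals into \<open>A\<close>, so this is no restriction.\<close>

definition flat_module :: "('r, 'c) ring_scheme \<Rightarrow> ('r, 'n, 'd) module_scheme \<Rightarrow> bool" where
  "flat_module A N \<longleftrightarrow> module A N \<and>
     (\<forall>(M :: ('r, (nat \<Rightarrow> 'r) set) module) (M' :: ('r, (nat \<Rightarrow> 'r) set) module) h.
        module A M \<and> module A M' \<and> h \<in> module_hom A M M' \<and> inj_on h (carrier M) \<longrightarrow>
        inj_on (tensor_map A M' N h) (carrier (tensor A M N)))"

definition restrict_scalars :: "'b ring \<Rightarrow> ('a \<Rightarrow> 'b) \<Rightarrow> ('a, 'b) module" where
  "restrict_scalars B \<phi> = ring.extend B (module.fields (\<lambda>a b. \<phi> a \<otimes>\<^bsub>B\<^esub> b))"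

definition flat_ring_hom :: "'a ring \<Rightarrow> 'b ring \<Rightarrow> ('a \<Rightarrow> 'b) \<Rightarrow> bool" where
  "flat_ring_hom A B \<phi> \<longleftrightarrow> \<phi> \<in> ring_hom A B \<and> flat_module A (restrict_scalars B \<phi>)"

definition Proj_flat :: "'a gring \<Rightarrow> 'b gring \<Rightarrow> ('a \<Rightarrow> 'b) \<Rightarrow> bool" where
  "Proj_flat A B \<phi> \<longleftrightarrow> (\<forall>P\<in>Proj_points B.
     flat_ring_hom (Proj_local_ring A (Proj_map A \<phi> P)) (Proj_local_ring B P) (Proj_local_map B \<phi> P))"

section \<open>Families of closed subschemes of affine space over a projective scheme\<close>

text \<open>A projective scheme over \<open>K\<close> is a scheme \<open>X = Proj (K[x]/I)\<close> with \<open>I\<close> a homogeneous ideal in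
  finitely many variables \<open>x\<close>, indexed by \<open>'m\<close>.  With \<open>y\<close> the coordinates of affine \<open>n\<close>-space,
  indexed by \<open>'n\<close>, the product of \<open>X\<close> with that space is \<open>Proj (K[y][x]/(I))\<close>, where \<open>K[y][x]\<close> is
  graded by the degree in \<open>x\<close>; its closed subschemes are the schemes \<open>\<Sigma> = Proj (K[y][x]/J)\<close> with
  \<open>J\<close> a homogeneous ideal that contains \<open>I\<close>.\<close>

definition projective_ring :: "('m, 'c::comm_ring_1) mpoly set \<Rightarrow> ('m, 'c) mpoly set gring" where
  "projective_ring I = gquot poly_gring I"

definition extend_coeffs :: "('m, 'k::comm_ring_1) mpoly \<Rightarrow> ('m, ('n, 'k) mpoly) mpoly" where
  "extend_coeffs = Poly_Mapping.map Const"

definition closed_in_product ::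
  "('m, 'k::comm_ring_1) mpoly set \<Rightarrow> ('m, ('n, 'k) mpoly) mpoly set \<Rightarrow> bool" where
  "closed_in_product I J \<longleftrightarrow> homogeneous_ideal poly_gring J \<and> extend_coeffs ` I \<subseteq> J"

text \<open>The ring homomorphisms \<open>K[x]/I \<rightarrow> K[y][x]/J\<close> and \<open>K[y] \<rightarrow> K[y][x]/J\<close> that induce the two
  projections of \<open>\<Sigma>\<close>.\<close>

definition pr1_hom ::
  "('m, ('n, 'k::comm_ring_1) mpoly) mpoly set \<Rightarrow> ('m, 'k) mpoly set \<Rightarrow> ('m, ('n, 'k) mpoly) mpoly set" where
  "pr1_hom J C = (\<Union>f\<in>C. J +>\<^bsub>poly_gring\<^esub> extend_coeffs f)"

definition pr2_hom ::
  "('m, ('n, 'k::comm_ring_1) mpoly) mpoly set \<Rightarrow> ('n, 'k) mpoly \<Rightarrow> ('m, ('n, 'k) mpoly) mpoly set" where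
  "pr2_hom J g = J +>\<^bsub>poly_gring\<^esub> Const g"

definition pr1 ::
  "('m, 'k::comm_ring_1) mpoly set \<Rightarrow> ('m, ('n, 'k) mpoly) mpoly set \<Rightarrow>
     ('m, ('n, 'k) mpoly) mpoly set set \<Rightarrow> ('m, 'k) mpoly set set" where
  "pr1 I J = Proj_map (projective_ring I) (pr1_hom J)"

definition pr2 ::
  "('m, ('n, 'k::comm_ring_1) mpoly) mpoly set \<Rightarrow>
     ('m, ('n, 'k) mpoly) mpoly set set \<Rightarrow> ('n, 'k) mpoly set" where
  "pr2 J P = {g. pr2_hom J g \<in> P}"

text \<open>The fiber as a subset of the scheme \<open>\<Sigma>\<close>: it contains all points over \<open>x\<close>, not only the
  \<open>K\<close>-rational ones.\<close>

definition pr1_fiber ::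
  "('m, 'k::comm_ring_1) mpoly set \<Rightarrow> ('m, ('n, 'k) mpoly) mpoly set \<Rightarrow>
     ('m, 'k) mpoly set set \<Rightarrow> ('m, ('n, 'k) mpoly) mpoly set set set" where
  "pr1_fiber I J x = {z \<in> Proj_points (projective_ring J). pr1 I J z = x}"

text \<open>The set \<open>X(K)\<close> of points of \<open>X\<close> with residue field \<open>K\<close>.\<close>

definition rational_points :: "('m, 'k::field) mpoly set \<Rightarrow> ('m, 'k) mpoly set set set" where
  "rational_points I = {P \<in> Proj_points (projective_ring I).
     let L = Proj_local_ring (projective_ring I) P in
     \<forall>a\<in>carrier L. \<exists>c.
       a \<ominus>\<^bsub>L\<^esub> hfrac (projective_ring I) P (I +>\<^bsub>poly_gring\<^esub> Const c) \<one>\<^bsub>projective_ring I\<^esub> \<notin> Units L}"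

section \<open>Infinite affine space and the space of sequences\<close>

definition A_inf :: "(nat \<times> 'n, 'k::comm_ring_1) mpoly set topology" where
  "A_inf = Spec ring_of_type_algebra"

definition seq_point :: "(nat \<Rightarrow> 'k::comm_ring_1 ^ 'n) \<Rightarrow> (nat \<times> 'n, 'k) mpoly set" where
  "seq_point p = affine_point (\<lambda>(i, j). p i $ j)"

definition A_inf_K :: "(nat \<Rightarrow> 'k::comm_ring_1 ^ 'n) topology" where
  "A_inf_K = pullback_topology UNIV seq_point A_inf"

text \<open>A sequence lies in \<open>Seq\<close> if, for some \<open>x\<close>, all its terms are \<open>K\<close>-rational points of the
  image under the second projection of the fiber over \<open>x\<close>.\<close>

definition Seq ::
  "('m, 'k::field) mpoly set \<Rightarrow> ('m, ('n::finite, 'k) mpoly) mpoly set \<Rightarrow> (nat \<Rightarrow> 'k ^ 'n) set" where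
  "Seq I J = {p. \<exists>x\<in>rational_points I. \<forall>i. affine_point (\<lambda>j. p i $ j) \<in> pr2 J ` pr1_fiber I J x}"

definition sq ::
  "('m, 'k::field) mpoly set \<Rightarrow> ('m, ('n::finite, 'k) mpoly) mpoly set \<Rightarrow> (nat \<times> 'n, 'k) mpoly set" where
  "sq I J = (THE \<eta>. generic_point A_inf (A_inf closure_of (seq_point ` Seq I J)) \<eta>)"

definition Sym_inf :: "(nat \<Rightarrow> nat) set" where
  "Sym_inf = (\<Union>k. {\<sigma>. \<sigma> permutes {..<k}})"

definition sym_act :: "(nat \<Rightarrow> nat) \<Rightarrow> (nat \<times> 'n, 'k::comm_ring_1) mpoly \<Rightarrow> (nat \<times> 'n, 'k) mpoly" where
  "sym_act \<sigma> = poly_subst Const (\<lambda>(i, j). Var (\<sigma> i, j))"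

text \<open>The action on points is by images; it is a left action, and letting \<open>\<sigma>\<close> act by preimages
  instead gives the same fixed points.\<close>

definition sym_act_point ::
  "(nat \<Rightarrow> nat) \<Rightarrow> (nat \<times> 'n, 'k::comm_ring_1) mpoly set \<Rightarrow> (nat \<times> 'n, 'k) mpoly set" where
  "sym_act_point \<sigma> P = sym_act \<sigma> ` P"

end

theory Submission
  imports Defs
begin

text \<open>Write \<open>F\<^sub>x\<close> for the set of \<open>K\<close>-points of the fibre over \<open>x\<close>.  Two nonempty open sets of sequences
  contain the nonvanishing loci of polynomials \<open>f\<close> and \<open>g\<close> in the coordinates of \<open>N\<close> points.  The set of
  \<open>x\<close> such that \<open>f\<close> does not vanish identically on \<open>F\<^sub>x\<^sup>N\<close> contains a nonempty open set, and so does the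
  one for \<open>g\<close>.  As \<open>X\<close> is irreducible, both conditions hold at some \<open>x\<close> in \<open>U\<close>.  There \<open>F\<^sub>x\<close> is
  irreducible, so \<open>f\<close> and \<open>g\<close> are nonzero at a common point of \<open>F\<^sub>x\<^sup>N\<close> (make the two points agree in one
  factor after the other).

  For the openness, let \<open>P\<close> be the generic point of an affine chart and \<open>A\<^sub>N\<close> the ideal of the
  \<open>N\<close>-fold fibre power over \<open>P\<close>.  If no \<open>a f\<^sup>k\<close> with \<open>a \<notin> P\<close> lies in \<open>A\<^sub>N\<close>, then a prime ideal over \<open>A\<^sub>N\<close>
  avoids all of them, and extending points along it gives the open set.  So assume \<open>a g \<in> A\<^sub>N\<close>; then \<open>g\<close>
  vanishes on \<open>F\<^sub>x\<^sup>N\<close> for every \<open>x\<close>, by induction on \<open>N\<close>: the quotient of \<open>O\<^sub>X\<^sub>,\<^sub>x[y\<^sub>1, \<dots>, y\<^sub>N\<^sub>-\<^sub>1]\<close> by the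
  torsion closure of \<open>A\<^sub>N\<^sub>-\<^sub>1\<close> is torsion free, hence remains so after tensoring with the flat local ring
  at \<open>(x, b\<^sub>N)\<close>, and it follows that \<open>g(x, \<cdot>, b\<^sub>N)\<close> lifts to an element of the torsion closure.\<close>

text \<open>Flatness excludes parts of the fibre powers of \<Sigma> that lie over a proper closed
  subset of X. On such a part f could be nonzero for special x and yet vanish on the fibre power
  over the generic point, so that the good x would contain no open set. Torsion over K[x]/P is the
  algebraic form of such parts. The ideal \<open>A\<^sub>N\<close> need be neither prime nor
  radical, hence the powers of f: one prime over it is wanted that contains neither f nor a constant
  outside P. Flatness is given for the local rings of \<Sigma> and not for its fibre powers;
  therefore the induction freezes one point at a time and compares only values at x. Finitely many
  points suffice because a polynomial in the coordinates of a sequence involves only finitely many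
  of them. Irreducibility of a fibre is used for two polynomials in a single point, so that no
  product of schemes has to be formed. The generic point is the ideal of all polynomials vanishing
  on the set of sequences; its invariance comes from reindexing sequences with the same x.\<close>

abbreviation lookup :: "('a \<Rightarrow>\<^sub>0 'b::zero) \<Rightarrow> 'a \<Rightarrow> 'b" where "lookup \<equiv> Poly_Mapping.lookup"
abbreviation keys :: "('a \<Rightarrow>\<^sub>0 'b::zero) \<Rightarrow> 'a set" where "keys \<equiv> Poly_Mapping.keys"
abbreviation single :: "'a \<Rightarrow> 'b \<Rightarrow> ('a \<Rightarrow>\<^sub>0 'b::zero)" where "single \<equiv> Poly_Mapping.single"

section \<open>Homomorphisms and ideals of commutative rings as types\<close>

definition rhom :: "('a::comm_ring_1 \<Rightarrow> 'b::comm_ring_1) \<Rightarrow> bool" where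
  "rhom f \<longleftrightarrow> f 1 = 1 \<and> (\<forall>x y. f (x + y) = f x + f y) \<and> (\<forall>x y. f (x * y) = f x * f y)"

lemma rhomI:
  "f 1 = 1 \<Longrightarrow> (\<And>x y. f (x + y) = f x + f y) \<Longrightarrow> (\<And>x y. f (x * y) = f x * f y) \<Longrightarrow> rhom f"
  by (simp add: rhom_def)

lemma rhom_1: "rhom f \<Longrightarrow> f 1 = 1"
  and rhom_add: "rhom f \<Longrightarrow> f (x + y) = f x + f y"
  and rhom_mult: "rhom f \<Longrightarrow> f (x * y) = f x * f y"
  by (auto simp: rhom_def)

lemma rhom_0: assumes "rhom f" shows "f 0 = 0"
  using rhom_add[OF assms, of 0 0] by simp

lemma rhom_minus: assumes "rhom f" shows "f (- x) = - f x"
  using rhom_add[OF assms, of x "-x"] rhom_0[OF assms]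
  by (simp add: eq_neg_iff_add_eq_0 add.commute)

lemma rhom_diff: assumes "rhom f" shows "f (x - y) = f x - f y"
  using rhom_add[OF assms, of x "-y"] rhom_minus[OF assms, of y] by simp

lemma rhom_power: assumes "rhom f" shows "f (x ^ n) = f x ^ n"
  by (induction n) (auto simp: rhom_1[OF assms] rhom_mult[OF assms])

lemma rhom_sum: assumes "rhom f" shows "f (sum g A) = (\<Sum>a\<in>A. f (g a))"
  by (induction A rule: infinite_finite_induct) (auto simp: rhom_0[OF assms] rhom_add[OF assms])

lemma rhom_prod: assumes "rhom f" shows "f (prod g A) = (\<Prod>a\<in>A. f (g a))"
  by (induction A rule: infinite_finite_induct) (auto simp: rhom_1[OF assms] rhom_mult[OF assms])

lemmas rhom_simps = rhom_1 rhom_0 rhom_add rhom_mult rhom_minus rhom_diff rhom_power rhom_sum rhom_prod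

lemma rhom_id [simp]: "rhom (\<lambda>x. x)"
  by (simp add: rhom_def)

lemma rhom_comp: "rhom f \<Longrightarrow> rhom g \<Longrightarrow> rhom (\<lambda>x. f (g x))"
  by (simp add: rhom_def)

text \<open>Calculations use ideals of a whole type, without carriers;
  \<open>ideal_poly_gring\<close> and \<open>primeideal_type_ring\<close> translate from the notions
  of the statement.\<close>

definition tideal :: "'a::comm_ring_1 set \<Rightarrow> bool" where
  "tideal I \<longleftrightarrow> 0 \<in> I \<and> (\<forall>x\<in>I. \<forall>y\<in>I. x + y \<in> I) \<and> (\<forall>r. \<forall>x\<in>I. r * x \<in> I)"

definition tprime :: "'a::comm_ring_1 set \<Rightarrow> bool" where
  "tprime I \<longleftrightarrow> tideal I \<and> 1 \<notin> I \<and> (\<forall>x y. x * y \<in> I \<longrightarrow> x \<in> I \<or> y \<in> I)"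

definition tgen :: "'a::comm_ring_1 set \<Rightarrow> 'a set" where
  "tgen G = \<Inter>{I. tideal I \<and> G \<subseteq> I}"

lemma tideal_0: "tideal I \<Longrightarrow> 0 \<in> I"
  and tideal_add: "tideal I \<Longrightarrow> x \<in> I \<Longrightarrow> y \<in> I \<Longrightarrow> x + y \<in> I"
  and tideal_mult: "tideal I \<Longrightarrow> x \<in> I \<Longrightarrow> r * x \<in> I"
  by (auto simp: tideal_def)

lemma tideal_mult': "tideal I \<Longrightarrow> x \<in> I \<Longrightarrow> x * r \<in> I"
  by (metis mult.commute tideal_mult)

lemma tideal_minus: "tideal I \<Longrightarrow> x \<in> I \<Longrightarrow> - x \<in> I"
  using tideal_mult[of I x "-1"] by simp

lemma tideal_diff: "tideal I \<Longrightarrow> x \<in> I \<Longrightarrow> y \<in> I \<Longrightarrow> x - y \<in> I"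
  by (metis diff_conv_add_uminus tideal_add tideal_minus)

lemma tideal_sum: "tideal I \<Longrightarrow> (\<And>a. a \<in> A \<Longrightarrow> f a \<in> I) \<Longrightarrow> sum f A \<in> I"
  by (induction A rule: infinite_finite_induct) (auto simp: tideal_0 tideal_add)

lemma tprime_tideal: "tprime I \<Longrightarrow> tideal I"
  and tprime_1: "tprime I \<Longrightarrow> 1 \<notin> I"
  and tprime_mult: "tprime I \<Longrightarrow> x * y \<in> I \<Longrightarrow> x \<in> I \<or> y \<in> I"
  by (auto simp: tprime_def)

lemma tprime_mult_iff: "tprime I \<Longrightarrow> x * y \<in> I \<longleftrightarrow> x \<in> I \<or> y \<in> I"
  by (metis tprime_mult tprime_tideal tideal_mult tideal_mult')

lemma tprime_power: assumes "tprime I" "x ^ n \<in> I" shows "x \<in> I"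
  using assms(2) by (induction n) (auto simp: tprime_1 assms(1) tprime_mult_iff[OF assms(1)])

lemma tideal_tgen: "tideal (tgen G)"
  by (auto simp: tgen_def tideal_def)

lemma tgen_superset: "G \<subseteq> tgen G"
  by (auto simp: tgen_def)

lemma tgen_minimal: "tideal I \<Longrightarrow> G \<subseteq> I \<Longrightarrow> tgen G \<subseteq> I"
  by (auto simp: tgen_def)

lemma tideal_vimage: "rhom f \<Longrightarrow> tideal I \<Longrightarrow> tideal {x. f x \<in> I}"
  by (auto simp: tideal_def rhom_simps)

lemma tprime_vimage: "rhom f \<Longrightarrow> tprime I \<Longrightarrow> tprime {x. f x \<in> I}"
  using tideal_vimage[of f I] by (auto simp: tprime_def rhom_simps)

lemma tideal_zero: "tideal {0}"
  by (auto simp: tideal_def)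

lemma tprime_ker:
  fixes f :: "'a::comm_ring_1 \<Rightarrow> 'b::idom"
  assumes "rhom f" shows "tprime {x. f x = 0}"
proof -
  have "tprime {0::'b}" by (auto simp: tprime_def tideal_zero)
  from tprime_vimage[OF assms this] show ?thesis by simp
qed

text \<open>An ideal that is maximal among those containing A and missing the multiplicative set M
  is prime. It is applied to the ideal of a fibre power and the products of powers of f with
  constants.\<close>

lemma prime_avoiding_exists:
  fixes A M :: "'a::comm_ring_1 set"
  assumes A: "tideal A" and M1: "1 \<in> M" and Mm: "\<And>x y. x \<in> M \<Longrightarrow> y \<in> M \<Longrightarrow> x * y \<in> M"
    and disj: "A \<inter> M = {}"
  shows "\<exists>P. tprime P \<and> A \<subseteq> P \<and> P \<inter> M = {}"
proof -
  define FF where "FF = {I. tideal I \<and> A \<subseteq> I \<and> I \<inter> M = {}}"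
  have "\<exists>P\<in>FF. (\<forall>Z\<in>FF. (P \<subseteq> Z \<longrightarrow> Z = P))"
  proof (rule subset_Zorn_nonempty)
    show "FF \<noteq> {}" using A disj by (auto simp: FF_def)
  next
    fix CC assume ne: "CC \<noteq> {}" and ch: "subset.chain FF CC"
    have sub: "CC \<subseteq> FF" and tot: "\<And>Z Y. Z \<in> CC \<Longrightarrow> Y \<in> CC \<Longrightarrow> Z \<subseteq> Y \<or> Y \<subseteq> Z"
      using ch by (auto simp: subset_chain_def)
    have tid: "\<And>Z. Z \<in> CC \<Longrightarrow> tideal Z" using sub by (auto simp: FF_def)
    have "tideal (\<Union>CC)"
      unfolding tideal_def
    proof (intro conjI ballI allI)
      show "0 \<in> \<Union>CC" using ne tid tideal_0 by blast
    next
      fix x y assume "x \<in> \<Union>CC" "y \<in> \<Union>CC"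
      then obtain Z Y where XY: "Z \<in> CC" "Y \<in> CC" "x \<in> Z" "y \<in> Y" by blast
      with tot[OF XY(1,2)] tid show "x + y \<in> \<Union>CC" by (meson Union_iff subsetD tideal_add)
    next
      fix r x assume "x \<in> \<Union>CC" then show "r * x \<in> \<Union>CC" using tid tideal_mult by blast
    qed
    then show "\<Union>CC \<in> FF" using ne sub by (auto simp: FF_def)
  qed
  then obtain P where P: "P \<in> FF" and max: "\<And>Z. Z \<in> FF \<Longrightarrow> P \<subseteq> Z \<Longrightarrow> Z = P" by blast
  have tP: "tideal P" and AP: "A \<subseteq> P" and PM: "P \<inter> M = {}" using P by (auto simp: FF_def)
  \<comment> \<open>By maximality, the ideal generated by P and a further element x meets M.\<close>
  have ext: "\<exists>r. \<exists>p\<in>P. r * x + p \<in> M" if "x \<notin> P" for x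
  proof (rule ccontr)
    assume no: "\<not> ?thesis"
    define Z where "Z = {r * x + p | r p. p \<in> P}"
    have "tideal Z"
      unfolding tideal_def
    proof (intro conjI ballI allI)
      have "0 = 0 * x + 0" by simp
      then show "0 \<in> Z" unfolding Z_def using tideal_0[OF tP] by blast
    next
      fix u v assume "u \<in> Z" "v \<in> Z"
      then obtain r p s q where "u = r * x + p" "v = s * x + q" "p \<in> P" "q \<in> P"
        by (auto simp: Z_def)
      then have "u + v = (r + s) * x + (p + q)" "p + q \<in> P"
        by (auto simp: algebra_simps tP tideal_add)
      then show "u + v \<in> Z" unfolding Z_def by blast
    next
      fix s u assume "u \<in> Z"
      then obtain r p where "u = r * x + p" "p \<in> P" by (auto simp: Z_def)
      then have "s * u = (s * r) * x + s * p" "s * p \<in> P"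
        using tP by (auto simp: algebra_simps tideal_mult')
      then show "s * u \<in> Z" unfolding Z_def by blast
    qed
    moreover have PX: "P \<subseteq> Z"
    proof
      fix p assume "p \<in> P"
      then show "p \<in> Z" unfolding Z_def by (auto intro: exI[of _ 0])
    qed
    moreover have "Z \<inter> M = {}" using no by (auto simp: Z_def)
    ultimately have "Z \<in> FF" using AP by (auto simp: FF_def)
    from max[OF this PX] have "Z = P" .
    moreover have "x = 1 * x + 0" by simp
    then have "x \<in> Z" unfolding Z_def using tideal_0[OF tP] by blast
    ultimately show False using that by simp
  qed
  have "tprime P"
    unfolding tprime_def
  proof (intro conjI allI impI)
    show "1 \<notin> P" using PM M1 by auto
  next
    fix x y assume xy: "x * y \<in> P"
    show "x \<in> P \<or> y \<in> P"
    proof (rule ccontr)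
      assume "\<not> ?thesis"
      then obtain r p s q where 1: "r * x + p \<in> M" "p \<in> P" "s * y + q \<in> M" "q \<in> P"
        using ext by blast
      have "(r * x + p) * (s * y + q) = (r * s) * (x * y) + (r * x) * q + p * (s * y + q)"
        by (simp add: algebra_simps)
      also have "\<dots> \<in> P"
        using 1 xy by (meson tP tideal_add tideal_mult tideal_mult')
      finally show False using Mm[OF 1(1,3)] PM by blast
    qed
  qed (fact tP)
  with AP PM show ?thesis by blast
qed

section \<open>Substitution in polynomials\<close>

definition mval :: "('v \<Rightarrow> 'd) \<Rightarrow> ('v \<Rightarrow>\<^sub>0 nat) \<Rightarrow> 'd::comm_semiring_1" where
  "mval s m = (\<Prod>v\<in>keys m. s v ^ lookup m v)"

lemma poly_subst_mval: "poly_subst h s f = (\<Sum>m\<in>keys f. h (lookup f m) * mval s m)"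
  by (simp add: poly_subst_def mval_def)

lemma mval_superset: "finite A \<Longrightarrow> keys m \<subseteq> A \<Longrightarrow> mval s m = (\<Prod>v\<in>A. s v ^ lookup m v)"
  unfolding mval_def by (rule prod.mono_neutral_left) (auto simp: in_keys_iff)

lemma mval_0 [simp]: "mval s 0 = 1"
  by (simp add: mval_def)

lemma mval_single [simp]: "mval s (single v k) = s v ^ k"
  by (simp add: mval_def)

lemma mval_add: "mval s (m + m') = mval s m * mval s m'"
proof -
  let ?A = "keys m \<union> keys m'"
  have "keys (m + m') \<subseteq> ?A" by (rule Poly_Mapping.keys_add)
  then show ?thesis
    by (simp add: mval_superset[of ?A] lookup_add power_add prod.distrib)
qed

lemma mval_cong: "(\<And>v. v \<in> keys m \<Longrightarrow> s v = t v) \<Longrightarrow> mval s m = mval t m"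
  by (simp add: mval_def cong: prod.cong)

lemma poly_subst_superset:
  assumes "finite A" "keys f \<subseteq> A" "h 0 = 0"
  shows "poly_subst h s f = (\<Sum>m\<in>A. h (lookup f m) * mval s m)"
  unfolding poly_subst_mval using assms
  by (intro sum.mono_neutral_left) (auto simp: in_keys_iff)

lemma poly_subst_single: "h 0 = 0 \<Longrightarrow> poly_subst h s (single m c) = h c * mval s m"
  by (simp add: poly_subst_mval)

lemma poly_subst_add:
  assumes "rhom h" shows "poly_subst h s (f + g) = poly_subst h s f + poly_subst h s g"
proof -
  let ?A = "keys f \<union> keys g"
  have "keys (f + g) \<subseteq> ?A" by (rule Poly_Mapping.keys_add)
  then show ?thesis
    by (simp add: poly_subst_superset[of ?A] lookup_add rhom_simps[OF assms] sum.distrib distrib_right)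
qed

lemma poly_subst_sum:
  assumes "rhom h" shows "poly_subst h s (sum f A) = (\<Sum>a\<in>A. poly_subst h s (f a))"
  by (induction A rule: infinite_finite_induct)
     (auto simp: poly_subst_add[OF assms], auto simp: poly_subst_def)

lemma poly_mapping_sum_single: "f = (\<Sum>m\<in>keys f. single m (lookup f m))"
  by (rule poly_mapping_eqI)
     (auto simp: lookup_sum lookup_single when_def in_keys_iff sum.delta')

lemma poly_subst_mult:
  assumes "rhom h" shows "poly_subst h s (f * g) = poly_subst h s f * poly_subst h s g"
proof -
  have "f * g = (\<Sum>m\<in>keys f. \<Sum>m'\<in>keys g. single (m + m') (lookup f m * lookup g m'))"
    by (subst poly_mapping_sum_single[of f], subst poly_mapping_sum_single[of g])
       (simp add: sum_product mult_single)
  then have "poly_subst h s (f * g)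
      = (\<Sum>m\<in>keys f. \<Sum>m'\<in>keys g. (h (lookup f m) * mval s m) * (h (lookup g m') * mval s m'))"
    by (simp add: poly_subst_sum[OF assms] poly_subst_single rhom_simps[OF assms] mval_add mult_ac)
  then show ?thesis by (simp add: sum_product poly_subst_mval)
qed

lemma poly_subst_Const: "h 0 = 0 \<Longrightarrow> poly_subst h s (Const c) = h c"
  by (simp add: Const_def poly_subst_single)

lemma poly_subst_Var: "rhom h \<Longrightarrow> poly_subst h s (Var v) = s v"
  by (simp add: Var_def poly_subst_single rhom_simps)

lemma Const_1: "Const 1 = (1 :: ('v, 'c::comm_ring_1) mpoly)"
  by (simp add: Const_def)

lemma rhom_poly_subst: assumes "rhom h" shows "rhom (poly_subst h s)"
proof (rule rhomI)
  show "poly_subst h s 1 = 1"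
    using poly_subst_Const[of h s 1] by (simp add: Const_1 rhom_simps[OF assms])
qed (auto simp: poly_subst_add poly_subst_mult assms)

lemma rhom_Const [simp]: "rhom (Const :: 'c::comm_ring_1 \<Rightarrow> ('v, 'c) mpoly)"
  by (rule rhomI) (auto simp: Const_def single_add mult_single)

lemma Const_eq_0_iff [simp]: "Const c = 0 \<longleftrightarrow> c = 0"
  by (metis Const_def lookup_single_eq lookup_zero single_zero)

lemma Var_power: "(Var v :: ('v, 'c::comm_ring_1) mpoly) ^ k = single (single v k) 1"
proof (induction k)
  case (Suc k)
  then show ?case by (simp add: Var_def mult_single flip: single_add)
qed simp

lemma mval_Var: "mval Var m = (single m 1 :: ('v, 'c::comm_ring_1) mpoly)"
proof -
  have "(\<Prod>v\<in>A. single (single v (g v)) 1) = (single (\<Sum>v\<in>A. single v (g v)) 1 :: ('v, 'c) mpoly)"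
    if "finite A" for A g
    using that by induction (simp_all add: mult_single)
  then show ?thesis unfolding mval_def Var_power
    by (simp flip: poly_mapping_sum_single)
qed

lemma single_eq_Const_mult: "single m c = Const c * mval Var m" for c :: "'c::comm_ring_1"
  by (simp add: mval_Var Const_def mult_single)

lemma rhom_mval: "rhom F \<Longrightarrow> F (mval s m) = mval (\<lambda>v. F (s v)) m"
  by (simp add: mval_def rhom_simps)

text \<open>Universal property of the polynomial ring. Through \<open>rhom_eqI\<close> it reduces
  identities between composed substitutions to constants and variables.\<close>

lemma rhom_eq_poly_subst:
  assumes "rhom F" shows "F f = poly_subst (\<lambda>c. F (Const c)) (\<lambda>v. F (Var v)) f"
proof -
  have "F f = F (\<Sum>m\<in>keys f. Const (lookup f m) * mval Var m)"
    by (subst poly_mapping_sum_single[of f]) (simp add: single_eq_Const_mult)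
  then show ?thesis by (simp add: rhom_simps[OF assms] rhom_mval[OF assms] poly_subst_mval)
qed

lemma rhom_eqI:
  assumes "rhom F" "rhom G" "\<And>c. F (Const c) = G (Const c)" "\<And>v. F (Var v) = G (Var v)"
  shows "F f = G f"
  by (subst (1 2) rhom_eq_poly_subst) (auto simp: assms)

lemma poly_subst_cong:
  assumes "\<And>m v. m \<in> keys f \<Longrightarrow> v \<in> keys m \<Longrightarrow> s v = t v"
  shows "poly_subst h s f = poly_subst h t f"
  unfolding poly_subst_mval using assms by (intro sum.cong arg_cong2[of _ _ _ _ "(*)"] mval_cong) auto

lemma rhom_comp_poly_subst:
  assumes "rhom F" shows "F (poly_subst h s f) = poly_subst (\<lambda>c. F (h c)) (\<lambda>v. F (s v)) f"
  by (simp add: poly_subst_mval rhom_simps[OF assms] rhom_mval[OF assms])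

lemma poly_subst_Const_Var: "poly_subst Const Var f = f" for f :: "('v, 'c::comm_ring_1) mpoly"
  using rhom_eq_poly_subst[OF rhom_id, of f] by simp

definition mvars :: "('v, 'c::zero) mpoly \<Rightarrow> 'v set" where
  "mvars f = (\<Union>m\<in>keys f. keys m)"

lemma finite_mvars [simp]: "finite (mvars f)"
  by (simp add: mvars_def)

lemma poly_subst_cong_mvars:
  "(\<And>v. v \<in> mvars f \<Longrightarrow> s v = t v) \<Longrightarrow> poly_subst h s f = poly_subst h t f"
  by (rule poly_subst_cong) (auto simp: mvars_def)

hide_const (open) Polynomials.degree Polynomials.lead_coeff up_ring.coeff up_ring.monom

section \<open>Extension of points\<close>

text \<open>Division with remainder needs an invertible leading coefficient; multiplying h by a
  power of it replaces this. The degree bound on q is what later makes a quotient smaller than an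
  element of least degree.\<close>

lemma pseudo_division:
  fixes h r :: "'a::comm_ring_1 poly"
  assumes "r \<noteq> 0"
  shows "\<exists>k q s. Polynomial.smult (lead_coeff r ^ k) h = q * r + s \<and>
           (s = 0 \<or> degree s < degree r) \<and>
           degree q \<le> degree h - degree r"
proof (induction "degree h" arbitrary: h rule: less_induct)
  case less
  let ?c = "lead_coeff r" and ?n = "degree h" and ?d = "degree r"
  show ?case
  proof (cases "h = 0 \<or> ?n < ?d")
    case True
    then show ?thesis by - (rule exI[of _ 0], rule exI[of _ 0], rule exI[of _ h], auto)
  next
    case False
    define g where "g = Polynomial.smult ?c h - monom (lead_coeff h) (?n - ?d) * r"
    have deg: "degree g \<le> ?n"
      unfolding g_def
    proof (rule degree_diff_le)
      show "degree (Polynomial.smult ?c h) \<le> ?n" by (rule degree_smult_le)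
      have "degree (monom (lead_coeff h) (?n - ?d) * r) \<le>
          degree (monom (lead_coeff h) (?n - ?d)) + ?d" by (rule degree_mult_le)
      also have "\<dots> \<le> (?n - ?d) + ?d" by (simp add: degree_monom_le)
      finally show "degree (monom (lead_coeff h) (?n - ?d) * r) \<le> ?n"
        using False by simp
    qed
    have top: "coeff g ?n = 0"
      using False coeff_monom_mult[of "lead_coeff h" "?n - ?d" r ?n] by (simp add: g_def mult.commute)
    show ?thesis
    \<comment> \<open>In degree 0 cancelling the top term cannot lower the degree, but there the top
      term is all of g.\<close>
    proof (cases "?n = 0")
      case True
      then have "g = 0" using deg top by (metis le_zero_eq leading_coeff_0_iff)
      then have "Polynomial.smult (?c ^ 1) h = monom (lead_coeff h) (?n - ?d) * r + 0"
        by (simp add: g_def)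
      moreover have "degree (monom (lead_coeff h) (?n - ?d)) \<le> ?n - ?d"
        by (rule degree_monom_le)
      ultimately show ?thesis by blast
    next
      case ne: False
      have "degree g < ?n" using deg top ne
        by (cases "g = 0") (auto simp: le_less dest: leading_coeff_neq_0)
      from less[OF this] obtain k q s where IH: "Polynomial.smult (?c ^ k) g = q * r + s"
        "s = 0 \<or> degree s < ?d" "degree q \<le> degree g - ?d" by blast
      let ?m = "monom (?c ^ k * lead_coeff h) (?n - ?d)"
      have "Polynomial.smult (?c ^ k) g
          = Polynomial.smult (?c ^ Suc k) h - ?m * r"
        by (simp add: g_def smult_diff_right smult_monom mult.commute[of ?c] flip: mult_smult_left)
      with IH(1) have "Polynomial.smult (?c ^ Suc k) h = (q + ?m) * r + s"
        by (simp add: algebra_simps)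
      moreover have "degree (q + ?m) \<le> ?n - ?d"
        using IH(3) deg by (intro degree_add_le degree_monom_le) simp
      ultimately show ?thesis using IH(2) by blast
    qed
  qed
qed

text \<open>This is a nonzero element of least degree in the image of I over the residue ring modulo
  q, phrased without the quotient: terms with coefficients in q belong to I and can be stripped off,
  so a leading coefficient may be assumed to lie outside q.\<close>

lemma min_degree_elem:
  fixes I :: "'a::comm_ring_1 poly set"
  assumes I: "tideal I" and qI: "\<And>p. (\<And>i. coeff p i \<in> q) \<Longrightarrow> p \<in> I"
    and q: "tideal q" and ex: "b \<in> I" "coeff b i \<notin> q"
  shows "\<exists>r\<in>I. lead_coeff r \<notin> q \<and> (\<forall>p\<in>I. \<forall>i.
    p = 0 \<or> degree p < degree r \<longrightarrow> coeff p i \<in> q)"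
proof -
  define S where "S = {n. \<exists>p\<in>I. degree p = n \<and> lead_coeff p \<notin> q}"
  have low: "\<exists>n\<in>S. n \<le> degree p" if "p \<in> I" "coeff p i \<notin> q" for p i
    using that
  proof (induction "degree p" arbitrary: p rule: less_induct)
    case less
    show ?case
    proof (cases "lead_coeff p \<in> q")
      case False
      then show ?thesis using less.prems by (auto simp: S_def)
    next
      case True
      let ?m = "monom (lead_coeff p) (degree p)"
      define p' where "p' = p - ?m"
      have "?m \<in> I" using True tideal_0[OF q] by (intro qI) auto
      then have p'I: "p' \<in> I" unfolding p'_def using I less.prems tideal_diff by blast
      have ci: "coeff p' i \<notin> q"
      proof (cases "i = degree p")
        case True
        then show ?thesis using \<open>lead_coeff p \<in> q\<close> less.prems by simp
      next
        case False
        then show ?thesis using less.prems by (simp add: p'_def)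
      qed
      have "degree p' \<le> degree p"
        unfolding p'_def by (intro degree_diff_le degree_monom_le) simp
      moreover have "coeff p' (degree p) = 0" by (simp add: p'_def)
      moreover have "p' \<noteq> 0" using ci tideal_0[OF q] by auto
      ultimately have lt: "degree p' < degree p"
        by (auto simp: le_less dest: leading_coeff_neq_0)
      from less.hyps[OF lt p'I ci] lt show ?thesis by (meson less_imp_le order_trans)
    qed
  qed
  have "S \<noteq> {}" using low[OF ex] by auto
  then have "(LEAST n. n \<in> S) \<in> S" by (auto intro: LeastI)
  then obtain r where r: "r \<in> I" "degree r = (LEAST n. n \<in> S)" "lead_coeff r \<notin> q"
    by (auto simp: S_def)
  show ?thesis
  proof (intro bexI[OF _ r(1)] conjI r(3) ballI allI impI)
    fix p i assume p: "p \<in> I" "p = 0 \<or> degree p < degree r"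
    show "coeff p i \<in> q"
    proof (rule ccontr)
      assume c: "coeff p i \<notin> q"
      with low[OF p(1) c] obtain n where n: "n \<in> S" "n \<le> degree p" by blast
      moreover have "p \<noteq> 0" using c tideal_0[OF q] by auto
      ultimately show False using p(2) r(2) Least_le[of "\<lambda>n. n \<in> S" n] by simp
    qed
  qed
qed

lemma rhom_poly_map_poly:
  fixes \<psi> :: "'a::comm_ring_1 \<Rightarrow> 'k::comm_ring_1"
  assumes "rhom \<psi>" shows "rhom (\<lambda>h. poly (map_poly \<psi> h) t)"
proof -
  have add: "map_poly \<psi> (p + q) = map_poly \<psi> p + map_poly \<psi> q" for p q
    by (rule poly_eqI) (simp add: coeff_map_poly rhom_simps[OF assms])
  have mult: "map_poly \<psi> (p * q) = map_poly \<psi> p * map_poly \<psi> q" for p q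
    by (rule poly_eqI) (simp add: coeff_map_poly rhom_simps[OF assms] coeff_mult)
  show ?thesis by (rule rhomI) (simp_all add: add mult rhom_simps[OF assms])
qed

text \<open>If \<open>Q\<close> is not extended from the coefficients, let \<open>m\<close> be an element of least degree whose leading
  coefficient is not in \<open>Q\<close>; pseudo-division by \<open>m\<close> shows that every root of \<open>m\<close> is a zero of \<open>Q\<close>.
  Likewise the ideal \<open>Q + (b)\<close> contains a constant outside \<open>Q\<close>, which bounds \<open>b\<close> away from \<open>0\<close>.\<close>

lemma point_extension:
  fixes Q :: "'a::comm_ring_1 poly set"
  assumes Q: "tprime Q" and b: "b \<notin> Q" and inf: "infinite (UNIV :: 'k::alg_closed_field set)"
  obtains a where "[:a:] \<notin> Q"
    "\<And>\<psi> :: 'a \<Rightarrow> 'k. rhom \<psi> \<Longrightarrow> (\<And>c. [:c:] \<in> Q \<Longrightarrow> \<psi> c = 0) \<Longrightarrow> \<psi> a \<noteq> 0 \<Longrightarrow>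
      \<exists>t. (\<forall>h\<in>Q. poly (map_poly \<psi> h) t = 0) \<and> poly (map_poly \<psi> b) t \<noteq> 0"
proof -
  define q where "q = {c. [:c:] \<in> Q}"
  have rC: "rhom (\<lambda>c::'a. [:c:])" by (rule rhomI) auto
  have q: "tprime q" unfolding q_def by (rule tprime_vimage[OF rC Q])
  note tq = tprime_tideal[OF q] and tQ = tprime_tideal[OF Q]
  have qQ: "p \<in> Q" if "\<And>i. coeff p i \<in> q" for p
  proof -
    have "p = (\<Sum>i\<le>degree p. monom 1 i * [:coeff p i:])"
      by (subst poly_as_sum_of_monoms[symmetric]) (simp add: smult_monom)
    also have "\<dots> \<in> Q" using that by (intro tideal_sum[OF tQ] tideal_mult[OF tQ]) (auto simp: q_def)
    finally show ?thesis .
  qed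
  have smultQ: "Polynomial.smult c p \<in> Q \<longleftrightarrow> c \<in> q \<or> p \<in> Q" for c p
    using tprime_mult_iff[OF Q, of "[:c:]" p] by (simp add: q_def)
  show thesis
  proof (cases "\<forall>m\<in>Q. \<forall>i. coeff m i \<in> q")
    case True
    \<comment> \<open>Here Q consists of the polynomials with coefficients in q. So t only has to
      avoid the finitely many roots of the image of b, and a coefficient of b outside q keeps that
      image nonzero.\<close>
    from b qQ obtain i where i: "coeff b i \<notin> q" by blast
    show thesis
    proof (rule that)
      show "[:coeff b i:] \<notin> Q" using i by (simp add: q_def)
      fix \<psi> :: "'a \<Rightarrow> 'k"
      assume \<psi>: "rhom \<psi>" "\<And>c. [:c:] \<in> Q \<Longrightarrow> \<psi> c = 0" "\<psi> (coeff b i) \<noteq> 0"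
      have "map_poly \<psi> b \<noteq> 0" using \<psi>(3) rhom_0[OF \<psi>(1)]
        by (metis coeff_0 coeff_map_poly)
      then have "finite {t. poly (map_poly \<psi> b) t = 0}" by (rule poly_roots_finite)
      with inf obtain t where t: "poly (map_poly \<psi> b) t \<noteq> 0"
        by (metis (mono_tags, lifting) UNIV_eq_I mem_Collect_eq)
      have "map_poly \<psi> h = 0" if "h \<in> Q" for h
        using True that \<psi>(2) by (intro poly_eqI) (simp add: coeff_map_poly rhom_0[OF \<psi>(1)] q_def)
      with t show "\<exists>t. (\<forall>h\<in>Q. poly (map_poly \<psi> h) t = 0) \<and> poly (map_poly \<psi> b) t \<noteq> 0" by auto
    qed
  next
    case False
    then obtain m0 i0 where m0: "m0 \<in> Q" "coeff m0 i0 \<notin> q" by blast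
    obtain m where m: "m \<in> Q" "lead_coeff m \<notin> q" and mmin:
      "\<And>p i. p \<in> Q \<Longrightarrow> p = 0 \<or> degree p < degree m \<Longrightarrow> coeff p i \<in> q"
      using min_degree_elem[OF tQ qQ tq m0] by blast
    have mdeg: "degree m > 0"
    proof (rule ccontr)
      assume "\<not> ?thesis"
      then obtain c where "m = [:c:]" by (auto elim: degree_eq_zeroE)
      with m show False by (simp add: q_def)
    qed
    define B where "B = {u * b + w | u w. w \<in> Q}"
    have BI: "u * b + w \<in> B" if "w \<in> Q" for u w using that by (auto simp: B_def)
    have QB: "Q \<subseteq> B" using BI[of _ 0] by auto
    have tB: "tideal B"
      unfolding tideal_def
    proof (intro conjI ballI allI)
      show "0 \<in> B" using QB tideal_0[OF tQ] by blast
    next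
      fix x y assume "x \<in> B" "y \<in> B"
      then obtain u w u' w' where "x = u * b + w" "y = u' * b + w'" "w \<in> Q" "w' \<in> Q"
        by (auto simp: B_def)
      then show "x + y \<in> B" using BI[OF tideal_add[OF tQ, of w w'], of "u + u'"]
        by (simp add: algebra_simps)
    next
      fix r x assume "x \<in> B"
      then obtain u w where "x = u * b + w" "w \<in> Q" by (auto simp: B_def)
      then show "r * x \<in> B" using BI[OF tideal_mult[OF tQ, of w r], of "r * u"]
        by (simp add: algebra_simps)
    qed
    have bB: "b \<in> B" using BI[OF tideal_0[OF tQ], of 1] by simp
    obtain i where bi: "coeff b i \<notin> q" using b qQ by blast
    obtain r where r: "r \<in> B" "lead_coeff r \<notin> q" and rmin:
      "\<And>p i. p \<in> B \<Longrightarrow> p = 0 \<or> degree p < degree r \<Longrightarrow> coeff p i \<in> q"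
      using min_degree_elem[OF tB _ tq bB bi] qQ QB by blast
    have r0: "r \<noteq> 0" using r(2) tideal_0[OF tq] by auto
    have m0': "m \<noteq> 0" using m(2) tideal_0[OF tq] by auto
    have pw: "c ^ k \<notin> q" if "c \<notin> q" for c k using tprime_power[OF q] that by blast
    have rdiv: "\<exists>k g s. Polynomial.smult (lead_coeff r ^ k) h = g * r + s \<and> s \<in> Q \<and> (\<forall>i. coeff s i \<in> q) \<and>
         degree g \<le> degree h - degree r" if "h \<in> B" for h
    proof -
      obtain k g s where 1: "Polynomial.smult (lead_coeff r ^ k) h = g * r + s"
        "s = 0 \<or> degree s < degree r"
        "degree g \<le> degree h - degree r"
        using pseudo_division[OF r0] by blast
      have "s = [:lead_coeff r ^ k:] * h - g * r" using 1(1) by simp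
      then have "s \<in> B" using that r(1) tB by (metis tideal_diff tideal_mult)
      with rmin 1(2) have "\<forall>i. coeff s i \<in> q" by blast
      with 1 qQ show ?thesis by blast
    qed
    have rQ: "r \<notin> Q"
    proof
      assume "r \<in> Q"
      obtain k g s where "Polynomial.smult (lead_coeff r ^ k) b = g * r + s" "s \<in> Q"
        using rdiv[OF bB] by blast
      then have "Polynomial.smult (lead_coeff r ^ k) b \<in> Q"
        using \<open>r \<in> Q\<close> tQ by (simp add: tideal_add tideal_mult)
      with smultQ b pw[OF r(2)] show False by blast
    qed
    \<comment> \<open>If r had positive degree, dividing m by it would give a quotient in Q of
      smaller degree than m, whose coefficients therefore lie in q. Then a power of the leading
      coefficient of r times that of m would lie in q as well.\<close>
    have rdeg: "degree r = 0"
    proof (rule ccontr)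
      assume pos: "degree r \<noteq> 0"
      obtain k g s where 1: "Polynomial.smult (lead_coeff r ^ k) m = g * r + s" "s \<in> Q"
        "\<forall>i. coeff s i \<in> q" "degree g \<le> degree m - degree r"
        using rdiv[of m] m QB by blast
      have "g * r = [:lead_coeff r ^ k:] * m - s" using 1(1) by simp
      then have "g * r \<in> Q" using m(1) 1(2) tQ by (metis tideal_diff tideal_mult)
      then have "g \<in> Q" using rQ tprime_mult[OF Q] by blast
      moreover have "degree g < degree m" using 1(4) pos mdeg by linarith
      ultimately have g: "\<forall>i. coeff g i \<in> q" using mmin by blast
      have "coeff (g * r + s) i \<in> q" for i
        using g 1(3) by (auto simp: coeff_mult intro!: tideal_add[OF tq] tideal_sum[OF tq] tideal_mult'[OF tq])
      from this[of "degree m"] have "lead_coeff r ^ k * lead_coeff m \<in> q" by (simp flip: 1(1))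
      then show False using tprime_mult[OF q] pw[OF r(2)] m(2) by blast
    qed
    then obtain c where c: "r = [:c:]" by (auto elim: degree_eq_zeroE)
    from r(1) obtain u w where uw: "[:c:] = u * b + w" "w \<in> Q" by (auto simp: B_def c)
    show thesis
    proof (rule that)
      \<comment> \<open>The two factors have separate tasks. If \<open>\<psi> (lead_coeff m)\<close>
        is nonzero, the image of m keeps its degree and has a root t, which is then a zero of all of
        Q. If \<open>\<psi> c\<close> is nonzero, the equation c = u b + w forces b to be nonzero at
        t.\<close>
      have "lead_coeff m * c \<notin> q" using tprime_mult[OF q] m(2) r(2) c by auto
      then show "[:lead_coeff m * c:] \<notin> Q" by (simp add: q_def)
      fix \<psi> :: "'a \<Rightarrow> 'k"
      assume \<psi>: "rhom \<psi>" and \<psi>q: "\<And>c. [:c:] \<in> Q \<Longrightarrow> \<psi> c = 0" and nz: "\<psi> (lead_coeff m * c) \<noteq> 0"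
      have nz': "\<psi> (lead_coeff m) \<noteq> 0" "\<psi> c \<noteq> 0" using nz by (auto simp: rhom_simps[OF \<psi>])
      have "degree (map_poly \<psi> m) > 0"
        using nz' mdeg by (simp add: map_poly_degree_eq)
      then obtain t where t: "poly (map_poly \<psi> m) t = 0" using alg_closed_imp_poly_has_root by blast
      note ev = rhom_poly_map_poly[OF \<psi>, of t]
      have van: "poly (map_poly \<psi> h) t = 0" if "h \<in> Q" for h
      proof -
        obtain k g s where 1: "Polynomial.smult (lead_coeff m ^ k) h = g * m + s"
            "s = 0 \<or> degree s < degree m"
          using pseudo_division[OF m0'] by blast
        have "s = [:lead_coeff m ^ k:] * h - g * m" using 1(1) by simp
        then have "s \<in> Q" using m(1) that tQ by (metis tideal_diff tideal_mult)
        then have "\<And>i. coeff s i \<in> q" using mmin 1(2) by blast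
        then have s0: "map_poly \<psi> s = 0"
          using \<psi>q by (intro poly_eqI) (simp add: coeff_map_poly rhom_0[OF \<psi>] q_def)
        have "poly (map_poly \<psi> ([:lead_coeff m ^ k:] * h)) t = poly (map_poly \<psi> (g * m + s)) t"
          using 1(1) by simp
        then have "\<psi> (lead_coeff m) ^ k * poly (map_poly \<psi> h) t = 0"
          unfolding rhom_mult[OF ev] rhom_add[OF ev] s0 t
          by (simp add: rhom_simps[OF \<psi>] map_poly_pCons)
        then show ?thesis using nz' by simp
      qed
      have "\<psi> c = poly (map_poly \<psi> (u * b + w)) t"
        by (simp add: rhom_0[OF \<psi>] map_poly_pCons flip: uw(1))
      also have "\<dots> = poly (map_poly \<psi> u) t * poly (map_poly \<psi> b) t"
        unfolding rhom_mult[OF ev] rhom_add[OF ev] by (simp add: van[OF uw(2)])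
      finally show "\<exists>t. (\<forall>h\<in>Q. poly (map_poly \<psi> h) t = 0) \<and> poly (map_poly \<psi> b) t \<noteq> 0"
        using van nz' by auto
    qed
  qed
qed

section \<open>Adjoining finitely many variables, and the Nullstellensatz\<close>

definition restrict_vars :: "'v set \<Rightarrow> ('v, 'c::comm_ring_1) mpoly \<Rightarrow> ('v, 'c) mpoly" where
  "restrict_vars W = poly_subst Const (\<lambda>v. if v \<in> W then Var v else 0)"

lemma rhom_restrict_vars [simp]: "rhom (restrict_vars W)"
  unfolding restrict_vars_def by (rule rhom_poly_subst) simp

lemma restrict_vars_Const [simp]: "restrict_vars W (Const c) = Const c"
  by (simp add: restrict_vars_def poly_subst_Const)

lemma restrict_vars_Var [simp]: "restrict_vars W (Var v) = (if v \<in> W then Var v else 0)"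
  by (simp add: restrict_vars_def poly_subst_Var)

lemma restrict_vars_ident: "mvars f \<subseteq> W \<Longrightarrow> restrict_vars W f = f"
  unfolding restrict_vars_def
  by (subst (2) poly_subst_Const_Var[symmetric], rule poly_subst_cong_mvars) auto

lemma mval_zero: "m \<noteq> 0 \<Longrightarrow> mval (\<lambda>_. 0) m = 0"
proof -
  assume "m \<noteq> 0"
  then obtain v where "lookup m v \<noteq> 0" by (metis lookup_zero poly_mapping_eqI)
  then have "v \<in> keys m" by (simp add: in_keys_iff)
  then show "mval (\<lambda>_. 0) m = 0"
    unfolding mval_def by (intro prod_zero bexI[of _ v]) (auto simp: in_keys_iff power_0_left)
qed

text \<open>One variable after the other is adjoined to \<open>W\<close>.  Setting the variables outside \<open>W\<close> to \<open>0\<close>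
  replaces the passage to the polynomial ring in \<open>W\<close>, which is not a type.\<close>

lemma restrict_vars_extension:
  fixes Q :: "('v, 'c::comm_ring_1) mpoly set"
  assumes inf: "infinite (UNIV :: 'k::alg_closed_field set)" and Q: "tprime Q" and W: "finite W"
    and f: "restrict_vars W f \<notin> Q"
  shows "\<exists>a. Const a \<notin> Q \<and> (\<forall>\<psi> :: 'c \<Rightarrow> 'k. rhom \<psi> \<longrightarrow> (\<forall>c. Const c \<in> Q \<longrightarrow> \<psi> c = 0) \<longrightarrow> \<psi> a \<noteq> 0 \<longrightarrow>
      (\<exists>p. (\<forall>h. restrict_vars W h \<in> Q \<longrightarrow> poly_subst \<psi> p h = 0) \<and> poly_subst \<psi> p f \<noteq> 0))"
  using W f
proof (induction W arbitrary: f rule: finite_induct)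
  case empty
  have const: "restrict_vars {} h = Const (lookup h 0)" for h :: "('v, 'c) mpoly"
  proof -
    have "restrict_vars {} h = (\<Sum>m\<in>keys h. if m = 0 then Const (lookup h m) else 0)"
      unfolding restrict_vars_def poly_subst_mval
    proof (intro sum.cong refl)
      fix m assume "m \<in> keys h"
      show "Const (lookup h m) * mval (\<lambda>v. if v \<in> {} then Var v else 0) m =
          (if m = 0 then Const (lookup h m) else 0)"
        by (simp add: mval_zero)
    qed
    also have "\<dots> = Const (lookup h 0)" by (auto simp: sum.delta' in_keys_iff)
    finally show ?thesis .
  qed
  have ev: "poly_subst \<psi> (\<lambda>_. 0) h = \<psi> (lookup h 0)" if "rhom \<psi>" for \<psi> :: "'c \<Rightarrow> 'k" and h :: "('v, 'c) mpoly"
  proof -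
    have "poly_subst \<psi> (\<lambda>_. 0) (restrict_vars {} h) = poly_subst \<psi> (\<lambda>_. 0) h"
      by (rule rhom_eqI[OF rhom_comp[OF rhom_poly_subst[OF that] rhom_restrict_vars] rhom_poly_subst[OF that]])
         (simp_all add: poly_subst_Const poly_subst_Var that rhom_0[OF that] rhom_0[OF rhom_poly_subst[OF that]])
    then show ?thesis by (simp add: const poly_subst_Const rhom_0[OF that])
  qed
  show ?case
    using empty unfolding const by (intro exI[of _ "lookup f 0"] conjI allI impI exI[of _ "\<lambda>_. 0"]) (auto simp: ev)
next
  case (insert v W)
  \<comment> \<open>\<open>\<delta>\<close> reads v as the variable of a univariate polynomial, and
    \<open>\<sigma>\<close> substitutes v back after restricting the coefficients to W. Together
    they restrict to \<open>insert v W\<close>, so Q pulls back along \<open>\<sigma>\<close> to a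
    prime for the one-variable lemma.\<close>
  define \<sigma> where "\<sigma> = (\<lambda>q. poly (map_poly (restrict_vars W) q) (Var v :: ('v, 'c) mpoly))"
  define \<delta> where "\<delta> = poly_subst (\<lambda>c. [:Const c:]) (\<lambda>u. if u = v then [:0, 1:] else [:Var u :: ('v, 'c) mpoly:])"
  have \<sigma>: "rhom \<sigma>" unfolding \<sigma>_def by (rule rhom_poly_map_poly) simp
  have rc: "rhom (\<lambda>c. [:Const c :: ('v, 'c) mpoly:])"
    by (rule rhom_comp[of "\<lambda>c. [:c:]" Const]) (auto intro: rhomI)
  then have \<delta>: "rhom \<delta>" unfolding \<delta>_def by (rule rhom_poly_subst)
  have \<delta>C: "\<delta> (Const c) = [:Const c:]" and \<delta>V: "\<delta> (Var u) = (if u = v then [:0, 1:] else [:Var u:])" for c u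
    by (simp_all add: \<delta>_def poly_subst_Const poly_subst_Var rc)
  have R0: "restrict_vars W 0 = 0" and R1: "restrict_vars W 1 = 1"
    using rhom_restrict_vars rhom_0 rhom_1 by blast+
  have \<sigma>\<delta>: "\<sigma> (\<delta> h) = restrict_vars (insert v W) h" for h
    by (rule rhom_eqI[OF rhom_comp[OF \<sigma> \<delta>] rhom_restrict_vars])
       (simp_all add: \<delta>C \<delta>V, simp_all add: \<sigma>_def map_poly_pCons R0 R1)
  define Q' where "Q' = {q. \<sigma> q \<in> Q}"
  have Q': "tprime Q'" unfolding Q'_def by (rule tprime_vimage[OF \<sigma> Q])
  have cQ': "[:c:] \<in> Q' \<longleftrightarrow> restrict_vars W c \<in> Q" for c
    by (simp add: Q'_def \<sigma>_def map_poly_pCons R0)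
  have "\<delta> f \<notin> Q'" using insert.prems by (simp add: Q'_def \<sigma>\<delta>)
  from point_extension[OF Q' this inf] obtain a1 where a1: "[:a1:] \<notin> Q'" and ext:
    "\<And>\<psi> :: ('v, 'c) mpoly \<Rightarrow> 'k. rhom \<psi> \<Longrightarrow> (\<And>c. [:c:] \<in> Q' \<Longrightarrow> \<psi> c = 0) \<Longrightarrow> \<psi> a1 \<noteq> 0 \<Longrightarrow>
      \<exists>t. (\<forall>h\<in>Q'. poly (map_poly \<psi> h) t = 0) \<and> poly (map_poly \<psi> (\<delta> f)) t \<noteq> 0" by blast
  \<comment> \<open>The element a1 from the one-variable step is itself a polynomial; it is what the
    induction hypothesis has to keep nonzero.\<close>
  from insert.IH[of a1] a1 obtain a where a: "Const a \<notin> Q" and IH: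
    "\<And>\<psi> :: 'c \<Rightarrow> 'k. rhom \<psi> \<Longrightarrow> (\<And>c. Const c \<in> Q \<Longrightarrow> \<psi> c = 0) \<Longrightarrow> \<psi> a \<noteq> 0 \<Longrightarrow>
      \<exists>p. (\<forall>h. restrict_vars W h \<in> Q \<longrightarrow> poly_subst \<psi> p h = 0) \<and> poly_subst \<psi> p a1 \<noteq> 0"
    unfolding cQ' by blast
  show ?case
  proof (intro exI[of _ a] conjI a allI impI)
    fix \<psi> :: "'c \<Rightarrow> 'k" assume \<psi>: "rhom \<psi>" "\<forall>c. Const c \<in> Q \<longrightarrow> \<psi> c = 0" "\<psi> a \<noteq> 0"
    from IH[of \<psi>] \<psi> obtain p where p: "\<And>h. restrict_vars W h \<in> Q \<Longrightarrow> poly_subst \<psi> p h = 0" "poly_subst \<psi> p a1 \<noteq> 0"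
      by blast
    note ev = rhom_poly_subst[OF \<psi>(1), of p]
    from ext[of "poly_subst \<psi> p"] ev p cQ' obtain t where
      t: "\<And>h. h \<in> Q' \<Longrightarrow> poly (map_poly (poly_subst \<psi> p) h) t = 0" "poly (map_poly (poly_subst \<psi> p) (\<delta> f)) t \<noteq> 0"
      by blast
    have eq: "poly (map_poly (poly_subst \<psi> p) (\<delta> h)) t = poly_subst \<psi> (p(v := t)) h" for h
      by (rule rhom_eqI[OF rhom_comp[OF rhom_poly_map_poly[OF ev] \<delta>] rhom_poly_subst[OF \<psi>(1)]])
         (simp_all add: \<delta>C \<delta>V map_poly_pCons poly_subst_Const poly_subst_Var \<psi>(1) rhom_0[OF \<psi>(1)] rhom_0[OF ev] rhom_1[OF ev])
    show "\<exists>p. (\<forall>h. restrict_vars (insert v W) h \<in> Q \<longrightarrow> poly_subst \<psi> p h = 0) \<and> poly_subst \<psi> p f \<noteq> 0"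
    proof (intro exI[of _ "p(v := t)"] conjI allI impI)
      fix h assume "restrict_vars (insert v W) h \<in> Q"
      then have "\<delta> h \<in> Q'" by (simp add: Q'_def \<sigma>\<delta>)
      from t(1)[OF this] show "poly_subst \<psi> (p(v := t)) h = 0" by (simp add: eq)
    qed (use t(2) in \<open>simp add: eq\<close>)
  qed
qed

text \<open>The case of \<open>restrict_vars_extension\<close> with all variables and the identity
  on K. Nonzero constants are units, so P contains none of them, and the condition on a holds as
  soon as a is nonzero.\<close>

lemma Nullstellensatz:
  fixes P :: "('v::finite, 'k::alg_closed_field) mpoly set"
  assumes inf: "infinite (UNIV :: 'k set)" and P: "tprime P" and f: "f \<notin> P"
  obtains p where "\<And>h. h \<in> P \<Longrightarrow> poly_subst (\<lambda>c. c) p h = 0" "poly_subst (\<lambda>c. c) p f \<noteq> 0"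
proof -
  have c0: "c = 0" if "Const c \<in> P" for c
  proof (rule ccontr)
    assume "c \<noteq> 0"
    then have "Const (inverse c) * Const c = (1 :: ('v, 'k) mpoly)"
      by (simp add: Const_1 flip: rhom_mult[OF rhom_Const])
    then show False using tideal_mult[OF tprime_tideal[OF P] that, of "Const (inverse c)"] tprime_1[OF P] by simp
  qed
  have all: "restrict_vars UNIV h = h" for h :: "('v, 'k) mpoly" by (rule restrict_vars_ident) simp
  have "restrict_vars UNIV f \<notin> P" using f by (simp add: all)
  from restrict_vars_extension[where 'k = 'k, OF inf P finite this]
  obtain a where "Const a \<notin> P" and a: "\<forall>\<psi> :: 'k \<Rightarrow> 'k. rhom \<psi> \<longrightarrow> (\<forall>c. Const c \<in> P \<longrightarrow> \<psi> c = 0) \<longrightarrow> \<psi> a \<noteq> 0 \<longrightarrow>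
      (\<exists>p. (\<forall>h. h \<in> P \<longrightarrow> poly_subst \<psi> p h = 0) \<and> poly_subst \<psi> p f \<noteq> 0)"
    unfolding all by (elim exE conjE)
  have "a \<noteq> 0"
  proof
    assume "a = 0"
    with \<open>Const a \<notin> P\<close> show False by (simp add: rhom_0[OF rhom_Const] tideal_0[OF tprime_tideal[OF P]])
  qed
  moreover have "\<forall>c. Const c \<in> P \<longrightarrow> c = 0" using c0 by blast
  ultimately have "\<exists>p. (\<forall>h. h \<in> P \<longrightarrow> poly_subst (\<lambda>c. c) p h = 0) \<and> poly_subst (\<lambda>c. c) p f \<noteq> 0"
    using a[THEN spec, of "\<lambda>c. c"] by simp
  then show thesis using that by auto
qed

section \<open>A linear criterion for flatness\<close>

text \<open>\<open>flat_module\<close> quantifies over modules whose elements are sets of sequences,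
  so a sequence is represented by its singleton.\<close>

definition fun_module :: "('r, 'c) ring_scheme \<Rightarrow> (nat \<Rightarrow> 'r) set \<Rightarrow> ('r, (nat \<Rightarrow> 'r) set) module" where
  "fun_module R W = \<lparr>carrier = (\<lambda>f. {f}) ` W, monoid.mult = (\<lambda>x y. x), one = {},
     ring.zero = {\<lambda>_. \<zero>\<^bsub>R\<^esub>}, add = (\<lambda>x y. {\<lambda>i. the_elem x i \<oplus>\<^bsub>R\<^esub> the_elem y i}),
     smult = (\<lambda>r x. {\<lambda>i. r \<otimes>\<^bsub>R\<^esub> the_elem x i})\<rparr>"

lemma fun_module_simps [simp]:
  "carrier (fun_module R W) = (\<lambda>f. {f}) ` W"
  "\<zero>\<^bsub>fun_module R W\<^esub> = {\<lambda>_. \<zero>\<^bsub>R\<^esub>}"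
  "x \<oplus>\<^bsub>fun_module R W\<^esub> y = {\<lambda>i. the_elem x i \<oplus>\<^bsub>R\<^esub> the_elem y i}"
  "r \<odot>\<^bsub>fun_module R W\<^esub> x = {\<lambda>i. r \<otimes>\<^bsub>R\<^esub> the_elem x i}"
  by (simp_all add: fun_module_def)

lemma (in cring) module_fun_module:
  assumes "\<And>f i. f \<in> W \<Longrightarrow> f i \<in> carrier R" "(\<lambda>_. \<zero>) \<in> W"
    "\<And>f g. f \<in> W \<Longrightarrow> g \<in> W \<Longrightarrow> (\<lambda>i. f i \<oplus> g i) \<in> W" "\<And>r f. r \<in> carrier R \<Longrightarrow> f \<in> W \<Longrightarrow> (\<lambda>i. r \<otimes> f i) \<in> W"
  shows "module R (fun_module R W)"
proof (rule moduleI)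
  show "abelian_group (fun_module R W)"
  proof (rule abelian_groupI)
    fix x assume "x \<in> carrier (fun_module R W)"
    then obtain f where f: "x = {f}" "f \<in> W" by auto
    have "\<ominus> \<one> \<otimes> f i \<oplus> f i = \<zero>" for i using assms(1)[OF f(2)] by (simp add: l_minus l_neg)
    show "\<exists>y\<in>carrier (fun_module R W). y \<oplus>\<^bsub>fun_module R W\<^esub> x = \<zero>\<^bsub>fun_module R W\<^esub>"
    proof (rule bexI[of _ "{\<lambda>i. \<ominus> \<one> \<otimes> f i}"])
      show "{\<lambda>i. \<ominus> \<one> \<otimes> f i} \<oplus>\<^bsub>fun_module R W\<^esub> x = \<zero>\<^bsub>fun_module R W\<^esub>"
        by (simp add: f(1) \<open>\<And>i. \<ominus> \<one> \<otimes> f i \<oplus> f i = \<zero>\<close>)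
    qed (use assms(4)[of "\<ominus> \<one>" f] f(2) in simp)
  qed (use assms in \<open>auto simp: a_ac\<close>)
qed (use assms in \<open>auto simp: l_distr r_distr m_assoc intro: cring_axioms\<close>)

lemma generate_free_subset:
  assumes "Z \<in> generate (free_Abelian_group S) H" "H \<subseteq> carrier (free_Abelian_group S)"
    and "0 \<in> D" "\<And>x y. x \<in> D \<Longrightarrow> y \<in> D \<Longrightarrow> x + y \<in> D" "\<And>x. x \<in> D \<Longrightarrow> - x \<in> D" "H \<subseteq> D"
  shows "Z \<in> D"
  using assms(1) by (induction rule: generate.induct) (use assms(2-) in \<open>auto simp: subset_iff\<close>)

text \<open>Makes v well defined modulo T in t + a v: multiplication by a carries the difference of
  two choices into T. Negation is written as multiplication by the negative of 1 because T is only
  assumed to be closed under sums and multiples.\<close>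

lemma (in cring) cancel_decomposition:
  assumes "t1 \<in> carrier R" "t2 \<in> carrier R" "v1 \<in> carrier R" "v2 \<in> carrier R" "a \<in> carrier R"
    and "t1 \<oplus> a \<otimes> v1 = t2 \<oplus> a \<otimes> v2"
  shows "a \<otimes> (v1 \<oplus> \<ominus> \<one> \<otimes> v2) = t2 \<oplus> \<ominus> \<one> \<otimes> t1"
proof -
  have "a \<otimes> (v1 \<oplus> \<ominus> \<one> \<otimes> v2) = (t1 \<oplus> a \<otimes> v1) \<oplus> \<ominus> (a \<otimes> v2) \<oplus> \<ominus> t1"
    using assms(1-5) by (simp add: r_distr l_minus r_minus) algebra
  also have "\<dots> = t2 \<oplus> \<ominus> \<one> \<otimes> t1"
    unfolding assms(6) using assms(1-5) by (simp add: l_minus) algebra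
  finally show ?thesis .
qed

text \<open>The generators inside \<open>tensor_relations\<close>, under a name to which inductions
  over the generated subgroup can refer.\<close>

definition tensor_gens ::
  "('r, 'c) ring_scheme \<Rightarrow> ('r, 'm, 'd) module_scheme \<Rightarrow> ('r, 'n, 'e) module_scheme \<Rightarrow> (('m \<times> 'n) \<Rightarrow>\<^sub>0 int) set" where
  "tensor_gens A M N =
     {frag_of (x \<oplus>\<^bsub>M\<^esub> x', y) - frag_of (x, y) - frag_of (x', y) | x x' y.
         x \<in> carrier M \<and> x' \<in> carrier M \<and> y \<in> carrier N} \<union>
      {frag_of (x, y \<oplus>\<^bsub>N\<^esub> y') - frag_of (x, y) - frag_of (x, y') | x y y'.
         x \<in> carrier M \<and> y \<in> carrier N \<and> y' \<in> carrier N} \<union>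
      {frag_of (a \<odot>\<^bsub>M\<^esub> x, y) - frag_of (x, a \<odot>\<^bsub>N\<^esub> y) | a x y.
         a \<in> carrier A \<and> x \<in> carrier M \<and> y \<in> carrier N}"

lemma tensor_gens_carrier:
  assumes "module A M" "module A N"
  shows "tensor_gens A M N \<subseteq> carrier (free_Abelian_group (carrier M \<times> carrier N))"
proof
  interpret M: module A M by fact
  interpret N: module A N by fact
  have k2: "keys (frag_of p - frag_of q) \<subseteq> {p, q}" for p q :: "'c \<times> 'e"
    using keys_diff[of "frag_of p" "frag_of q"] by auto
  have k: "keys (frag_of p - frag_of q) \<subseteq> S" if "p \<in> S" "q \<in> S" for p q :: "'c \<times> 'e" and S
    using k2[of p q] that by blast
  have k': "keys (frag_of p - frag_of q - frag_of r) \<subseteq> S" if "p \<in> S" "q \<in> S" "r \<in> S" for p q r :: "'c \<times> 'e" and S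
    using keys_diff[of "frag_of p - frag_of q" "frag_of r"] k2[of p q] that by auto
  fix w assume "w \<in> tensor_gens A M N"
  then show "w \<in> carrier (free_Abelian_group (carrier M \<times> carrier N))"
    unfolding tensor_gens_def Un_iff carrier_free_Abelian_group_iff
    by (elim disjE CollectE exE conjE; hypsubst; intro k k') (auto)
qed

text \<open>Flatness is used for the inclusion of \<open>T + a R\<^sup>s\<close> in \<open>R\<^sup>s\<close>: the difference of the two sides of
  the given relation vanishes in the tensor product with the larger module, hence in that with the
  smaller one, where \<open>t + a v \<mapsto> v\<close> is well defined modulo \<open>T\<close>.\<close>

lemma flat_module_relation:
  fixes R :: "('r, 'c) ring_scheme" (structure) and N :: "('r, 'n, 'd) module_scheme" and ev :: "'r \<Rightarrow> 'k::comm_ring_1"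
    and L :: "'l set" and s :: nat
  assumes flat: "flat_module R N"
    and V_def: "V = {f. \<forall>i. (i < s \<longrightarrow> f i \<in> carrier R) \<and> (i \<ge> s \<longrightarrow> f i = \<zero>)}"
    and TV: "T \<subseteq> V" and T0: "(\<lambda>_. \<zero>) \<in> T"
    and Tadd: "\<And>f g. f \<in> T \<Longrightarrow> g \<in> T \<Longrightarrow> (\<lambda>i. f i \<oplus> g i) \<in> T"
    and Tsmult: "\<And>r f. r \<in> carrier R \<Longrightarrow> f \<in> T \<Longrightarrow> (\<lambda>i. r \<otimes> f i) \<in> T"
    and a: "a \<in> carrier R" and sat: "\<And>v. v \<in> V \<Longrightarrow> (\<lambda>i. a \<otimes> v i) \<in> T \<Longrightarrow> v \<in> T"
    and n: "\<And>i. i < s \<Longrightarrow> n i \<in> carrier N"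
    and L: "finite L" and t: "\<And>j. j \<in> L \<Longrightarrow> t j \<in> T" and m: "\<And>j. j \<in> L \<Longrightarrow> m j \<in> carrier N"
    and rel: "\<And>i. i < s \<Longrightarrow> a \<odot>\<^bsub>N\<^esub> n i = (\<Oplus>\<^bsub>N\<^esub>j\<in>L. t j i \<odot>\<^bsub>N\<^esub> m j)"
    and ev_add: "\<And>x y. x \<in> carrier R \<Longrightarrow> y \<in> carrier R \<Longrightarrow> ev (x \<oplus> y) = ev x + ev y"
    and ev_mult: "\<And>x y. x \<in> carrier R \<Longrightarrow> y \<in> carrier R \<Longrightarrow> ev (x \<otimes> y) = ev x * ev y"
    and ev_1: "ev \<one> = 1" and ev_surj: "\<And>c. \<exists>x\<in>carrier R. ev x = c"
    and eps_add: "\<And>x y. x \<in> carrier N \<Longrightarrow> y \<in> carrier N \<Longrightarrow> eps (x \<oplus>\<^bsub>N\<^esub> y) = eps x + eps y"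
    and eps_smult: "\<And>r x. r \<in> carrier R \<Longrightarrow> x \<in> carrier N \<Longrightarrow> eps (r \<odot>\<^bsub>N\<^esub> x) = ev r * eps x"
  shows "\<exists>t\<in>T. \<forall>i<s. ev (t i) = eps (n i)"
proof -
  have md: "module R N" using flat by (simp add: flat_module_def)
  interpret R: cring R using md by (rule module.axioms)
  interpret N: module R N by (rule md)
  have Vc: "f i \<in> carrier R" if "f \<in> V" for f i
    using that R.zero_closed unfolding V_def by (cases "i < s") auto
  have V0: "(\<lambda>_. \<zero>) \<in> V" by (auto simp: V_def)
  have Vadd: "(\<lambda>i. f i \<oplus> g i) \<in> V" if "f \<in> V" "g \<in> V" for f g using that by (auto simp: V_def)
  have Vsmult: "(\<lambda>i. r \<otimes> f i) \<in> V" if "r \<in> carrier R" "f \<in> V" for r f using that by (auto simp: V_def)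
  note Tc = Vc[OF subsetD[OF TV]]
  define W :: "(nat \<Rightarrow> 'r) set" where "W = {\<lambda>i. t i \<oplus> a \<otimes> v i | t v. t \<in> T \<and> v \<in> V}"
  have WI: "(\<lambda>i. t i \<oplus> a \<otimes> v i) \<in> W" if "t \<in> T" "v \<in> V" for t v using that by (auto simp: W_def)
  have WV: "W \<subseteq> V" using TV Vadd Vsmult[OF a] by (auto simp: W_def)
  have TW: "T \<subseteq> W"
  proof
    fix f assume f: "f \<in> T"
    have "(\<lambda>i. f i \<oplus> a \<otimes> \<zero>) = f" using Tc[OF f] a by auto
    with WI[OF f V0] show "f \<in> W" by simp
  qed
  have aVW: "(\<lambda>i. a \<otimes> v i) \<in> W" if "v \<in> V" for v
    using WI[OF T0 that] Vc[OF that] a by simp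
  have add_eq: "(\<lambda>i. (t i \<oplus> a \<otimes> v i) \<oplus> (t' i \<oplus> a \<otimes> v' i))
      = (\<lambda>i. (t i \<oplus> t' i) \<oplus> a \<otimes> (v i \<oplus> v' i))"
    if "t \<in> T" "v \<in> V" "t' \<in> T" "v' \<in> V" for t v t' v'
    using Tc[OF that(1)] Tc[OF that(3)] Vc[OF that(2)] Vc[OF that(4)] a by (simp add: R.r_distr R.a_ac)
  have smult_eq: "(\<lambda>i. r \<otimes> (t i \<oplus> a \<otimes> v i)) = (\<lambda>i. r \<otimes> t i \<oplus> a \<otimes> (r \<otimes> v i))"
    if "t \<in> T" "v \<in> V" "r \<in> carrier R" for t v r
    using Tc[OF that(1)] Vc[OF that(2)] a that(3) by (simp add: R.r_distr R.m_lcomm)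
  have Wadd: "(\<lambda>i. f i \<oplus> g i) \<in> W" if fg: "f \<in> W" "g \<in> W" for f g
  proof -
    from fg obtain t v t' v' where 1: "f = (\<lambda>i. t i \<oplus> a \<otimes> v i)" "g = (\<lambda>i. t' i \<oplus> a \<otimes> v' i)"
      "t \<in> T" "v \<in> V" "t' \<in> T" "v' \<in> V" by (auto simp: W_def)
    show ?thesis unfolding 1(1,2) add_eq[OF 1(3-)] by (rule WI[OF Tadd[OF 1(3,5)] Vadd[OF 1(4,6)]])
  qed
  have Wsmult: "(\<lambda>i. r \<otimes> f i) \<in> W" if r: "r \<in> carrier R" and f: "f \<in> W" for r f
  proof -
    from f obtain t v where 1: "f = (\<lambda>i. t i \<oplus> a \<otimes> v i)" "t \<in> T" "v \<in> V" by (auto simp: W_def)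
    show ?thesis unfolding 1(1) smult_eq[OF 1(2,3) r] by (rule WI[OF Tsmult[OF r 1(2)] Vsmult[OF r 1(3)]])
  qed
  let ?WM = "fun_module R W" and ?VM = "fun_module R V"
  have WM: "module R ?WM" using R.module_fun_module[of W] WV Vc TW T0 Wadd Wsmult by blast
  have VM: "module R ?VM" using R.module_fun_module[of V] Vc V0 Vadd Vsmult by blast
  let ?id = "\<lambda>x :: (nat \<Rightarrow> 'r) set. x"
  have "?id \<in> module_hom R ?WM ?VM" using WV by (auto simp: module_hom_def)
  then have inj: "inj_on (tensor_map R ?VM N ?id) (carrier (tensor R ?WM N))"
    using flat WM VM unfolding flat_module_def by (metis inj_on_id2)
  define FW where "FW = free_Abelian_group (carrier ?WM \<times> carrier N)"
  define FV where "FV = free_Abelian_group (carrier ?VM \<times> carrier N)"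
  define HW where "HW = tensor_gens R ?WM N"
  define HV where "HV = tensor_gens R ?VM N"
  have HWV: "HW \<subseteq> HV" unfolding HW_def HV_def tensor_gens_def fun_module_simps
    using WV by (intro Un_mono) blast+
  have HVc: "HV \<subseteq> carrier FV" unfolding HV_def FV_def by (rule tensor_gens_carrier[OF VM md])
  have HWc: "HW \<subseteq> carrier FW" unfolding HW_def FW_def by (rule tensor_gens_carrier[OF WM md])
  define RW where "RW = generate FW HW"
  define RV where "RV = generate FV HV"
  have RW: "tensor_relations R ?WM N = RW" unfolding tensor_relations_def RW_def HW_def FW_def tensor_gens_def ..
  have RV: "tensor_relations R ?VM N = RV" unfolding tensor_relations_def RV_def HV_def FV_def tensor_gens_def ..
  interpret FW: group FW by (simp add: FW_def)
  interpret FV: group FV by (simp add: FV_def)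
  have sRW: "subgroup RW FW" unfolding RW_def by (rule FW.generate_is_subgroup[OF HWc])
  have sRV: "subgroup RV FV" unfolding RV_def by (rule FV.generate_is_subgroup[OF HVc])
  have RV0: "0 \<in> RV" using subgroup.one_closed[OF sRV] by (simp add: FV_def)
  have RVadd: "x + y \<in> RV" if "x \<in> RV" "y \<in> RV" for x y
    using subgroup.m_closed[OF sRV that] by (simp add: FV_def)
  have RVneg: "- x \<in> RV" if "x \<in> RV" for x
    using subgroup.m_inv_closed[OF sRV that] subgroup.subset[OF sRV] that by (auto simp: FV_def)
  have RVdiff: "x - y \<in> RV" if "x \<in> RV" "y \<in> RV" for x y
    using RVadd[OF that(1) RVneg[OF that(2)]] by simp
  have RV_HV: "x \<in> RV" if "x \<in> HV" for x unfolding RV_def using that by (rule generate.incl)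
  have RWV: "RW \<subseteq> RV"
  proof
    fix x assume "x \<in> RW"
    then show "x \<in> RV"
      unfolding RW_def FW_def by (rule generate_free_subset)
        (use HWc FW_def HWV RV_HV RV0 RVadd RVneg in auto)
  qed
  \<comment> \<open>Injectivity of the induced map in terms of representatives: an element of
    \<open>FW\<close> that is a relation over V is already a relation over W.\<close>
  have main: "z \<in> RW" if z: "z \<in> carrier FW" "z \<in> RV" for z
  proof -
    have tm: "tensor_map R ?VM N ?id (RW #>\<^bsub>FW\<^esub> z') = RV" if z': "z' \<in> carrier FW" "z' \<in> RV" for z'
    proof -
      have idf: "frag_extend (\<lambda>(x, y). frag_of (x, y)) w = w" for w :: "(nat \<Rightarrow> 'r) set \<times> 'n \<Rightarrow>\<^sub>0 int"
      proof -
        have "(\<lambda>(x, y). frag_of (x, y)) = (frag_of :: (nat \<Rightarrow> 'r) set \<times> 'n \<Rightarrow> _)" by auto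
        then show ?thesis by (simp add: frag_expansion[symmetric])
      qed
      have "RV #>\<^bsub>FV\<^esub> w = RV" if "w \<in> RW #>\<^bsub>FW\<^esub> z'" for w
      proof -
        from that have "w \<in> RV" using RWV z' RVadd by (auto simp: r_coset_def FW_def)
        then show ?thesis using FV.coset_join2[OF _ sRV] subgroup.subset[OF sRV] by blast
      qed
      moreover have "RW #>\<^bsub>FW\<^esub> z' \<noteq> {}" using subgroup.one_closed[OF sRW] by (auto simp: r_coset_def)
      ultimately show ?thesis unfolding tensor_map_def RV idf FV_def[symmetric] by auto
    qed
    have cos: "RW #>\<^bsub>FW\<^esub> z' \<in> carrier (tensor R ?WM N)" if "z' \<in> carrier FW" for z'
      using that unfolding tensor_def RW FW_def[symmetric] by (auto simp: FactGroup_def RCOSETS_def)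
    have z0: "0 \<in> carrier FW" by (simp add: FW_def)
    have "RW #>\<^bsub>FW\<^esub> z = RW #>\<^bsub>FW\<^esub> 0"
      using inj_onD[OF inj _ cos[OF z(1)] cos[OF z0]] tm[OF z] tm[OF z0 RV0] by simp
    moreover have "z \<in> RW #>\<^bsub>FW\<^esub> z"
      unfolding r_coset_def using subgroup.one_closed[OF sRW] by (intro UN_I[of 0]) (simp_all add: FW_def)
    ultimately show ?thesis by (auto simp: r_coset_def FW_def)
  qed
  define e where "e i = (\<lambda>k. if k = i then \<one> else \<zero>)" for i :: nat
  have eV: "e i \<in> V" if "i < s" for i using that by (auto simp: e_def V_def)
  have gen1: "frag_of (x \<oplus>\<^bsub>?VM\<^esub> x', y) - frag_of (x, y) - frag_of (x', y) \<in> RV"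
    if "x \<in> carrier ?VM" "x' \<in> carrier ?VM" "y \<in> carrier N" for x x' y
    using that by (intro RV_HV) (unfold HV_def tensor_gens_def, blast)
  have gen2: "frag_of (x, y \<oplus>\<^bsub>N\<^esub> y') - frag_of (x, y) - frag_of (x, y') \<in> RV"
    if "x \<in> carrier ?VM" "y \<in> carrier N" "y' \<in> carrier N" for x y y'
    using that by (intro RV_HV) (unfold HV_def tensor_gens_def, blast)
  have gen3: "frag_of (r \<odot>\<^bsub>?VM\<^esub> x, y) - frag_of (x, r \<odot>\<^bsub>N\<^esub> y) \<in> RV"
    if "r \<in> carrier R" "x \<in> carrier ?VM" "y \<in> carrier N" for r x y
    using that by (intro RV_HV) (unfold HV_def tensor_gens_def, blast)
  have r1: "frag_of ({\<lambda>i. f i \<oplus> g i}, y) - frag_of ({f}, y) - frag_of ({g}, y) \<in> RV"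
    if "f \<in> V" "g \<in> V" "y \<in> carrier N" for f g y
    using gen1[of "{f}" "{g}" y] that by simp
  have r2: "frag_of ({f}, x \<oplus>\<^bsub>N\<^esub> y) - frag_of ({f}, x) - frag_of ({f}, y) \<in> RV"
    if "f \<in> V" "x \<in> carrier N" "y \<in> carrier N" for f x y
    using gen2[of "{f}" x y] that by simp
  have r3: "frag_of ({\<lambda>i. r \<otimes> f i}, y) - frag_of ({f}, r \<odot>\<^bsub>N\<^esub> y) \<in> RV"
    if "f \<in> V" "r \<in> carrier R" "y \<in> carrier N" for f r y
    using gen3[of r "{f}" y] that by simp
  \<comment> \<open>Over V, the tensor f \<otimes> y is the sum of all \<open>e i\<close> \<otimes>
    \<open>f i\<close> y. The partial sums belong to the truncations of f.\<close>
  have expand: "frag_of ({f}, y) - (\<Sum>i<s. frag_of ({e i}, f i \<odot>\<^bsub>N\<^esub> y)) \<in> RV" if f: "f \<in> V" and y: "y \<in> carrier N" for f y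
  proof -
    let ?f = "\<lambda>k i. if i < k then f i else \<zero>"
    have "frag_of ({?f k}, y) - (\<Sum>i<k. frag_of ({e i}, f i \<odot>\<^bsub>N\<^esub> y)) \<in> RV" if "k \<le> s" for k
      using that
    proof (induction k)
      case 0
      from RVneg[OF r1[OF V0 V0 y]] show ?case by simp
    next
      case (Suc k)
      have fk: "?f k \<in> V" using f by (auto simp: V_def)
      have ek: "(\<lambda>i. f k \<otimes> e k i) \<in> V" using Vsmult[OF Vc[OF f] eV] Suc.prems by simp
      have eq: "?f (Suc k) = (\<lambda>i. ?f k i \<oplus> f k \<otimes> e k i)"
        using Vc[OF f] by (auto simp: e_def less_Suc_eq)
      from RVadd[OF RVadd[OF Suc.IH r1[OF fk ek y]] r3[OF eV Vc[OF f, of k] y, of k]] Suc.prems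
      show ?case unfolding eq by (simp add: algebra_simps)
    qed
    from this[of s] have "frag_of ({?f s}, y) - (\<Sum>i<s. frag_of ({e i}, f i \<odot>\<^bsub>N\<^esub> y)) \<in> RV" by simp
    moreover have "?f s = f" using f by (auto simp: V_def)
    ultimately show ?thesis by simp
  qed
  have collect: "(\<Sum>j\<in>A. frag_of ({f}, y j)) - frag_of ({f}, \<Oplus>\<^bsub>N\<^esub>j\<in>A. y j) \<in> RV"
    if "finite A" and "f \<in> V" and "\<And>j. j \<in> A \<Longrightarrow> y j \<in> carrier N" for f y and A :: "'l set"
    using that(1,3)
  proof (induction A rule: finite_induct)
    case empty
    from RVneg[OF r2[OF \<open>f \<in> V\<close> N.M.zero_closed N.M.zero_closed]]
    have "frag_of ({f}, \<zero>\<^bsub>N\<^esub>) \<in> RV" by simp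
    from RVneg[OF this] show ?case by simp
  next
    case (insert x A)
    have y: "y \<in> A \<rightarrow> carrier N" "y x \<in> carrier N" using insert.prems by auto
    from RVdiff[OF insert.IH r2[OF \<open>f \<in> V\<close> y(2) N.M.finsum_closed[OF y(1)]]] insert.prems insert.hyps
    show ?case by (simp add: N.M.finsum_insert[OF _ _ y] algebra_simps)
  qed
  define ae where "ae i = (\<lambda>k. a \<otimes> e i k)" for i
  have aeW: "ae i \<in> W" if "i < s" for i unfolding ae_def using aVW[OF eV[OF that]] .
  \<comment> \<open>As \<open>t j\<close> and a \<open>e i\<close> lie in W, this is an element over
    W. Over V it vanishes, since there a \<open>e i\<close> \<otimes> \<open>n i\<close> equals
    \<open>e i\<close> \<otimes> a \<open>n i\<close>, to which the given relation applies.\<close>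
  define z where "z = (\<Sum>j\<in>L. frag_of ({t j}, m j)) - (\<Sum>i<s. frag_of ({ae i}, n i))"
  have sumRV: "(\<Sum>j\<in>A. g j) \<in> RV" if "\<And>j. j \<in> A \<Longrightarrow> g j \<in> RV" for g and A :: "'q set"
    using that by (induction A rule: infinite_finite_induct) (auto simp: RV0 RVadd)
  have zc: "z \<in> carrier FW"
  proof -
    have "(\<Sum>j\<in>L. frag_of ({t j}, m j)) \<in> carrier FW" "(\<Sum>i<s. frag_of ({ae i}, n i)) \<in> carrier FW"
      unfolding FW_def using t m TW aeW n by (intro sum_closed_free_Abelian_group; force)+
    then show ?thesis unfolding z_def FW_def using keys_diff by (fastforce simp: subset_iff)
  qed
  have zRV: "z \<in> RV"
  proof -
    let ?S1 = "\<Sum>j\<in>L. \<Sum>i<s. frag_of ({e i}, t j i \<odot>\<^bsub>N\<^esub> m j)"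
    let ?S2 = "\<Sum>i<s. frag_of ({e i}, a \<odot>\<^bsub>N\<^esub> n i)"
    have 1: "(\<Sum>j\<in>L. frag_of ({t j}, m j)) - ?S1 \<in> RV"
      unfolding sum_subtractf[symmetric] using t m TV by (intro sumRV expand) auto
    have 2: "(\<Sum>i<s. frag_of ({ae i}, n i)) - ?S2 \<in> RV"
      unfolding sum_subtractf[symmetric] ae_def using a n by (intro sumRV r3 eV) auto
    have "?S1 = (\<Sum>i<s. \<Sum>j\<in>L. frag_of ({e i}, t j i \<odot>\<^bsub>N\<^esub> m j))" by (rule sum.swap)
    also have "\<dots> - ?S2 \<in> RV"
      unfolding sum_subtractf[symmetric]
      using t m Tc L by (intro sumRV) (auto simp: rel intro!: collect eV)
    finally have 3: "?S1 - ?S2 \<in> RV" .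
    from RVadd[OF RVdiff[OF 1 2] 3] show ?thesis by (simp add: z_def algebra_simps)
  qed
  have zRW: "z \<in> RW" by (rule main[OF zc zRV])
  \<comment> \<open>The aim is to show that \<open>\<lambda>i. eps (n i)\<close> lies in E; entries
    from s on are left arbitrary.\<close>
  define E where "E = {x :: nat \<Rightarrow> 'k. \<exists>t\<in>T. \<forall>i<s. x i = ev (t i)}"
  have ev0: "ev \<zero> = 0" using ev_add[of "\<zero>" "\<zero>"] by simp
  have evm1: "ev (\<ominus> \<one>) = - 1"
    using ev_add[of "\<ominus> \<one>" "\<one>"] by (simp add: R.l_neg ev0 ev_1 eq_neg_iff_add_eq_0)
  have E0: "(\<lambda>_. 0) \<in> E" unfolding E_def using T0 ev0 by (intro CollectI bexI[OF _ T0]) auto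
  have Eadd: "(\<lambda>i. x i + y i) \<in> E" if xy: "x \<in> E" "y \<in> E" for x y
  proof -
    from xy obtain t t' where 1: "t \<in> T" "t' \<in> T" "\<forall>i<s. x i = ev (t i)" "\<forall>i<s. y i = ev (t' i)"
      by (auto simp: E_def)
    then show ?thesis unfolding E_def using Tc by (intro CollectI bexI[OF _ Tadd[OF 1(1,2)]]) (simp add: ev_add)
  qed
  have Escale: "(\<lambda>i. x i * c) \<in> E" if x: "x \<in> E" for x c
  proof -
    from x obtain t where 1: "t \<in> T" "\<forall>i<s. x i = ev (t i)" by (auto simp: E_def)
    from ev_surj[of c] obtain r where r: "r \<in> carrier R" "ev r = c" by blast
    show ?thesis unfolding E_def using Tc 1 r by (intro CollectI bexI[OF _ Tsmult[OF r(1) 1(1)]]) (simp add: ev_mult)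
  qed
  have Eneg: "(\<lambda>i. - x i) \<in> E" if "x \<in> E" for x using Escale[OF that, of "-1"] by simp
  have Ediff: "(\<lambda>i. x i - y i) \<in> E" if "x \<in> E" "y \<in> E" for x y using Eadd[OF that(1) Eneg[OF that(2)]] by simp
  have Esum: "(\<lambda>i. \<Sum>j\<in>A. g j i) \<in> E" if "\<And>j. j \<in> A \<Longrightarrow> g j \<in> E" for g and A :: "'q set"
    using that by (induction A rule: infinite_finite_induct) (auto simp: E0 Eadd)
  have uniq: "(\<lambda>i. ev (v1 i) - ev (v2 i)) \<in> E"
    if 1: "t1 \<in> T" "t2 \<in> T" "v1 \<in> V" "v2 \<in> V" and eq: "(\<lambda>i. t1 i \<oplus> a \<otimes> v1 i) = (\<lambda>i. t2 i \<oplus> a \<otimes> v2 i)"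
    for t1 t2 v1 v2
  proof -
    have m1: "\<ominus> \<one> \<in> carrier R" by simp
    have eqi: "t1 i \<oplus> a \<otimes> v1 i = t2 i \<oplus> a \<otimes> v2 i" for i
      using fun_cong[OF eq, of i] .
    have eqT: "(\<lambda>i. a \<otimes> (v1 i \<oplus> \<ominus> \<one> \<otimes> v2 i)) = (\<lambda>i. t2 i \<oplus> \<ominus> \<one> \<otimes> t1 i)"
    proof
      fix i show "a \<otimes> (v1 i \<oplus> \<ominus> \<one> \<otimes> v2 i) = t2 i \<oplus> \<ominus> \<one> \<otimes> t1 i"
        by (rule R.cancel_decomposition[OF Tc[OF 1(1), of i] Tc[OF 1(2), of i] Vc[OF 1(3), of i] Vc[OF 1(4), of i] a eqi])
    qed
    have "(\<lambda>i. a \<otimes> (v1 i \<oplus> \<ominus> \<one> \<otimes> v2 i)) \<in> T"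
      unfolding eqT by (rule Tadd[OF 1(2) Tsmult[OF m1 1(1)]])
    then have "(\<lambda>i. v1 i \<oplus> \<ominus> \<one> \<otimes> v2 i) \<in> T"
      by (rule sat[OF Vadd[OF 1(3) Vsmult[OF m1 1(4)]]])
    moreover have "ev (v1 i \<oplus> \<ominus> \<one> \<otimes> v2 i) = ev (v1 i) - ev (v2 i)" for i
      unfolding ev_add[OF Vc[OF 1(3)] R.m_closed[OF m1 Vc[OF 1(4)]]] ev_mult[OF m1 Vc[OF 1(4)]] evm1 by simp
    ultimately show ?thesis unfolding E_def by (intro CollectI bexI[rotated]) auto
  qed
  define dec where "dec w = (SOME v. v \<in> V \<and> (\<exists>t\<in>T. w = (\<lambda>i. t i \<oplus> a \<otimes> v i)))" for w
  have dec: "dec w \<in> V \<and> (\<exists>t\<in>T. w = (\<lambda>i. t i \<oplus> a \<otimes> dec w i))" if "w \<in> W" for w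
  proof -
    from that obtain v where "v \<in> V \<and> (\<exists>t\<in>T. w = (\<lambda>i. t i \<oplus> a \<otimes> v i))" unfolding W_def by blast
    then show ?thesis unfolding dec_def
      by (rule someI[of "\<lambda>v. v \<in> V \<and> (\<exists>t\<in>T. w = (\<lambda>i. t i \<oplus> a \<otimes> v i))"])
  qed
  have dec_uniq: "(\<lambda>i. ev (dec w i) - ev (v i)) \<in> E"
    if w: "w = (\<lambda>i. t i \<oplus> a \<otimes> v i)" and tv: "t \<in> T" "v \<in> V" for w t v
  proof -
    have "w \<in> W" unfolding w by (rule WI[OF tv])
    from dec[OF this] obtain t' where 1: "t' \<in> T" "w = (\<lambda>i. t' i \<oplus> a \<otimes> dec w i)" "dec w \<in> V" by blast
    show ?thesis by (rule uniq[OF 1(1) tv(1) 1(3) tv(2) trans[OF 1(2)[symmetric] w]])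
  qed
  \<comment> \<open>The additive extension \<open>\<Phi>\<close> represents the map (t + a v)
    \<otimes> y \<mapsto> ev(v) eps(y) with values modulo E. By \<open>dec_uniq\<close> the choices
    made in \<open>dec\<close> matter only up to E, and so the relations over W are sent into
    E.\<close>
  define \<phi> where "\<phi> c i = (case c of (x, y) \<Rightarrow> ev (dec (the_elem x) i) * eps y)" for c :: "(nat \<Rightarrow> 'r) set \<times> 'n" and i
  define \<Phi> where "\<Phi> w i = (\<Sum>c\<in>keys w. of_int (lookup w c) * \<phi> c i)" for w i
  have \<Phi>_superset: "\<Phi> w i = (\<Sum>c\<in>A. of_int (lookup w c) * \<phi> c i)" if "finite A" "keys w \<subseteq> A" for w i A
    unfolding \<Phi>_def using that by (intro sum.mono_neutral_left) (auto simp: in_keys_iff)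
  have \<Phi>_add: "\<Phi> (w + w') i = \<Phi> w i + \<Phi> w' i" for w w' i
    using Poly_Mapping.keys_add[of w w']
    by (simp add: \<Phi>_superset[of "keys w \<union> keys w'"] lookup_add sum.distrib distrib_right)
  have \<Phi>_neg: "\<Phi> (- w) i = - \<Phi> w i" for w i by (simp add: \<Phi>_def sum_negf)
  have \<Phi>_diff: "\<Phi> (w - w') i = \<Phi> w i - \<Phi> w' i" for w w' i
    using \<Phi>_add[of w "-w'" i] by (simp add: \<Phi>_neg)
  have \<Phi>_0: "\<Phi> 0 i = 0" for i by (simp add: \<Phi>_def)
  have \<Phi>_frag: "\<Phi> (frag_of c) i = \<phi> c i" for c i by (simp add: \<Phi>_def)
  have \<Phi>_sum: "\<Phi> (\<Sum>j\<in>A. g j) i = (\<Sum>j\<in>A. \<Phi> (g j) i)" for g i and A :: "'q set"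
    by (induction A rule: infinite_finite_induct) (auto simp: \<Phi>_0 \<Phi>_add)
  have HWE: "\<Phi> w \<in> E" if "w \<in> HW" for w
  proof -
    from that consider
        (1) f g y where "w = frag_of ({\<lambda>i. f i \<oplus> g i}, y) - frag_of ({f}, y) - frag_of ({g}, y)" "f \<in> W" "g \<in> W" "y \<in> carrier N"
      | (2) f x y where "w = frag_of ({f}, x \<oplus>\<^bsub>N\<^esub> y) - frag_of ({f}, x) - frag_of ({f}, y)" "f \<in> W" "x \<in> carrier N" "y \<in> carrier N"
      | (3) f r y where "w = frag_of ({\<lambda>i. r \<otimes> f i}, y) - frag_of ({f}, r \<odot>\<^bsub>N\<^esub> y)" "r \<in> carrier R" "f \<in> W" "y \<in> carrier N"
      unfolding HW_def tensor_gens_def by auto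
    then show ?thesis
    proof cases
      case 1
      from dec[OF 1(2)] dec[OF 1(3)] obtain t t' where
        d: "t \<in> T" "f = (\<lambda>i. t i \<oplus> a \<otimes> dec f i)" "dec f \<in> V" "t' \<in> T" "g = (\<lambda>i. t' i \<oplus> a \<otimes> dec g i)" "dec g \<in> V"
        by blast
      have "(\<lambda>i. f i \<oplus> g i) = (\<lambda>i. (t i \<oplus> t' i) \<oplus> a \<otimes> (dec f i \<oplus> dec g i))"
        using add_eq[OF d(1,3,4,6)] unfolding fun_cong[OF d(2), symmetric] fun_cong[OF d(5), symmetric] .
      from Escale[OF dec_uniq[OF this Tadd[OF d(1,4)] Vadd[OF d(3,6)]], of "eps y"]
      have "(\<lambda>i. (ev (dec (\<lambda>i. f i \<oplus> g i) i) - ev (dec f i \<oplus> dec g i)) * eps y) \<in> E" .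
      also have "(\<lambda>i. (ev (dec (\<lambda>i. f i \<oplus> g i) i) - ev (dec f i \<oplus> dec g i)) * eps y) = \<Phi> w"
        using Vc[OF d(3)] Vc[OF d(6)]
        by (intro ext) (simp add: 1(1) \<Phi>_diff \<Phi>_add \<Phi>_frag \<phi>_def ev_add algebra_simps)
      finally show ?thesis .
    next
      case 2
      have "\<Phi> w = (\<lambda>_. 0)" by (intro ext) (simp add: 2 \<Phi>_diff \<Phi>_add \<Phi>_frag \<phi>_def eps_add algebra_simps)
      then show ?thesis by (simp add: E0)
    next
      case 3
      from dec[OF 3(3)] obtain t where
        d: "t \<in> T" "f = (\<lambda>i. t i \<oplus> a \<otimes> dec f i)" "dec f \<in> V" by blast
      have "(\<lambda>i. r \<otimes> f i) = (\<lambda>i. r \<otimes> t i \<oplus> a \<otimes> (r \<otimes> dec f i))"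
        using smult_eq[OF d(1,3) 3(2)] unfolding fun_cong[OF d(2), symmetric] .
      from Escale[OF dec_uniq[OF this Tsmult[OF 3(2) d(1)] Vsmult[OF 3(2) d(3)]], of "eps y"]
      have "(\<lambda>i. (ev (dec (\<lambda>i. r \<otimes> f i) i) - ev (r \<otimes> dec f i)) * eps y) \<in> E" .
      also have "(\<lambda>i. (ev (dec (\<lambda>i. r \<otimes> f i) i) - ev (r \<otimes> dec f i)) * eps y) = \<Phi> w"
        using Vc[OF d(3)] 3(2,4)
        by (intro ext) (simp add: 3(1) \<Phi>_diff \<Phi>_add \<Phi>_frag \<phi>_def ev_mult eps_smult algebra_simps)
      finally show ?thesis .
    qed
  qed
  have "z \<in> {w. \<Phi> w \<in> E}"
  proof (rule generate_free_subset)
    show "z \<in> generate (free_Abelian_group (carrier ?WM \<times> carrier N)) HW" using zRW by (simp add: RW_def FW_def)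
    show "0 \<in> {w. \<Phi> w \<in> E}" using E0 by (simp add: \<Phi>_0[abs_def])
  qed (use HWc HWE in \<open>auto simp: FW_def \<Phi>_add[abs_def] \<Phi>_neg[abs_def] Eadd Eneg\<close>)
  then have zE: "\<Phi> z \<in> E" by simp
  have "\<Phi> z = (\<lambda>i. (\<Sum>j\<in>L. ev (dec (t j) i) * eps (m j)) - (\<Sum>k<s. ev (dec (ae k) i) * eps (n k)))"
    by (intro ext) (simp add: z_def \<Phi>_diff \<Phi>_sum \<Phi>_frag \<phi>_def)
  with zE have 1: "(\<lambda>i. (\<Sum>j\<in>L. ev (dec (t j) i) * eps (m j)) - (\<Sum>k<s. ev (dec (ae k) i) * eps (n k))) \<in> E" by simp
  \<comment> \<open>Since \<open>t j\<close> = \<open>t j\<close> + a 0, its chosen v evaluates into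
    E; that of a \<open>e k\<close> evaluates to \<open>e k\<close> modulo E. Hence
    \<open>\<Phi> z\<close> isolates the values of the \<open>n k\<close>.\<close>
  have 2: "(\<lambda>i. \<Sum>j\<in>L. ev (dec (t j) i) * eps (m j)) \<in> E"
  proof (rule Esum, rule Escale)
    fix j assume j: "j \<in> L"
    have "t j = (\<lambda>i. t j i \<oplus> a \<otimes> \<zero>)" using Tc[OF t[OF j]] a by auto
    from dec_uniq[OF this t[OF j] V0] show "(\<lambda>i. ev (dec (t j) i)) \<in> E" by (simp add: ev0)
  qed
  have 3: "(\<lambda>i. \<Sum>k<s. (ev (dec (ae k) i) - ev (e k i)) * eps (n k)) \<in> E"
  proof (rule Esum, rule Escale)
    fix k assume "k \<in> {..<s}"
    then have k: "k < s" by simp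
    have "ae k = (\<lambda>i. \<zero> \<oplus> a \<otimes> e k i)" using Vc[OF eV[OF k]] a by (simp add: ae_def)
    from dec_uniq[OF this T0 eV[OF k]] show "(\<lambda>i. ev (dec (ae k) i) - ev (e k i)) \<in> E" .
  qed
  from Ediff[OF 2 Eadd[OF 1 3]]
  have "(\<lambda>i. \<Sum>k<s. ev (e k i) * eps (n k)) \<in> E"
    by (simp add: sum_subtractf algebra_simps)
  moreover have "(\<Sum>k<s. ev (e k i) * eps (n k)) = eps (n i)" if "i < s" for i
  proof -
    have "(\<Sum>k<s. ev (e k i) * eps (n k)) = (\<Sum>k<s. if k = i then eps (n k) else 0)"
      by (intro sum.cong) (auto simp: e_def ev_1 ev0)
    then show ?thesis using that by simp
  qed
  ultimately obtain t' where "t' \<in> T" "\<forall>i<s. eps (n i) = ev (t' i)" by (auto simp: E_def)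
  then show ?thesis by (intro bexI[of _ t']) simp_all
qed

section \<open>Homogeneous polynomials\<close>

definition homog :: "nat \<Rightarrow> ('m, 'c::comm_ring_1) mpoly set" where
  "homog d = {f. \<forall>m\<in>keys f. tdeg m = d}"

definition hc :: "nat \<Rightarrow> ('m, 'c::comm_ring_1) mpoly \<Rightarrow> ('m, 'c) mpoly" where
  "hc d f = (\<Sum>m\<in>{m \<in> keys f. tdeg m = d}. single m (lookup f m))"

text \<open>Closure under homogeneous components, the form in which homogeneity is used, in place of
  generation by homogeneous elements as in \<open>homogeneous_ideal\<close>.\<close>

definition thomog :: "('m, 'c::comm_ring_1) mpoly set \<Rightarrow> bool" where
  "thomog I \<longleftrightarrow> (\<forall>f\<in>I. \<forall>d. hc d f \<in> I)"

lemma tdeg_superset: "finite A \<Longrightarrow> keys m \<subseteq> A \<Longrightarrow> tdeg m = (\<Sum>v\<in>A. lookup m v)"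
  unfolding tdeg_def by (rule sum.mono_neutral_left) (auto simp: in_keys_iff)

lemma tdeg_add: "tdeg (m + m') = tdeg m + tdeg m'"
  using Poly_Mapping.keys_add[of m m']
  by (simp add: tdeg_superset[of "keys m \<union> keys m'"] lookup_add sum.distrib)

lemma tdeg_0 [simp]: "tdeg 0 = 0"
  by (simp add: tdeg_def)

lemma tdeg_single [simp]: "tdeg (single v k) = k"
  by (simp add: tdeg_def)

lemma lookup_hc: "lookup (hc d f) m = (if tdeg m = d then lookup f m else 0)"
  unfolding hc_def lookup_sum lookup_single by (auto simp: when_def sum.delta' in_keys_iff)

lemma hc_homog [simp]: "hc d f \<in> homog d"
  by (auto simp: homog_def in_keys_iff lookup_hc split: if_splits)

lemma hc_add: "hc d (f + g) = hc d f + hc d g"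
  by (rule poly_mapping_eqI) (simp add: lookup_hc lookup_add)

lemma hc_0 [simp]: "hc d 0 = 0"
  by (rule poly_mapping_eqI) (simp add: lookup_hc)

lemma hc_sum: "hc d (sum f A) = (\<Sum>a\<in>A. hc d (f a))"
  by (induction A rule: infinite_finite_induct) (auto simp: hc_add)

lemma hc_of_homog: "f \<in> homog e \<Longrightarrow> hc d f = (if d = e then f else 0)"
  by (rule poly_mapping_eqI) (auto simp: lookup_hc homog_def in_keys_iff)

lemma sum_hc: "\<exists>n. \<forall>N\<ge>n. f = (\<Sum>d\<le>N. hc d f)"
proof -
  obtain n where n: "\<And>m. m \<in> keys f \<Longrightarrow> tdeg m \<le> n"
    using finite_nat_set_iff_bounded_le[of "tdeg ` keys f"] by auto
  have "f = (\<Sum>d\<le>N. hc d f)" if "N \<ge> n" for N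
  proof (rule poly_mapping_eqI)
    fix m show "lookup f m = lookup (\<Sum>d\<le>N. hc d f) m"
    proof (cases "m \<in> keys f")
      case True
      then have "tdeg m \<le> N" using n[of m] that by simp
      then show ?thesis by (simp add: lookup_sum lookup_hc)
    qed (simp add: lookup_sum lookup_hc in_keys_iff)
  qed
  then show ?thesis by blast
qed

lemma homog_0 [simp]: "0 \<in> homog d"
  by (simp add: homog_def)

lemma homog_add: "f \<in> homog d \<Longrightarrow> g \<in> homog d \<Longrightarrow> f + g \<in> homog d"
  using Poly_Mapping.keys_add[of f g] by (auto simp: homog_def)

lemma homog_minus: "f \<in> homog d \<Longrightarrow> - f \<in> homog d"
  by (auto simp: homog_def in_keys_iff)

lemma homog_diff: "f \<in> homog d \<Longrightarrow> g \<in> homog d \<Longrightarrow> f - g \<in> homog d"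
  by (metis diff_conv_add_uminus homog_add homog_minus)

lemma homog_sum: "(\<And>a. a \<in> A \<Longrightarrow> f a \<in> homog d) \<Longrightarrow> sum f A \<in> homog d"
  by (induction A rule: infinite_finite_induct) (auto simp: homog_add)

lemma homog_mult:
  assumes "f \<in> homog d" "g \<in> homog e" shows "f * g \<in> homog (d + e)"
  unfolding homog_def
proof (intro CollectI ballI)
  fix m assume "m \<in> keys (f * g)"
  then obtain a b where "m = a + b" "a \<in> keys f" "b \<in> keys g" using Poly_Mapping.keys_mult[of f g] by blast
  then show "tdeg m = d + e" using assms by (simp add: homog_def tdeg_add)
qed

lemma homog_Const [simp]: "Const c \<in> homog 0"
  by (auto simp: homog_def Const_def)

lemma homog_1 [simp]: "1 \<in> homog 0"
  using homog_Const[of 1] by (simp only: Const_1)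

lemma homog_Var [simp]: "Var v \<in> homog (Suc 0)"
  by (auto simp: homog_def Var_def)

lemma homog_power: "f \<in> homog d \<Longrightarrow> f ^ k \<in> homog (k * d)"
  by (induction k) (auto intro: homog_mult simp: algebra_simps)

lemma hc_mult_homog:
  assumes "g \<in> homog e" shows "hc (d + e) (g * f) = g * hc d f"
proof -
  obtain n where n: "f = (\<Sum>k\<le>max n d. hc k f)" using sum_hc[of f] by (metis max.cobounded1)
  have "hc (d + e) (g * f) = (\<Sum>k\<le>max n d. hc (d + e) (g * hc k f))"
    by (subst n) (simp add: sum_distrib_left hc_sum)
  also have "\<dots> = (\<Sum>k\<le>max n d. if k = d then g * hc k f else 0)"
    by (intro sum.cong refl) (auto simp: hc_of_homog[OF homog_mult[OF assms hc_homog]])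
  finally show ?thesis by simp
qed

lemma hc_mult_homog_low:
  assumes "g \<in> homog e" "d < e" shows "hc d (g * f) = 0"
proof -
  obtain n where n: "f = (\<Sum>k\<le>n. hc k f)" using sum_hc[of f] by blast
  have "hc d (g * f) = (\<Sum>k\<le>n. hc d (g * hc k f))"
    by (subst n) (simp add: sum_distrib_left hc_sum)
  also have "\<dots> = 0"
    using assms(2) by (intro sum.neutral ballI) (simp add: hc_of_homog[OF homog_mult[OF assms(1) hc_homog]])
  finally show ?thesis .
qed

text \<open>This ideal contains every homogeneous element of I. If I is generated by such elements,
  minimality makes I a part of it, which yields \<open>thomog\<close>.\<close>

lemma tideal_components:
  assumes I: "tideal I"
  shows "tideal {f. \<forall>d. hc d f \<in> I}"
  unfolding tideal_def
proof (intro conjI ballI allI)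
  fix r x assume x: "x \<in> {f. \<forall>d. hc d f \<in> I}"
  have "hc d (hc k r * x) \<in> I" for d k
  proof (cases "d < k")
    case False
    then have "hc d (hc k r * x) = hc k r * hc (d - k) x" using hc_mult_homog[of "hc k r" k "d - k" x] by simp
    with x tideal_mult[OF I] show ?thesis by simp
  qed (simp add: hc_mult_homog_low[OF hc_homog] tideal_0[OF I])
  note comp = this
  obtain n where n: "r = (\<Sum>k\<le>n. hc k r)" using sum_hc[of r] by blast
  have "hc d (r * x) \<in> I" for d
  proof -
    have "hc d (r * x) = (\<Sum>k\<le>n. hc d (hc k r * x))"
      by (subst n) (simp add: sum_distrib_right hc_sum)
    then show ?thesis using comp by (simp add: tideal_sum[OF I])
  qed
  then show "r * x \<in> {f. \<forall>d. hc d f \<in> I}" by simp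
qed (auto simp: hc_add tideal_add[OF I] tideal_0[OF I])

lemma thomog_memI: "tideal I \<Longrightarrow> (\<And>d. hc d f \<in> I) \<Longrightarrow> f \<in> I"
  using sum_hc[of f] tideal_sum[of I] by (metis order_refl)

text \<open>A monomial of positive degree is a multiple of some variable. So the requirement that a
  point of Proj does not contain the irrelevant ideal amounts to missing a variable.\<close>

lemma Var_notin_irrelevant:
  assumes I: "tideal I" and f: "f \<in> homog d" "d > 0" "f \<notin> I"
  shows "\<exists>v. Var v \<notin> I"
proof (rule ccontr)
  assume no: "\<not> ?thesis"
  have "single m (lookup f m) \<in> I" if m: "m \<in> keys f" for m
  proof -
    have "tdeg m \<noteq> 0" using f m by (auto simp: homog_def)
    then obtain v where v: "v \<in> keys m" unfolding tdeg_def by fastforce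
    then obtain k where k: "lookup m v = Suc k" by (metis in_keys_iff not0_implies_Suc)
    have "single m (lookup f m) = (Const (lookup f m) * (Var v ^ k * (\<Prod>u\<in>keys m - {v}. Var u ^ lookup m u))) * Var v"
      using v k by (simp add: single_eq_Const_mult mval_def prod.remove[of "keys m" v] mult_ac)
    then show ?thesis using no tideal_mult[OF I] by simp
  qed
  then have "f \<in> I" by (subst poly_mapping_sum_single) (rule tideal_sum[OF I])
  with f show False by simp
qed

section \<open>Graded quotient rings\<close>

lemma with_grading_simps [simp]:
  "carrier (with_grading A G) = carrier A" "x \<otimes>\<^bsub>with_grading A G\<^esub> y = x \<otimes>\<^bsub>A\<^esub> y"
  "x \<oplus>\<^bsub>with_grading A G\<^esub> y = x \<oplus>\<^bsub>A\<^esub> y" "\<zero>\<^bsub>with_grading A G\<^esub> = \<zero>\<^bsub>A\<^esub>" "\<one>\<^bsub>with_grading A G\<^esub> = \<one>\<^bsub>A\<^esub>"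
  "hcomp (with_grading A G) = G"
  by (simp_all add: with_grading_def ring.extend_def gring.fields_def)

lemma poly_gring_simps [simp]:
  "carrier poly_gring = UNIV" "x \<otimes>\<^bsub>poly_gring\<^esub> y = x * y"
  "x \<oplus>\<^bsub>poly_gring\<^esub> y = x + y" "\<zero>\<^bsub>poly_gring\<^esub> = 0" "\<one>\<^bsub>poly_gring\<^esub> = 1"
  "hcomp poly_gring = homog"
  by (simp_all add: poly_gring_def ring_of_type_algebra_def homog_def[abs_def])

lemma cring_with_grading: "cring A \<Longrightarrow> cring (with_grading A G)"
proof -
  assume "cring A"
  then interpret A: cring A .
  show ?thesis
  proof (rule cringI)
    show "abelian_group (with_grading A G)"
    proof (rule abelian_groupI)
      fix x assume "x \<in> carrier (with_grading A G)"
      then show "\<exists>y\<in>carrier (with_grading A G). y \<oplus>\<^bsub>with_grading A G\<^esub> x = \<zero>\<^bsub>with_grading A G\<^esub>"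
        using A.a_inv_closed A.l_neg by auto
    qed (auto simp: A.a_ac)
    show "comm_monoid (with_grading A G)"
      by (rule comm_monoidI) (auto simp: A.m_ac)
  qed (auto simp: A.l_distr)
qed

lemma cring_poly_gring: "cring poly_gring"
  unfolding poly_gring_def by (intro cring_with_grading cring_from_type_algebra)

lemma ideal_poly_gring: "ideal I poly_gring \<longleftrightarrow> tideal I"
proof
  interpret cring "poly_gring :: ('a, 'b) mpoly gring" by (rule cring_poly_gring)
  show "tideal I" if "ideal I poly_gring"
  proof -
    interpret ideal I poly_gring by fact
    show ?thesis unfolding tideal_def using zero_closed a_closed I_l_closed by auto
  qed
  show "ideal I poly_gring" if t: "tideal I"
  proof (rule idealI)
    show "subgroup I (add_monoid poly_gring)"
    proof (rule add.subgroupI)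
      fix a assume a: "a \<in> I"
      have "\<ominus>\<^bsub>poly_gring\<^esub> a = - a" by (rule minus_equality) auto
      then show "\<ominus>\<^bsub>poly_gring\<^esub> a \<in> I" using tideal_minus[OF t a] by simp
    qed (use t in \<open>auto simp: tideal_add dest: tideal_0\<close>)
  qed (use t in \<open>auto simp: tideal_mult tideal_mult' intro: ring_axioms\<close>)
qed

definition cls :: "'a::comm_ring_1 set \<Rightarrow> 'a \<Rightarrow> 'a set" where
  "cls J f = {g. g - f \<in> J}"

lemma poly_gring_coset: "J +>\<^bsub>poly_gring\<^esub> f = cls J f"
proof -
  have "J +>\<^bsub>poly_gring\<^esub> f = (\<lambda>h. h + f) ` J" by (auto simp: a_r_coset_def r_coset_def)
  also have "\<dots> = cls J f" by (force simp: cls_def image_iff algebra_simps intro: bexI[of _ "_ - f"])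
  finally show ?thesis .
qed

lemma cls_eq_iff: assumes "tideal J" shows "cls J f = cls J g \<longleftrightarrow> f - g \<in> J"
proof
  assume "cls J f = cls J g"
  moreover have "f \<in> cls J f" using tideal_0[OF assms] by (simp add: cls_def)
  ultimately show "f - g \<in> J" by (simp add: cls_def)
next
  assume fg: "f - g \<in> J"
  have "h - f \<in> J \<longleftrightarrow> h - g \<in> J" for h
    using tideal_add[OF assms, of "h - f" "f - g"] tideal_diff[OF assms, of "h - g" "f - g"] fg by auto
  then show "cls J f = cls J g" by (simp add: cls_def)
qed

lemma cls_self: "tideal J \<Longrightarrow> f \<in> cls J f"
  by (simp add: cls_def tideal_0)

lemma cls_in_image_iff:
  assumes "tideal J" "tideal P" "J \<subseteq> P" shows "cls J f \<in> cls J ` P \<longleftrightarrow> f \<in> P"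
proof
  assume "cls J f \<in> cls J ` P"
  then obtain g where "g \<in> P" "f - g \<in> P" using assms by (auto simp: cls_eq_iff)
  then show "f \<in> P" using tideal_add[OF assms(2), of "f - g" g] by simp
qed auto

locale graded_quotient =
  fixes J :: "('m, 'c::comm_ring_1) mpoly set"
  assumes hom_J: "homogeneous_ideal poly_gring J"
begin

abbreviation "A \<equiv> projective_ring J"

lemma tJ: "tideal J"
  using hom_J by (simp add: homogeneous_ideal_def ideal_poly_gring)

lemma hJ: "thomog J"
proof -
  interpret ring "poly_gring :: ('m, 'c) mpoly gring" using cring_poly_gring by (rule cring.axioms)
  let ?I = "{f. \<forall>d. hc d f \<in> J}"
  have "J = Idl\<^bsub>poly_gring\<^esub> (J \<inter> (\<Union>d. homog d))" using hom_J by (simp add: homogeneous_ideal_def)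
  also have "\<dots> \<subseteq> ?I"
  proof (rule genideal_minimal)
    show "ideal ?I poly_gring" using tideal_components[OF tJ] by (simp add: ideal_poly_gring)
    show "J \<inter> (\<Union>d. homog d) \<subseteq> ?I" using tideal_0[OF tJ] by (auto simp: hc_of_homog)
  qed
  finally show ?thesis by (auto simp: thomog_def)
qed

lemma cring_A: "cring A"
proof -
  interpret ideal J "poly_gring" using hom_J by (simp add: homogeneous_ideal_def)
  show ?thesis unfolding projective_ring_def gquot_def
    by (intro cring_with_grading quotient_is_cring cring_poly_gring)
qed

lemma A_simps:
  "carrier A = range (cls J)" "cls J f \<otimes>\<^bsub>A\<^esub> cls J g = cls J (f * g)"
  "cls J f \<oplus>\<^bsub>A\<^esub> cls J g = cls J (f + g)" "\<zero>\<^bsub>A\<^esub> = cls J 0" "\<one>\<^bsub>A\<^esub> = cls J 1"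
  "hcomp A d = cls J ` homog d"
proof -
  interpret ideal J "poly_gring" using hom_J by (simp add: homogeneous_ideal_def)
  show "carrier A = range (cls J)"
    by (auto simp: projective_ring_def gquot_def FactRing_def A_RCOSETS_def' poly_gring_coset)
  show "cls J f \<otimes>\<^bsub>A\<^esub> cls J g = cls J (f * g)"
    using rcoset_mult_add[of f g] by (simp add: projective_ring_def gquot_def FactRing_def poly_gring_coset)
  show "cls J f \<oplus>\<^bsub>A\<^esub> cls J g = cls J (f + g)"
    using a_rcos_sum[of f g] by (simp add: projective_ring_def gquot_def FactRing_def poly_gring_coset)
  show "\<zero>\<^bsub>A\<^esub> = cls J 0" by (simp add: projective_ring_def gquot_def FactRing_def cls_def)
  show "\<one>\<^bsub>A\<^esub> = cls J 1" by (simp add: projective_ring_def gquot_def FactRing_def poly_gring_coset)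
  show "hcomp A d = cls J ` homog d" by (simp add: projective_ring_def gquot_def poly_gring_coset)
qed

lemma A_minus: "cls J f \<ominus>\<^bsub>A\<^esub> cls J g = cls J (f - g)"
proof -
  interpret cring A by (rule cring_A)
  have "\<ominus>\<^bsub>A\<^esub> cls J g = cls J (- g)" by (rule minus_equality) (auto simp: A_simps)
  then show ?thesis by (simp add: a_minus_def A_simps)
qed

lemma cls_eq_zero_iff: "cls J f = \<zero>\<^bsub>A\<^esub> \<longleftrightarrow> f \<in> J"
  by (simp add: A_simps cls_eq_iff[OF tJ])

definition lft :: "('m, 'c) mpoly set set \<Rightarrow> ('m, 'c) mpoly set" where
  "lft P = {f. cls J f \<in> P}"

lemma ideal_lft:
  assumes "ideal P A" shows "tideal (lft P)" "J \<subseteq> lft P" "cls J ` lft P = P"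
proof -
  interpret ideal P A by fact
  note P0 = additive_subgroup.zero_closed[OF additive_subgroup_axioms, unfolded A_simps]
    and Padd = additive_subgroup.a_closed[OF additive_subgroup_axioms]
  show "tideal (lft P)" unfolding tideal_def lft_def
  proof (intro conjI ballI allI CollectI)
    show "cls J 0 \<in> P" by (rule P0)
    fix x y assume "x \<in> {f. cls J f \<in> P}" "y \<in> {f. cls J f \<in> P}"
    then show "cls J (x + y) \<in> P" using Padd[of "cls J x" "cls J y", unfolded A_simps] by simp
  next
    fix r x assume "x \<in> {f. cls J f \<in> P}"
    then show "cls J (r * x) \<in> P" using I_l_closed[of "cls J x" "cls J r"] by (simp add: A_simps)
  qed
  show "J \<subseteq> lft P"
  proof
    fix f assume "f \<in> J"
    then have "cls J f = cls J 0" by (simp add: cls_eq_iff[OF tJ])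
    then show "f \<in> lft P" using P0 by (simp add: lft_def)
  qed
  show "cls J ` lft P = P" using a_subset by (auto simp: lft_def A_simps)
qed

lemma ideal_image:
  assumes "tideal p" shows "ideal (cls J ` p) A"
proof -
  interpret cring A by (rule cring_A)
  show ?thesis
  proof (rule idealI)
    show "ring A" by (rule ring_axioms)
    show "subgroup (cls J ` p) (add_monoid A)"
    proof (rule add.subgroupI)
      fix a assume "a \<in> cls J ` p"
      then obtain f where f: "a = cls J f" "f \<in> p" by auto
      have "\<ominus>\<^bsub>A\<^esub> cls J f = cls J (- f)" by (rule minus_equality) (auto simp: A_simps)
      then show "\<ominus>\<^bsub>A\<^esub> a \<in> cls J ` p"
        using tideal_minus[OF assms f(2)] f by simp
    qed (use assms tideal_0 tideal_add in \<open>auto simp: A_simps, blast\<close>)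
  qed (use assms in \<open>auto simp: A_simps tideal_mult tideal_mult'\<close>)
qed

lemma tprime_lft:
  assumes "primeideal P A" shows "tprime (lft P)"
proof -
  interpret primeideal P A by fact
  show ?thesis unfolding tprime_def
  proof (intro conjI allI impI)
    show t: "tideal (lft P)" by (rule ideal_lft(1)[OF ideal_axioms])
    show "1 \<notin> lft P"
    proof
      assume "1 \<in> lft P"
      then have "lft P = UNIV" using tideal_mult[OF t, of 1] by auto
      then show False using ideal_lft(3)[OF ideal_axioms] I_notcarr by (simp add: A_simps)
    qed
    fix x y assume "x * y \<in> lft P"
    then show "x \<in> lft P \<or> y \<in> lft P"
      using I_prime[of "cls J x" "cls J y"] by (simp add: A_simps lft_def)
  qed
qed

lemma primeideal_image:
  assumes p: "tprime p" and "J \<subseteq> p" shows "primeideal (cls J ` p) A"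
proof -
  have in_iff: "cls J f \<in> cls J ` p \<longleftrightarrow> f \<in> p" for f
    by (rule cls_in_image_iff[OF tJ tprime_tideal[OF p] assms(2)])
  show ?thesis
  proof (rule primeidealI)
    show "ideal (cls J ` p) A" by (rule ideal_image[OF tprime_tideal[OF p]])
    show "cring A" by (rule cring_A)
    show "carrier A \<noteq> cls J ` p" using tprime_1[OF p] in_iff[of 1] by (auto simp: A_simps)
    fix a b assume ab: "a \<in> carrier A" "b \<in> carrier A" "a \<otimes>\<^bsub>A\<^esub> b \<in> cls J ` p"
    then obtain x y where xy: "a = cls J x" "b = cls J y" by (auto simp: A_simps)
    with ab(3) have "x * y \<in> p" by (simp only: A_simps in_iff)
    with tprime_mult[OF p] xy in_iff show "a \<in> cls J ` p \<or> b \<in> cls J ` p" by blast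
  qed
qed

text \<open>Points of Proj as primes of the polynomial ring above J, so that arguments about points
  need no cosets.\<close>

definition proj_primes :: "('m, 'c) mpoly set set" where
  "proj_primes = {p. tprime p \<and> thomog p \<and> J \<subseteq> p \<and> (\<exists>v. Var v \<notin> p)}"

lemma Proj_points_eq: "Proj_points A = (\<lambda>p. cls J ` p) ` proj_primes"
proof (intro equalityI subsetI)
  interpret ring A using cring_A by (rule cring.axioms)
  fix P assume "P \<in> Proj_points A"
  then have pr: "primeideal P A" and hom: "P = Idl\<^bsub>A\<^esub> (P \<inter> (\<Union>d. hcomp A d))"
    and irr: "\<not> (\<Union>d\<in>{0<..}. hcomp A d) \<subseteq> P" by (auto simp: Proj_points_def homogeneous_ideal_def)
  have id: "ideal P A" using pr by (rule primeideal.axioms)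
  note l = ideal_lft[OF id]
  \<comment> \<open>The homogeneous generators of P have their components in \<open>lft P\<close>;
    as the elements with this property form an ideal, all of P is covered.\<close>
  have "P \<subseteq> cls J ` {f. \<forall>d. hc d f \<in> lft P}"
  proof (subst hom, rule genideal_minimal)
    show "ideal (cls J ` {f. \<forall>d. hc d f \<in> lft P}) A"
      by (rule ideal_image[OF tideal_components[OF l(1)]])
    show "P \<inter> (\<Union>d. hcomp A d) \<subseteq> cls J ` {f. \<forall>d. hc d f \<in> lft P}"
    proof
      fix a assume "a \<in> P \<inter> (\<Union>d. hcomp A d)"
      then obtain d f where f: "a = cls J f" "f \<in> homog d" "cls J f \<in> P" by (auto simp: A_simps)
      then have "hc e f \<in> lft P" for e using tideal_0[OF l(1)] by (simp add: hc_of_homog lft_def)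
      with f show "a \<in> cls J ` {f. \<forall>d. hc d f \<in> lft P}" by blast
    qed
  qed
  have "thomog (lft P)"
    unfolding thomog_def
  proof (intro ballI allI)
    fix f d assume "f \<in> lft P"
    then have "cls J f \<in> cls J ` {f. \<forall>d. hc d f \<in> lft P}"
      using \<open>P \<subseteq> cls J ` {f. \<forall>d. hc d f \<in> lft P}\<close> by (auto simp: lft_def)
    then obtain g where g: "f - g \<in> J" "\<forall>d. hc d g \<in> lft P" by (auto simp: cls_eq_iff[OF tJ])
    have "hc d (f - g) \<in> lft P" using g(1) hJ l(2) by (auto simp: thomog_def)
    moreover have "hc d f = hc d (f - g) + hc d g" by (simp flip: hc_add)
    ultimately show "hc d f \<in> lft P" using g(2) tideal_add[OF l(1)] by simp
  qed
  moreover have "\<exists>v. Var v \<notin> lft P"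
  proof -
    from irr obtain d f where "d > 0" "f \<in> homog d" "cls J f \<notin> P" by (auto simp: A_simps)
    then show ?thesis using Var_notin_irrelevant[OF l(1)] by (simp add: lft_def)
  qed
  ultimately have "lft P \<in> proj_primes" using tprime_lft[OF pr] l by (simp add: proj_primes_def)
  with l(3) show "P \<in> (\<lambda>p. cls J ` p) ` proj_primes" by (metis image_eqI)
next
  interpret ring A using cring_A by (rule cring.axioms)
  fix P assume "P \<in> (\<lambda>p. cls J ` p) ` proj_primes"
  then obtain p where P: "P = cls J ` p" and p: "tprime p" "thomog p" "J \<subseteq> p" "\<exists>v. Var v \<notin> p"
    by (auto simp: proj_primes_def)
  note tp = tprime_tideal[OF p(1)]
  have in_iff: "cls J f \<in> P \<longleftrightarrow> f \<in> p" for f unfolding P by (rule cls_in_image_iff[OF tJ tp p(3)])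
  have pr: "primeideal P A" unfolding P by (rule primeideal_image[OF p(1,3)])
  have id: "ideal P A" using pr by (rule primeideal.axioms)
  have "P \<subseteq> Idl\<^bsub>A\<^esub> (P \<inter> (\<Union>d. hcomp A d))"
  proof
    fix a assume "a \<in> P"
    then obtain f where f: "a = cls J f" "f \<in> p" by (auto simp: P)
    let ?I = "Idl\<^bsub>A\<^esub> (P \<inter> (\<Union>d. hcomp A d))"
    have sub: "P \<inter> (\<Union>d. hcomp A d) \<subseteq> carrier A" using in_iff by (auto simp: A_simps)
    have idI: "ideal ?I A" by (rule genideal_ideal[OF sub])
    have "hc d f \<in> lft ?I" for d
    proof -
      have "hc d f \<in> p" using p(2) f(2) by (simp add: thomog_def)
      then have "cls J (hc d f) \<in> P \<inter> (\<Union>d. hcomp A d)" unfolding A_simps using in_iff hc_homog by blast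
      then show ?thesis using genideal_self[OF sub] by (auto simp: lft_def)
    qed
    then have "f \<in> lft ?I" by (rule thomog_memI[OF ideal_lft(1)[OF idI]])
    then show "a \<in> ?I" by (simp add: lft_def f)
  qed
  moreover have "Idl\<^bsub>A\<^esub> (P \<inter> (\<Union>d. hcomp A d)) \<subseteq> P" by (rule genideal_minimal[OF id]) auto
  ultimately have "homogeneous_ideal A P" using id by (auto simp: homogeneous_ideal_def)
  moreover have "\<not> (\<Union>d\<in>{0<..}. hcomp A d) \<subseteq> P"
  proof -
    obtain v where v: "Var v \<notin> p" using p(4) by blast
    have "cls J (Var v) \<in> hcomp A (Suc 0)" unfolding A_simps by (intro imageI homog_Var)
    moreover have "cls J (Var v) \<notin> P" using v in_iff by simp
    ultimately show ?thesis by (auto simp: subset_iff)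
  qed
  ultimately show "P \<in> Proj_points A" using pr by (simp add: Proj_points_def)
qed

end

section \<open>Local rings of Proj\<close>

text \<open>The operations of \<open>Proj_local_ring\<close> are unions over representatives;
  independence of the representatives collapses such a union to a single class.\<close>

lemma UN_const: "S \<noteq> {} \<Longrightarrow> (\<And>x. x \<in> S \<Longrightarrow> F x = c) \<Longrightarrow> (\<Union>x\<in>S. F x) = c"
  by auto

locale proj_prime = graded_quotient J for J :: "('m, 'c::comm_ring_1) mpoly set" +
  fixes p :: "('m, 'c) mpoly set"
  assumes p_prime: "p \<in> proj_primes"
begin

abbreviation "P \<equiv> cls J ` p"
abbreviation "L \<equiv> Proj_local_ring A P"

text \<open>Fractions are handled through polynomial representatives, so that equality in the local
  ring becomes membership in J.\<close>

definition adm :: "('m, 'c) mpoly \<Rightarrow> ('m, 'c) mpoly \<Rightarrow> bool" where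
  "adm f s \<longleftrightarrow> (\<exists>d. f \<in> homog d \<and> s \<in> homog d \<and> s \<notin> p)"

definition fr :: "('m, 'c) mpoly \<Rightarrow> ('m, 'c) mpoly \<Rightarrow> (('m, 'c) mpoly set \<times> ('m, 'c) mpoly set) set" where
  "fr f s = hfrac A P (cls J f) (cls J s)"

definition rel :: "('m, 'c) mpoly \<Rightarrow> ('m, 'c) mpoly \<Rightarrow> ('m, 'c) mpoly \<Rightarrow> ('m, 'c) mpoly \<Rightarrow> bool" where
  "rel f s g t \<longleftrightarrow> (\<exists>k. \<exists>u\<in>homog k. u \<notin> p \<and> u * (f * t - g * s) \<in> J)"

lemma p_props: "tprime p" "thomog p" "J \<subseteq> p" "\<exists>v. Var v \<notin> p"
  using p_prime by (auto simp: proj_primes_def)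

lemma tp: "tideal p"
  by (rule tprime_tideal[OF p_props(1)])

lemma p_mult: "x * y \<in> p \<longleftrightarrow> x \<in> p \<or> y \<in> p"
  by (rule tprime_mult_iff[OF p_props(1)])

lemma p_1: "1 \<notin> p"
  by (rule tprime_1[OF p_props(1)])

lemma in_P: "cls J f \<in> P \<longleftrightarrow> f \<in> p"
  by (rule cls_in_image_iff[OF tJ tp p_props(3)])

lemma hfracs_iff: "(a, b) \<in> hfracs A P \<longleftrightarrow> (\<exists>f s. a = cls J f \<and> b = cls J s \<and> adm f s)"
proof
  assume "(a, b) \<in> hfracs A P"
  then obtain d where "a \<in> hcomp A d" "b \<in> hcomp A d" "b \<notin> P" by (auto simp: hfracs_def)
  then obtain f s where "a = cls J f" "f \<in> homog d" "b = cls J s" "s \<in> homog d" "cls J s \<notin> P"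
    unfolding A_simps by blast
  then show "\<exists>f s. a = cls J f \<and> b = cls J s \<and> adm f s" unfolding in_P adm_def by blast
next
  assume "\<exists>f s. a = cls J f \<and> b = cls J s \<and> adm f s"
  then obtain f s d where 1: "a = cls J f" "b = cls J s" "f \<in> homog d" "s \<in> homog d" "s \<notin> p"
    by (auto simp: adm_def)
  then have "a \<in> hcomp A d" "b \<in> hcomp A d" "b \<notin> P" by (auto simp: A_simps in_P simp del: image_iff)
  then show "(a, b) \<in> hfracs A P" unfolding hfracs_def by blast
qed

lemma fr_mem_iff:
  assumes "adm g t" shows "(cls J g, cls J t) \<in> fr f s \<longleftrightarrow> rel f s g t"
proof -
  have 1: "(cls J g, cls J t) \<in> hfracs A P" using assms hfracs_iff by blast
  have "(cls J g, cls J t) \<in> fr f s \<longleftrightarrow> (\<exists>u \<in> (\<Union>d. hcomp A d) - P.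
      u \<otimes>\<^bsub>A\<^esub> (cls J f \<otimes>\<^bsub>A\<^esub> cls J t \<ominus>\<^bsub>A\<^esub> cls J g \<otimes>\<^bsub>A\<^esub> cls J s) = \<zero>\<^bsub>A\<^esub>)"
    using 1 by (simp add: fr_def hfrac_def)
  also have "\<dots> \<longleftrightarrow> (\<exists>k. \<exists>u\<in>homog k. cls J u \<notin> P \<and>
      cls J u \<otimes>\<^bsub>A\<^esub> (cls J f \<otimes>\<^bsub>A\<^esub> cls J t \<ominus>\<^bsub>A\<^esub> cls J g \<otimes>\<^bsub>A\<^esub> cls J s) = \<zero>\<^bsub>A\<^esub>)"
    unfolding A_simps(6) by blast
  also have "\<dots> \<longleftrightarrow> rel f s g t"
    unfolding rel_def in_P A_simps(2) A_minus cls_eq_zero_iff ..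
  finally show ?thesis .
qed

lemma rel_refl: "rel f s f s"
  unfolding rel_def using tideal_0[OF tJ] p_1 by (intro exI[of _ 0] bexI[of _ 1]) auto

lemma rel_sym: assumes "rel f s g t" shows "rel g t f s"
proof -
  from assms obtain k u where u: "u \<in> homog k" "u \<notin> p" "u * (f * t - g * s) \<in> J" by (auto simp: rel_def)
  have "u * (g * s - f * t) = - (u * (f * t - g * s))" by (simp add: algebra_simps)
  with u tideal_minus[OF tJ u(3)] show ?thesis unfolding rel_def by metis
qed

lemma rel_trans:
  assumes "rel f s g t" "rel g t h r" "adm g t" shows "rel f s h r"
proof -
  from assms(1) obtain k u where u: "u \<in> homog k" "u \<notin> p" "u * (f * t - g * s) \<in> J" by (auto simp: rel_def)
  from assms(2) obtain l w where w: "w \<in> homog l" "w \<notin> p" "w * (g * r - h * t) \<in> J" by (auto simp: rel_def)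
  from assms(3) obtain d where t: "t \<in> homog d" "t \<notin> p" by (auto simp: adm_def)
  \<comment> \<open>The denominator t of the middle fraction joins the multiplier; like u and w it
    lies outside the prime p.\<close>
  have "(u * w * t) * (f * r - h * s) = (w * r) * (u * (f * t - g * s)) + (u * s) * (w * (g * r - h * t))"
    by (simp add: algebra_simps)
  also have "\<dots> \<in> J" by (rule tideal_add[OF tJ tideal_mult[OF tJ u(3)] tideal_mult[OF tJ w(3)]])
  finally have "(u * w * t) * (f * r - h * s) \<in> J" .
  moreover have "u * w * t \<in> homog (k + l + d)" using u w t by (intro homog_mult)
  moreover have "u * w * t \<notin> p" using u w t by (simp add: p_mult)
  ultimately show ?thesis unfolding rel_def by blast
qed

lemma fr_eq_iff:
  assumes "adm f s" "adm g t" shows "fr f s = fr g t \<longleftrightarrow> rel f s g t"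
proof
  assume "fr f s = fr g t"
  then have "(cls J g, cls J t) \<in> fr f s" using fr_mem_iff[OF assms(2)] rel_refl by blast
  then show "rel f s g t" using fr_mem_iff[OF assms(2)] by blast
next
  assume r: "rel f s g t"
  have "(a, b) \<in> fr f s \<longleftrightarrow> (a, b) \<in> fr g t" for a b
  proof (cases "(a, b) \<in> hfracs A P")
    case True
    then obtain h r where "a = cls J h" "b = cls J r" "adm h r" using hfracs_iff by blast
    then show ?thesis using r rel_trans rel_trans rel_sym assms fr_mem_iff by blast
  qed (auto simp: fr_def hfrac_def)
  then show "fr f s = fr g t" by auto
qed

lemma fr_memE:
  assumes "x \<in> fr f s"
  obtains g t where "x = (cls J g, cls J t)" "adm g t" "rel f s g t"
proof -
  obtain a b where x: "x = (a, b)" by (cases x)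
  with assms have "(a, b) \<in> hfracs A P" by (auto simp: fr_def hfrac_def)
  then obtain g t where 1: "a = cls J g" "b = cls J t" "adm g t" using hfracs_iff by blast
  then have "rel f s g t" using fr_mem_iff[OF 1(3)] assms x by blast
  with 1 x that show thesis by blast
qed

lemma fr_self: "adm f s \<Longrightarrow> (cls J f, cls J s) \<in> fr f s"
  by (simp add: fr_mem_iff rel_refl)

lemma adm_mult: assumes "adm f s" "adm g t" shows "adm (f * g) (s * t)"
proof -
  from assms obtain d e where "f \<in> homog d" "s \<in> homog d" "s \<notin> p" "g \<in> homog e" "t \<in> homog e" "t \<notin> p"
    by (auto simp: adm_def)
  then show ?thesis unfolding adm_def using homog_mult p_mult by blast
qed

lemma adm_add: assumes "adm f s" "adm g t" shows "adm (f * t + g * s) (s * t)"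
proof -
  from assms obtain d e where 1: "f \<in> homog d" "s \<in> homog d" "s \<notin> p" "g \<in> homog e" "t \<in> homog e" "t \<notin> p"
    by (auto simp: adm_def)
  have "g * s \<in> homog (d + e)" using homog_mult[OF 1(4,2)] by (simp only: add.commute)
  then have "f * t + g * s \<in> homog (d + e)" by (rule homog_add[OF homog_mult[OF 1(1,5)]])
  with 1 show ?thesis unfolding adm_def using homog_mult p_mult by blast
qed

lemma rel_mult:
  assumes "rel f s f' s'" "rel g t g' t'" shows "rel (f * g) (s * t) (f' * g') (s' * t')"
proof -
  from assms(1) obtain k u where u: "u \<in> homog k" "u \<notin> p" "u * (f * s' - f' * s) \<in> J" by (auto simp: rel_def)
  from assms(2) obtain l w where w: "w \<in> homog l" "w \<notin> p" "w * (g * t' - g' * t) \<in> J" by (auto simp: rel_def)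
  have "(u * w) * ((f * g) * (s' * t') - (f' * g') * (s * t)) =
      (w * g * t') * (u * (f * s' - f' * s)) + (u * f' * s) * (w * (g * t' - g' * t))"
    by (simp add: algebra_simps)
  also have "\<dots> \<in> J" by (rule tideal_add[OF tJ tideal_mult[OF tJ u(3)] tideal_mult[OF tJ w(3)]])
  finally show ?thesis unfolding rel_def using u w homog_mult p_mult by blast
qed

lemma rel_add:
  assumes "rel f s f' s'" "rel g t g' t'" shows "rel (f * t + g * s) (s * t) (f' * t' + g' * s') (s' * t')"
proof -
  from assms(1) obtain k u where u: "u \<in> homog k" "u \<notin> p" "u * (f * s' - f' * s) \<in> J" by (auto simp: rel_def)
  from assms(2) obtain l w where w: "w \<in> homog l" "w \<notin> p" "w * (g * t' - g' * t) \<in> J" by (auto simp: rel_def)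
  have "(u * w) * ((f * t + g * s) * (s' * t') - (f' * t' + g' * s') * (s * t)) =
      (w * t * t') * (u * (f * s' - f' * s)) + (u * s * s') * (w * (g * t' - g' * t))"
    by (simp add: algebra_simps)
  also have "\<dots> \<in> J" by (rule tideal_add[OF tJ tideal_mult[OF tJ u(3)] tideal_mult[OF tJ w(3)]])
  finally show ?thesis unfolding rel_def using u w homog_mult p_mult by blast
qed

lemma carrier_L: "carrier L = {fr f s | f s. adm f s}"
proof -
  have "carrier L = (\<lambda>(a, s). hfrac A P a s) ` hfracs A P" by (simp add: Proj_local_ring_def)
  also have "\<dots> = {fr f s | f s. adm f s}"
  proof (intro equalityI subsetI)
    fix x assume "x \<in> (\<lambda>(a, s). hfrac A P a s) ` hfracs A P"
    then obtain a b where x: "x = hfrac A P a b" "(a, b) \<in> hfracs A P" by auto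
    then obtain f s where "a = cls J f" "b = cls J s" "adm f s" using hfracs_iff by blast
    with x show "x \<in> {fr f s | f s. adm f s}" by (auto simp: fr_def)
  next
    fix x assume "x \<in> {fr f s | f s. adm f s}"
    then obtain f s where x: "x = fr f s" "adm f s" by auto
    then have "(cls J f, cls J s) \<in> hfracs A P" using hfracs_iff by blast
    then show "x \<in> (\<lambda>(a, s). hfrac A P a s) ` hfracs A P"
      by (rule rev_image_eqI) (simp add: x fr_def)
  qed
  finally show ?thesis .
qed

lemma carrier_LE: assumes "x \<in> carrier L" obtains f s where "x = fr f s" "adm f s"
  using assms by (auto simp: carrier_L)

lemma fr_in_carrier: "adm f s \<Longrightarrow> fr f s \<in> carrier L"
  by (auto simp: carrier_L)

lemma one_L: "\<one>\<^bsub>L\<^esub> = fr 1 1" and zero_L: "\<zero>\<^bsub>L\<^esub> = fr 0 1"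
  by (simp_all add: Proj_local_ring_def fr_def A_simps)

lemma mult_L: assumes "adm f s" "adm g t" shows "fr f s \<otimes>\<^bsub>L\<^esub> fr g t = fr (f * g) (s * t)"
proof -
  have "fr f s \<otimes>\<^bsub>L\<^esub> fr g t =
      (\<Union>x\<in>fr f s. \<Union>y\<in>fr g t. hfrac A P (fst x \<otimes>\<^bsub>A\<^esub> fst y) (snd x \<otimes>\<^bsub>A\<^esub> snd y))"
    by (simp add: Proj_local_ring_def case_prod_beta)
  also have "\<dots> = fr (f * g) (s * t)"
  proof (intro UN_const)
    fix x y assume "x \<in> fr f s" "y \<in> fr g t"
    then obtain f' s' g' t' where 1: "x = (cls J f', cls J s')" "adm f' s'" "rel f s f' s'"
      "y = (cls J g', cls J t')" "adm g' t'" "rel g t g' t'" by (metis fr_memE)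
    have "fr (f' * g') (s' * t') = fr (f * g) (s * t)"
      using 1 assms rel_mult rel_sym by (subst fr_eq_iff) (auto intro: adm_mult)
    then show "hfrac A P (fst x \<otimes>\<^bsub>A\<^esub> fst y) (snd x \<otimes>\<^bsub>A\<^esub> snd y) = fr (f * g) (s * t)"
      by (simp add: 1 A_simps fr_def)
  qed (use fr_self assms in auto)
  finally show ?thesis .
qed

lemma add_L: assumes "adm f s" "adm g t" shows "fr f s \<oplus>\<^bsub>L\<^esub> fr g t = fr (f * t + g * s) (s * t)"
proof -
  have "fr f s \<oplus>\<^bsub>L\<^esub> fr g t =
      (\<Union>x\<in>fr f s. \<Union>y\<in>fr g t. hfrac A P (fst x \<otimes>\<^bsub>A\<^esub> snd y \<oplus>\<^bsub>A\<^esub> fst y \<otimes>\<^bsub>A\<^esub> snd x) (snd x \<otimes>\<^bsub>A\<^esub> snd y))"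
    by (simp add: Proj_local_ring_def case_prod_beta)
  also have "\<dots> = fr (f * t + g * s) (s * t)"
  proof (intro UN_const)
    fix x y assume "x \<in> fr f s" "y \<in> fr g t"
    then obtain f' s' g' t' where 1: "x = (cls J f', cls J s')" "adm f' s'" "rel f s f' s'"
      "y = (cls J g', cls J t')" "adm g' t'" "rel g t g' t'" by (metis fr_memE)
    have "fr (f' * t' + g' * s') (s' * t') = fr (f * t + g * s) (s * t)"
      using 1 assms rel_add rel_sym by (subst fr_eq_iff) (auto intro: adm_mult adm_add)
    then show "hfrac A P (fst x \<otimes>\<^bsub>A\<^esub> snd y \<oplus>\<^bsub>A\<^esub> fst y \<otimes>\<^bsub>A\<^esub> snd x) (snd x \<otimes>\<^bsub>A\<^esub> snd y) = fr (f * t + g * s) (s * t)"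
      by (simp add: 1 A_simps fr_def)
  qed (use fr_self assms in auto)
  finally show ?thesis .
qed

lemma adm_1: "f \<in> homog 0 \<Longrightarrow> adm f 1"
  unfolding adm_def using p_1 homog_1 by blast

lemma add_L_same: assumes "adm f s" "adm g s" shows "fr f s \<oplus>\<^bsub>L\<^esub> fr g s = fr (f + g) s"
proof -
  from assms obtain d e where 1: "f \<in> homog d" "s \<in> homog d" "s \<notin> p" "g \<in> homog e" "s \<in> homog e"
    by (auto simp: adm_def)
  \<comment> \<open>The two degrees witnessing admissibility must coincide: s lies outside p, hence
    is nonzero, and a nonzero homogeneous polynomial has only one degree.\<close>
  have "s \<noteq> 0" using 1(3) tideal_0[OF tp] by auto
  then obtain m where "m \<in> keys s" by (metis in_keys_iff lookup_zero poly_mapping_eqI)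
  then have "d = e" using 1 by (auto simp: homog_def)
  then have adm: "adm (f + g) s" using 1 homog_add unfolding adm_def by blast
  have "rel (f * s + g * s) (s * s) (f + g) s"
    unfolding rel_def using p_1 tideal_0[OF tJ] by (intro exI[of _ 0] bexI[of _ 1]) (auto simp: algebra_simps)
  then have "fr (f * s + g * s) (s * s) = fr (f + g) s"
    using fr_eq_iff[OF adm_add[OF assms] adm] by simp
  then show ?thesis by (simp add: add_L[OF assms])
qed

end

section \<open>The two projections\<close>

text \<open>Recognises the coefficientwise map as a substitution, which makes it a
  homomorphism.\<close>

lemma extend_coeffs_eq: "extend_coeffs f = poly_subst (\<lambda>c. Const (Const c)) Var f"
proof (rule poly_mapping_eqI)
  fix k
  have "lookup (extend_coeffs f) k = Const (lookup f k)"
    by (simp add: extend_coeffs_def Poly_Mapping.map.rep_eq when_def rhom_0[OF rhom_Const])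
  also have "\<dots> = lookup (poly_subst (\<lambda>c. Const (Const c)) Var f) k"
    unfolding poly_subst_mval lookup_sum
    by (simp add: flip: single_eq_Const_mult)
       (auto simp: lookup_single when_def sum.delta' in_keys_iff rhom_0[OF rhom_Const])
  finally show "lookup (extend_coeffs f) k = lookup (poly_subst (\<lambda>c. Const (Const c)) Var f) k" .
qed

lemma rhom_extend_coeffs:
  "rhom (extend_coeffs :: ('m, 'k::comm_ring_1) mpoly \<Rightarrow> ('m, ('n, 'k) mpoly) mpoly)"
proof -
  have "rhom (poly_subst (\<lambda>c. Const (Const c)) Var :: ('m, 'k) mpoly \<Rightarrow> ('m, ('n, 'k) mpoly) mpoly)"
    by (intro rhom_poly_subst rhom_comp[of Const Const]) auto
  then show ?thesis by (simp add: extend_coeffs_eq[abs_def])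
qed

lemma lookup_extend_coeffs: "lookup (extend_coeffs f) k = Const (lookup f k)"
  by (simp add: extend_coeffs_def Poly_Mapping.map.rep_eq when_def rhom_0[OF rhom_Const])

lemma hc_extend_coeffs: "hc d (extend_coeffs f) = extend_coeffs (hc d f)"
  by (rule poly_mapping_eqI) (simp add: lookup_hc lookup_extend_coeffs rhom_0[OF rhom_Const])

lemma extend_coeffs_homog: "f \<in> homog d \<Longrightarrow> extend_coeffs f \<in> homog d"
  by (auto simp: homog_def in_keys_iff lookup_extend_coeffs)

lemma extend_coeffs_Const: "extend_coeffs (Const c) = Const (Const c)"
  by (simp add: extend_coeffs_eq poly_subst_Const rhom_0[OF rhom_Const])

lemma extend_coeffs_Var: "extend_coeffs (Var v) = Var v"
  unfolding extend_coeffs_eq by (rule poly_subst_Var) (rule rhom_comp[of Const Const]; simp)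

locale product_family = I: graded_quotient I + J: graded_quotient J
  for I :: "('m, 'k::comm_ring_1) mpoly set" and J :: "('m, ('n, 'k) mpoly) mpoly set" +
  assumes ext_I: "extend_coeffs ` I \<subseteq> J"
begin

lemma pr1_hom_cls: "pr1_hom J (cls I f) = cls J (extend_coeffs f)"
proof -
  have eq: "cls J (extend_coeffs g) = cls J (extend_coeffs f)" if "g \<in> cls I f" for g
  proof -
    have "extend_coeffs (g - f) \<in> J" using that ext_I by (auto simp: cls_def)
    then show ?thesis by (simp add: cls_eq_iff[OF J.tJ] rhom_diff[OF rhom_extend_coeffs])
  qed
  show ?thesis unfolding pr1_hom_def poly_gring_coset
  proof (rule UN_const)
    show "cls I f \<noteq> {}" using cls_self[OF I.tJ, of f] by blast
  qed (rule eq)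
qed

lemma pr2_hom_eq: "pr2_hom J g = cls J (Const g)"
  by (simp add: pr2_hom_def poly_gring_coset)

abbreviation contr :: "('m, ('n, 'k) mpoly) mpoly set \<Rightarrow> ('m, 'k) mpoly set" where
  "contr q \<equiv> {f. extend_coeffs f \<in> q}"

text \<open>Variables are mapped to variables, so the contracted prime still misses one of them.
  This is why the first projection is defined on all of \<Sigma>.\<close>

lemma contr_prime:
  assumes "q \<in> J.proj_primes" shows "contr q \<in> I.proj_primes"
proof -
  have q: "tprime q" "thomog q" "J \<subseteq> q" "\<exists>v. Var v \<notin> q" using assms by (auto simp: J.proj_primes_def)
  have "tprime (contr q)" by (rule tprime_vimage[OF rhom_extend_coeffs q(1)])
  moreover have "thomog (contr q)" using q(2) by (auto simp: thomog_def simp flip: hc_extend_coeffs)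
  ultimately show ?thesis using q(3,4) ext_I by (auto simp: I.proj_primes_def extend_coeffs_Var)
qed

lemma in_image_J: "q \<in> J.proj_primes \<Longrightarrow> cls J f \<in> cls J ` q \<longleftrightarrow> f \<in> q"
  using cls_in_image_iff[OF J.tJ] tprime_tideal by (auto simp: J.proj_primes_def)

lemma in_image_I: "q \<in> I.proj_primes \<Longrightarrow> cls I f \<in> cls I ` q \<longleftrightarrow> f \<in> q"
  using cls_in_image_iff[OF I.tJ] tprime_tideal by (auto simp: I.proj_primes_def)

lemma image_I_inj: "q \<in> I.proj_primes \<Longrightarrow> q' \<in> I.proj_primes \<Longrightarrow> cls I ` q = cls I ` q' \<longleftrightarrow> q = q'"
proof
  assume q: "q \<in> I.proj_primes" "q' \<in> I.proj_primes" and eq: "cls I ` q = cls I ` q'"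
  have "f \<in> q \<longleftrightarrow> f \<in> q'" for f
    using in_image_I[OF q(1), of f] in_image_I[OF q(2), of f] unfolding eq by blast
  then show "q = q'" by blast
qed simp

lemma Proj_map_eq:
  assumes "q \<in> J.proj_primes" shows "Proj_map I.A (pr1_hom J) (cls J ` q) = cls I ` contr q"
proof -
  have "pr1_hom J (cls I f) \<in> cls J ` q \<longleftrightarrow> f \<in> contr q" for f
    unfolding pr1_hom_cls using in_image_J[OF assms] by blast
  then show ?thesis unfolding Proj_map_def I.A_simps by blast
qed

lemma pr1_eq: "q \<in> J.proj_primes \<Longrightarrow> pr1 I J (cls J ` q) = cls I ` contr q"
  unfolding pr1_def by (rule Proj_map_eq)

lemma pr2_eq: "q \<in> J.proj_primes \<Longrightarrow> pr2 J (cls J ` q) = {g. Const g \<in> q}"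
  unfolding pr2_def pr2_hom_eq by (simp only: in_image_J)

lemma fiber_iff:
  assumes "q0 \<in> I.proj_primes"
  shows "z \<in> pr1_fiber I J (cls I ` q0) \<longleftrightarrow> (\<exists>q\<in>J.proj_primes. z = cls J ` q \<and> contr q = q0)"
proof -
  have "z \<in> pr1_fiber I J (cls I ` q0) \<longleftrightarrow> (\<exists>q\<in>J.proj_primes. z = cls J ` q \<and> cls I ` contr q = cls I ` q0)"
  proof -
    have "z \<in> pr1_fiber I J (cls I ` q0) \<longleftrightarrow> (\<exists>q\<in>J.proj_primes. z = cls J ` q \<and> pr1 I J (cls J ` q) = cls I ` q0)"
      unfolding pr1_fiber_def J.Proj_points_eq by blast
    also have "\<dots> \<longleftrightarrow> (\<exists>q\<in>J.proj_primes. z = cls J ` q \<and> cls I ` contr q = cls I ` q0)"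
      by (simp add: pr1_eq cong: bex_cong)
    finally show ?thesis .
  qed
  also have "\<dots> \<longleftrightarrow> (\<exists>q\<in>J.proj_primes. z = cls J ` q \<and> contr q = q0)"
    by (simp add: image_I_inj[OF contr_prime assms] cong: bex_cong)
  finally show ?thesis .
qed

end

locale family_point = product_family I J for I :: "('m, 'k::comm_ring_1) mpoly set"
    and J :: "('m, ('n, 'k) mpoly) mpoly set" +
  fixes q :: "('m, ('n, 'k) mpoly) mpoly set"
  assumes q_prime: "q \<in> J.proj_primes"
begin

sublocale B: proj_prime J q
  by unfold_locales (rule q_prime)

sublocale R: proj_prime I "contr q"
  by unfold_locales (rule contr_prime[OF q_prime])

abbreviation "\<phi> \<equiv> Proj_local_map J.A (pr1_hom J) (cls J ` q)"

lemma adm_ext: "R.adm f s \<Longrightarrow> B.adm (extend_coeffs f) (extend_coeffs s)"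
  unfolding R.adm_def B.adm_def using extend_coeffs_homog by blast

lemma local_map_fr:
  assumes "R.adm f s" shows "\<phi> (R.fr f s) = B.fr (extend_coeffs f) (extend_coeffs s)"
proof -
  have "\<phi> (R.fr f s) = (\<Union>x\<in>R.fr f s. hfrac J.A (cls J ` q) (pr1_hom J (fst x)) (pr1_hom J (snd x)))"
    by (simp add: Proj_local_map_def case_prod_beta)
  also have "\<dots> = B.fr (extend_coeffs f) (extend_coeffs s)"
  proof (rule UN_const)
    show "R.fr f s \<noteq> {}" using R.fr_self[OF assms] by auto
    fix x assume "x \<in> R.fr f s"
    then obtain g t where x: "x = (cls I g, cls I t)" "R.adm g t" "R.rel f s g t" by (rule R.fr_memE)
    from x(3) obtain k u where u: "u \<in> homog k" "extend_coeffs u \<notin> q" "u * (f * t - g * s) \<in> I"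
      by (auto simp: R.rel_def)
    have "extend_coeffs (u * (f * t - g * s)) \<in> J" using u(3) ext_I by blast
    then have "B.rel (extend_coeffs f) (extend_coeffs s) (extend_coeffs g) (extend_coeffs t)"
      unfolding B.rel_def using u(2) extend_coeffs_homog[OF u(1)]
      by (intro exI[of _ k] bexI[of _ "extend_coeffs u"]) (simp_all add: rhom_simps[OF rhom_extend_coeffs])
    then have "B.fr (extend_coeffs g) (extend_coeffs t) = B.fr (extend_coeffs f) (extend_coeffs s)"
      using B.fr_eq_iff adm_ext x(2) assms B.rel_sym by blast
    then show "hfrac J.A (cls J ` q) (pr1_hom J (fst x)) (pr1_hom J (snd x)) = B.fr (extend_coeffs f) (extend_coeffs s)"
      by (simp add: x pr1_hom_cls B.fr_def)
  qed
  finally show ?thesis .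
qed

lemma flat_at:
  assumes "Proj_flat I.A J.A (pr1_hom J)"
  shows "flat_module R.L (restrict_scalars B.L \<phi>)" "\<phi> \<in> ring_hom R.L B.L"
proof -
  have "cls J ` q \<in> Proj_points J.A" unfolding J.Proj_points_eq using q_prime by blast
  with assms have "flat_ring_hom R.L B.L \<phi>"
    unfolding Proj_flat_def using Proj_map_eq[OF q_prime] by metis
  then show "flat_module R.L (restrict_scalars B.L \<phi>)" "\<phi> \<in> ring_hom R.L B.L"
    by (auto simp: flat_ring_hom_def)
qed

end

lemma restrict_scalars_simps [simp]:
  "carrier (restrict_scalars B h) = carrier B" "x \<oplus>\<^bsub>restrict_scalars B h\<^esub> y = x \<oplus>\<^bsub>B\<^esub> y"
  "\<zero>\<^bsub>restrict_scalars B h\<^esub> = \<zero>\<^bsub>B\<^esub>" "a \<odot>\<^bsub>restrict_scalars B h\<^esub> y = h a \<otimes>\<^bsub>B\<^esub> y"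
  by (simp_all add: restrict_scalars_def ring.extend_def module.fields_def)

section \<open>Rational points\<close>

abbreviation pev :: "('v \<Rightarrow> 'k) \<Rightarrow> ('v, 'k::comm_ring_1) mpoly \<Rightarrow> 'k" where
  "pev \<equiv> poly_subst (\<lambda>c. c)"

lemma rhom_pev [simp]: "rhom (pev b)"
  by (rule rhom_poly_subst) simp

lemma mval_monom: "mval (\<lambda>v. monom (x v) (Suc 0)) m = monom (mval x m) (tdeg m)"
proof -
  have "(\<Prod>v\<in>A. monom (x v) (Suc 0) ^ g v) = monom (\<Prod>v\<in>A. x v ^ g v) (\<Sum>v\<in>A. g v)"
    if "finite A" for A g
    using that by induction (simp_all add: Polynomial.monom_power mult_monom)
  then show ?thesis by (simp add: mval_def tdeg_def)
qed

text \<open>The homogeneous prime of the point \<open>x\<close>, or of the point \<open>(x, b)\<close> of the product if \<open>\<psi>\<close> is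
  evaluation at \<open>b\<close>.\<close>

definition pt :: "('c \<Rightarrow> 'k::field) \<Rightarrow> ('m \<Rightarrow> 'k) \<Rightarrow> ('m, 'c::comm_ring_1) mpoly set" where
  "pt \<psi> x = {f. \<forall>d. poly_subst \<psi> x (hc d f) = 0}"

text \<open>Replacing each variable v by \<open>x v\<close> T, with T a new variable, gives a
  homomorphism into K[T]. The coefficient of the d-th power of T in the image of f is the value of
  the component \<open>hc d f\<close>. So \<open>pt\<close> is the kernel of a map into a
  domain.\<close>

lemma tprime_pt:
  assumes \<psi>: "rhom \<psi>" shows "tprime (pt \<psi> x)"
proof -
  have r: "rhom (\<lambda>c. [:\<psi> c:])" by (rule rhom_comp[of "\<lambda>c. [:c:]", OF _ \<psi>]) (auto intro: rhomI)
  define F where "F = poly_subst (\<lambda>c. [:\<psi> c:]) (\<lambda>v. monom (x v) (Suc 0))"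
  have F: "rhom F" unfolding F_def by (rule rhom_poly_subst[OF r])
  have "coeff (F f) d = poly_subst \<psi> x (hc d f)" for f d
  proof -
    have "F f = (\<Sum>m\<in>keys f. monom (\<psi> (lookup f m) * mval x m) (tdeg m))"
      by (simp add: F_def poly_subst_mval mval_monom smult_monom)
    then have "coeff (F f) d = (\<Sum>m\<in>keys f. if tdeg m = d then \<psi> (lookup f m) * mval x m else 0)"
      by (simp add: coeff_sum)
    also have "\<dots> = (\<Sum>m\<in>keys f. \<psi> (lookup (hc d f) m) * mval x m)"
      by (intro sum.cong) (auto simp: lookup_hc rhom_0[OF \<psi>])
    also have "\<dots> = poly_subst \<psi> x (hc d f)"
      by (rule poly_subst_superset[symmetric]) (auto simp: in_keys_iff lookup_hc rhom_0[OF \<psi>] split: if_splits)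
    finally show ?thesis .
  qed
  then have "pt \<psi> x = {f. F f = 0}" by (auto simp: pt_def poly_eq_iff)
  then show ?thesis using tprime_ker[OF F] by simp
qed

lemma hc_hc: "hc d (hc e f) = (if d = e then hc e f else 0)"
  by (simp add: hc_of_homog[OF hc_homog])

lemma thomog_pt: assumes "rhom \<psi>" shows "thomog (pt \<psi> x)"
  by (auto simp: thomog_def pt_def hc_hc rhom_0[OF rhom_poly_subst[OF assms]])

lemma pt_homog:
  assumes "rhom \<psi>" "f \<in> homog d" shows "f \<in> pt \<psi> x \<longleftrightarrow> poly_subst \<psi> x f = 0"
  using rhom_0[OF rhom_poly_subst[OF assms(1)]] by (auto simp: pt_def hc_of_homog[OF assms(2)])

lemma pt_Var: "rhom \<psi> \<Longrightarrow> Var v \<in> pt \<psi> x \<longleftrightarrow> x v = 0"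
  by (simp add: pt_homog[OF _ homog_Var] poly_subst_Var)

lemma pt_vanish: assumes "rhom \<psi>" "f \<in> pt \<psi> x" shows "poly_subst \<psi> x f = 0"
proof -
  obtain n where "f = (\<Sum>d\<le>n. hc d f)" using sum_hc[of f] by blast
  then have "poly_subst \<psi> x f = (\<Sum>d\<le>n. poly_subst \<psi> x (hc d f))"
    by (metis rhom_sum rhom_poly_subst assms(1))
  then show ?thesis using assms(2) by (simp add: pt_def)
qed

lemma subset_pt_iff:
  assumes "rhom \<psi>" "thomog J" shows "J \<subseteq> pt \<psi> x \<longleftrightarrow> (\<forall>j\<in>J. poly_subst \<psi> x j = 0)"
proof
  assume "J \<subseteq> pt \<psi> x"
  then show "\<forall>j\<in>J. poly_subst \<psi> x j = 0" using pt_vanish[OF assms(1)] by blast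
next
  assume "\<forall>j\<in>J. poly_subst \<psi> x j = 0"
  then show "J \<subseteq> pt \<psi> x" using assms(2) unfolding pt_def thomog_def by blast
qed

lemma poly_subst_scale:
  assumes "rhom \<psi>" "f \<in> homog d" shows "poly_subst \<psi> (\<lambda>v. c * x v) f = c ^ d * poly_subst \<psi> x f"
proof -
  have "mval (\<lambda>v. c * x v) m = c ^ tdeg m * mval x m" for m
    by (simp add: mval_def tdeg_def power_mult_distrib prod.distrib power_sum)
  then show ?thesis using assms(2)
    by (simp add: poly_subst_mval sum_distrib_left homog_def mult_ac)
qed

lemma pt_scale:
  assumes "rhom \<psi>" "c \<noteq> 0" shows "pt \<psi> (\<lambda>v. c * x v) = pt \<psi> x"
  by (simp add: pt_def poly_subst_scale[OF assms(1) hc_homog] assms(2))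

lemma mval_diff_ideal:
  assumes I: "tideal I" and st: "\<And>v. s v - t v \<in> I" shows "mval s m - mval t m \<in> I"
proof -
  have mult: "x * y - x' * y' \<in> I" if "x - x' \<in> I" "y - y' \<in> I" for x y x' y'
  proof -
    have "x * y - x' * y' = y * (x - x') + x' * (y - y')" by (simp add: algebra_simps)
    with that show ?thesis by (simp add: tideal_add[OF I] tideal_mult[OF I])
  qed
  have pow: "s v ^ k - t v ^ k \<in> I" for v k
    by (induction k) (auto simp: tideal_0[OF I] intro: mult st)
  have "(\<Prod>v\<in>A. s v ^ g v) - (\<Prod>v\<in>A. t v ^ g v) \<in> I" if "finite A" for A g
    using that by induction (auto simp: tideal_0[OF I] intro: mult pow)
  then show ?thesis by (simp add: mval_def)
qed

text \<open>Modulo I all variables are multiples of the single element w, with the coordinates of x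
  as factors; so a homogeneous f of degree d becomes f(x) times the d-th power of w. The map
  \<open>\<kappa>\<close> returns values to the coefficient ring.\<close>

lemma homog_congruence:
  fixes \<psi> :: "'c::comm_ring_1 \<Rightarrow> 'd::comm_ring_1" and \<kappa> :: "'d \<Rightarrow> 'c"
  assumes I: "tideal I" and \<psi>: "rhom \<psi>" and \<kappa>: "rhom \<kappa>"
    and c: "\<And>c. Const c - Const (\<kappa> (\<psi> c)) \<in> I" and v: "\<And>v. Var v - Const (\<kappa> (x v)) * w \<in> I"
    and f: "f \<in> homog d"
  shows "f - Const (\<kappa> (poly_subst \<psi> x f)) * w ^ d \<in> I"
proof -
  let ?t = "\<lambda>v. Const (\<kappa> (x v)) * w"
  have mv: "mval ?t m = Const (\<kappa> (mval x m)) * w ^ tdeg m" for m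
    by (simp add: mval_def tdeg_def power_mult_distrib prod.distrib power_sum rhom_simps[OF \<kappa>]
        rhom_prod[OF rhom_Const] rhom_power[OF rhom_Const])
  have "f - (\<Sum>m\<in>keys f. Const (\<kappa> (\<psi> (lookup f m))) * mval ?t m) =
      (\<Sum>m\<in>keys f. Const (lookup f m) * mval Var m - Const (\<kappa> (\<psi> (lookup f m))) * mval ?t m)"
    by (subst poly_mapping_sum_single[of f]) (simp add: single_eq_Const_mult sum_subtractf)
  also have "\<dots> \<in> I"
  proof (rule tideal_sum[OF I])
    fix m
    have "Const (lookup f m) * mval Var m - Const (\<kappa> (\<psi> (lookup f m))) * mval ?t m =
      mval Var m * (Const (lookup f m) - Const (\<kappa> (\<psi> (lookup f m)))) + Const (\<kappa> (\<psi> (lookup f m))) * (mval Var m - mval ?t m)"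
      by (simp add: algebra_simps)
    then show "Const (lookup f m) * mval Var m - Const (\<kappa> (\<psi> (lookup f m))) * mval ?t m \<in> I"
      using tideal_add[OF I tideal_mult[OF I c] tideal_mult[OF I mval_diff_ideal[OF I v]]] by simp
  qed
  also have "(\<Sum>m\<in>keys f. Const (\<kappa> (\<psi> (lookup f m))) * mval ?t m) = Const (\<kappa> (poly_subst \<psi> x f)) * w ^ d"
  proof -
    have "(\<Sum>m\<in>keys f. Const (\<kappa> (\<psi> (lookup f m))) * mval ?t m) =
      (\<Sum>m\<in>keys f. Const (\<kappa> (\<psi> (lookup f m) * mval x m)) * w ^ d)"
      using f by (intro sum.cong refl) (subst mv, simp add: homog_def rhom_mult[OF \<kappa>] rhom_mult[OF rhom_Const] mult_ac)
    also have "\<dots> = Const (\<kappa> (poly_subst \<psi> x f)) * w ^ d"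
      by (simp add: poly_subst_mval rhom_sum[OF \<kappa>] rhom_sum[OF rhom_Const] sum_distrib_right)
    finally show ?thesis .
  qed
  finally show ?thesis .
qed

lemma pev_extend_coeffs: "poly_subst (pev b) x (extend_coeffs f) = pev x f"
proof -
  have "poly_subst (pev b) x (extend_coeffs f) = pev x f"
    by (rule rhom_eqI[OF rhom_comp[OF rhom_poly_subst[OF rhom_pev] rhom_extend_coeffs] rhom_pev])
       (simp_all add: extend_coeffs_Const extend_coeffs_Var poly_subst_Const poly_subst_Var rhom_0[OF rhom_pev])
  then show ?thesis .
qed

lemma homog_Const_mult: "f \<in> homog d \<Longrightarrow> Const c * f \<in> homog d"
  using homog_mult[OF homog_Const] by fastforce

section \<open>Fibres over points given by coordinates\<close>

locale field_family = product_family I J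
  for I :: "('m, 'k::field) mpoly set" and J :: "('m, ('n, 'k) mpoly) mpoly set"
begin

definition fib :: "('m \<Rightarrow> 'k) \<Rightarrow> ('n \<Rightarrow> 'k) set" where
  "fib x = {b. \<forall>j\<in>J. poly_subst (pev b) x j = 0}"

text \<open>These are homogeneous coordinate vectors and not points of X. Proportional vectors have
  the same \<open>Ppt\<close> and the same \<open>fib\<close>, by \<open>pt_scale\<close> and
  \<open>fib_scale\<close>, which allows scaling into a chart.\<close>

definition base_pts :: "('m \<Rightarrow> 'k) set" where
  "base_pts = {x. (\<exists>v. x v \<noteq> 0) \<and> (\<forall>f\<in>I. pev x f = 0)}"

abbreviation "Ppt x \<equiv> pt (\<lambda>c. c) x :: ('m, 'k) mpoly set"
abbreviation "Qpt x b \<equiv> pt (pev b) x :: ('m, ('n, 'k) mpoly) mpoly set"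

lemma Ppt_prime: "x \<in> base_pts \<longleftrightarrow> Ppt x \<in> I.proj_primes"
  using subset_pt_iff[OF rhom_id I.hJ]
  by (auto simp: base_pts_def I.proj_primes_def tprime_pt thomog_pt pt_Var)

lemma Qpt_prime: "x v \<noteq> 0 \<Longrightarrow> b \<in> fib x \<Longrightarrow> Qpt x b \<in> J.proj_primes"
  using subset_pt_iff[OF rhom_pev[of b] J.hJ]
  by (auto simp: fib_def J.proj_primes_def tprime_pt thomog_pt pt_Var)

lemma contr_Qpt: "contr (Qpt x b) = Ppt x"
  by (auto simp: pt_def hc_extend_coeffs pev_extend_coeffs)

lemma Const_Qpt: "{g. Const g \<in> Qpt x b} = affine_point b"
  by (auto simp: pt_homog[OF rhom_pev homog_Const] affine_point_def poly_subst_Const rhom_0[OF rhom_pev])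

lemma fib_scale: assumes "c \<noteq> 0" shows "fib (\<lambda>v. c * x v) = fib x"
proof -
  have "b \<in> fib x \<longleftrightarrow> J \<subseteq> Qpt x b" for x b
    using subset_pt_iff[OF rhom_pev[of b] J.hJ] by (auto simp: fib_def)
  then show ?thesis using pt_scale[OF rhom_pev assms] by blast
qed

abbreviation spec :: "('m \<Rightarrow> 'k) \<Rightarrow> ('m, ('n, 'k) mpoly) mpoly \<Rightarrow> ('n, 'k) mpoly" where
  "spec x \<equiv> poly_subst (\<lambda>g. g) (\<lambda>v. Const (x v))"

lemma pev_spec: "pev b (spec x j) = poly_subst (pev b) x j"
  by (simp add: rhom_comp_poly_subst[OF rhom_pev] poly_subst_Const)

text \<open>Here q may be any point of the fibre, rational or not. Choose \<open>Var v\<close>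
  outside q and put w = \<open>Var v\<close> / \<open>x v\<close>. Modulo q each variable is its
  coordinate times w, so the component of j of degree d is its specialisation at x times the d-th
  power of w. The component lies in q and w does not, so the specialisation lies in q.\<close>

lemma spec_in:
  assumes q: "q \<in> J.proj_primes" "contr q = Ppt x" and j: "j \<in> J"
  shows "Const (spec x j) \<in> q"
proof -
  have q': "tprime q" "thomog q" "J \<subseteq> q" "\<exists>v. Var v \<notin> q" using q(1) by (auto simp: J.proj_primes_def)
  note tq = tprime_tideal[OF q'(1)]
  obtain v where v: "Var v \<notin> q" using q'(4) by blast
  then have "Var v \<notin> contr q" by (simp add: extend_coeffs_Var)
  then have "Var v \<notin> Ppt x" using q(2) by simp
  then have xv: "x v \<noteq> 0" by (simp add: pt_Var)
  have inq: "Const (spec x j) \<in> q" if j: "j \<in> homog d" "j \<in> q" for j d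
  proof -
    let ?w = "Const (Const (inverse (x v))) * Var v :: ('m, ('n, 'k) mpoly) mpoly"
    have 1: "Var u - Const (Const (x u)) * ?w \<in> q" for u
    proof -
      have "Var u - Const (x u) * (Const (inverse (x v)) * Var v) \<in> Ppt x"
      proof (subst pt_homog[OF rhom_id])
        show "Var u - Const (x u) * (Const (inverse (x v)) * Var v) \<in> homog (Suc 0)"
          by (intro homog_diff homog_Const_mult homog_Var)
      qed (use xv in \<open>simp add: rhom_simps[OF rhom_pev] poly_subst_Const poly_subst_Var\<close>)
      then have "extend_coeffs (Var u - Const (x u) * (Const (inverse (x v)) * Var v)) \<in> q" using q(2) by auto
      then show ?thesis by (simp add: rhom_simps[OF rhom_extend_coeffs] extend_coeffs_Const extend_coeffs_Var)
    qed
    have "j - Const (spec x j) * ?w ^ d \<in> q"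
      by (rule homog_congruence[OF tq rhom_id rhom_id _ 1 j(1)]) (simp add: tideal_0[OF tq])
    then have "j - (j - Const (spec x j) * ?w ^ d) \<in> q" by (rule tideal_diff[OF tq j(2)])
    then have "Const (spec x j) * ?w ^ d \<in> q" by simp
    moreover have "?w \<notin> q"
    proof
      assume "?w \<in> q"
      then have "Const (Const (x v)) * ?w \<in> q" by (rule tideal_mult[OF tq])
      moreover have "Const (Const (x v)) * ?w = Const (Const (x v * inverse (x v))) * Var v"
        by (simp only: rhom_mult[OF rhom_Const] mult.assoc)
      ultimately show False using v xv by (simp add: Const_1)
    qed
    ultimately show ?thesis using tprime_mult[OF q'(1)] tprime_power[OF q'(1)] by blast
  qed
  obtain n where n: "j = (\<Sum>d\<le>n. hc d j)" using sum_hc[of j] by blast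
  have "Const (spec x j) = (\<Sum>d\<le>n. Const (spec x (hc d j)))"
    by (subst n) (simp add: rhom_sum[OF rhom_poly_subst[OF rhom_id]] rhom_sum[OF rhom_Const])
  also have "\<dots> \<in> q"
  proof (rule tideal_sum[OF tq])
    fix d
    have "hc d j \<in> J" using J.hJ j by (auto simp: thomog_def)
    then show "Const (spec x (hc d j)) \<in> q" using inq[OF hc_homog] q'(3) by blast
  qed
  finally show ?thesis .
qed

text \<open>A fibre point q that maps to b is not given in the form \<open>Qpt x b\<close>;
  \<open>spec_in\<close> extracts the equations of the fibre from q alone. Conversely
  \<open>Qpt x b\<close> is a point over both x and b.\<close>

lemma affine_point_fiber_iff:
  assumes "x \<in> base_pts"
  shows "affine_point b \<in> pr2 J ` pr1_fiber I J (cls I ` Ppt x) \<longleftrightarrow> b \<in> fib x"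
proof
  assume "affine_point b \<in> pr2 J ` pr1_fiber I J (cls I ` Ppt x)"
  then obtain q where q: "q \<in> J.proj_primes" "contr q = Ppt x" "affine_point b = {g. Const g \<in> q}"
    using fiber_iff[of "Ppt x"] pr2_eq assms by (auto simp: Ppt_prime)
  show "b \<in> fib x" unfolding fib_def
  proof (intro CollectI ballI)
    fix j assume "j \<in> J"
    from spec_in[OF q(1,2) this] have "spec x j \<in> affine_point b" using q(3) by blast
    then show "poly_subst (pev b) x j = 0" by (simp add: affine_point_def pev_spec)
  qed
next
  assume b: "b \<in> fib x"
  obtain v where "x v \<noteq> 0" using assms by (auto simp: base_pts_def)
  note q = Qpt_prime[OF this b]
  have "\<exists>q\<in>J.proj_primes. cls J ` Qpt x b = cls J ` q \<and> contr q = Ppt x"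
    by (rule bexI[OF _ q]) (simp add: contr_Qpt)
  then have "cls J ` Qpt x b \<in> pr1_fiber I J (cls I ` Ppt x)"
    using fiber_iff assms by (simp add: Ppt_prime)
  moreover have "pr2 J (cls J ` Qpt x b) = affine_point b" using pr2_eq[OF q] Const_Qpt by simp
  ultimately show "affine_point b \<in> pr2 J ` pr1_fiber I J (cls I ` Ppt x)" by (metis image_eqI)
qed

end

section \<open>Rational points are the points with coordinates in K\<close>

lemma (in cring) minus_eqI: "a \<in> carrier R \<Longrightarrow> b \<in> carrier R \<Longrightarrow> c \<in> carrier R \<Longrightarrow> c \<oplus> b = a \<Longrightarrow> a \<ominus> b = c"
  by (metis a_minus_def add.inv_solve_right' minus_closed)

locale flat_family_point = field_family I J + family_point I J q
  for I :: "('m, 'k::field) mpoly set" and J :: "('m, ('n, 'k) mpoly) mpoly set" and q +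
  assumes flat: "Proj_flat (projective_ring I) (projective_ring J) (pr1_hom J)"
begin

text \<open>Flatness supplies the ring axioms: \<open>flat_module\<close> includes
  \<open>module\<close>, whose base ring is a \<open>cring\<close>. The computations with rational
  points therefore take place at the image of a point of \<Sigma>.\<close>

lemma cring_RL: "cring R.L"
  using flat_at(1)[OF flat] by (simp add: flat_module_def module_def)

lemma minus_const:
  assumes "R.adm f s"
  shows "R.fr f s \<ominus>\<^bsub>R.L\<^esub> R.fr (Const c) 1 = R.fr (f - Const c * s) s" "R.adm (f - Const c * s) s"
proof -
  interpret cring R.L by (rule cring_RL)
  from assms obtain d where d: "f \<in> homog d" "s \<in> homog d" "s \<notin> contr q" by (auto simp: R.adm_def)
  have "Const c * s \<in> homog d" using homog_mult[OF homog_Const d(2)] by simp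
  then show adm: "R.adm (f - Const c * s) s" unfolding R.adm_def using d homog_diff by blast
  have admc: "R.adm (Const c) 1" by (rule R.adm_1) simp
  have "R.fr (f - Const c * s) s \<oplus>\<^bsub>R.L\<^esub> R.fr (Const c) 1 = R.fr f s"
    unfolding R.add_L[OF adm admc] by (simp add: algebra_simps)
  then show "R.fr f s \<ominus>\<^bsub>R.L\<^esub> R.fr (Const c) 1 = R.fr (f - Const c * s) s"
    by (intro minus_eqI R.fr_in_carrier adm admc assms)
qed

lemma rational_iff:
  "cls I ` contr q \<in> rational_points I \<longleftrightarrow>
    (\<forall>a\<in>carrier R.L. \<exists>c. a \<ominus>\<^bsub>R.L\<^esub> R.fr (Const c) 1 \<notin> Units R.L)"
proof -
  have "cls I ` contr q \<in> Proj_points I.A" unfolding I.Proj_points_eq using contr_prime[OF q_prime] by blast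
  then show ?thesis
    unfolding rational_points_def Let_def poly_gring_coset R.fr_def I.A_simps(5) by simp
qed

text \<open>With \<open>Var v\<close> outside the prime, the fractions \<open>Var u\<close> /
  \<open>Var v\<close> have values in K: a constant c that makes the difference a nonunit puts
  \<open>Var u\<close> - c \<open>Var v\<close> into the prime. These constants are the
  coordinates.\<close>

lemma rational_imp_point:
  assumes "cls I ` contr q \<in> rational_points I"
  obtains x where "x \<in> base_pts" "contr q = Ppt x"
proof -
  interpret cring R.L by (rule cring_RL)
  note tp = R.tp
  from R.p_props(4) obtain v where v: "Var v \<notin> contr q" ..
  have "\<exists>c. Var u - Const c * Var v \<in> contr q" for u
  proof -
    have adm: "R.adm (Var u) (Var v)"
      unfolding R.adm_def by (intro exI[of _ "Suc 0"] conjI homog_Var v)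
    from assms[unfolded rational_iff, rule_format, OF R.fr_in_carrier[OF adm]] obtain c where
      c: "R.fr (Var u - Const c * Var v) (Var v) \<notin> Units R.L" unfolding minus_const[OF adm] by blast
    let ?g = "Var u - Const c * Var v"
    note admg = minus_const(2)[OF adm, of c]
    have "?g \<in> contr q"
    proof (rule ccontr)
      assume g: "?g \<notin> contr q"
      have "?g \<in> homog (Suc 0)" by (intro homog_diff homog_Const_mult homog_Var)
      then have adm': "R.adm (Var v) ?g" unfolding R.adm_def by (intro exI[of _ "Suc 0"] conjI homog_Var g)
      have adm1: "R.adm 1 1" by (rule R.adm_1) simp
      have "R.rel (?g * Var v) (Var v * ?g) 1 1"
        unfolding R.rel_def using R.p_1 tideal_0[OF I.tJ] by (intro exI[of _ 0] bexI[of _ 1]) (auto simp: mult.commute)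
      then have "R.fr ?g (Var v) \<otimes>\<^bsub>R.L\<^esub> R.fr (Var v) ?g = \<one>\<^bsub>R.L\<^esub>"
        unfolding R.mult_L[OF admg adm'] R.one_L R.fr_eq_iff[OF R.adm_mult[OF admg adm'] adm1] .
      then have "R.fr ?g (Var v) \<in> Units R.L"
        unfolding Units_def using R.fr_in_carrier[OF admg] R.fr_in_carrier[OF adm'] m_comm by auto
      with c show False by simp
    qed
    then show ?thesis by blast
  qed
  then obtain x where x: "\<And>u. Var u - Const (x u) * Var v \<in> contr q" by metis
  \<comment> \<open>Modulo the prime, f is the constant f(x) times a power of \<open>Var v\<close>,
    which is outside the prime, and nonzero constants are units.\<close>
  have key: "f \<in> contr q \<longleftrightarrow> pev x f = 0" if f: "f \<in> homog d" for f d
  proof -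
    have cong: "f - Const (pev x f) * Var v ^ d \<in> contr q"
      by (rule homog_congruence[OF tp rhom_id rhom_id _ x f]) (simp only: diff_self tideal_0[OF tp])
    have "f \<in> contr q \<longleftrightarrow> Const (pev x f) * Var v ^ d \<in> contr q"
      using tideal_add[OF tp cong, of "Const (pev x f) * Var v ^ d"] tideal_diff[OF tp _ cong, of f] by auto
    also have "\<dots> \<longleftrightarrow> pev x f = 0"
    proof
      assume "Const (pev x f) * Var v ^ d \<in> contr q"
      then have c: "Const (pev x f) \<in> contr q" using R.p_mult v tprime_power[OF R.p_props(1)] by blast
      show "pev x f = 0"
      proof (rule ccontr)
        assume "pev x f \<noteq> 0"
        then have "Const (inverse (pev x f)) * Const (pev x f) = (1 :: ('m, 'k) mpoly)"
          by (simp add: Const_1 flip: rhom_mult[OF rhom_Const])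
        then show False using tideal_mult[OF tp c] R.p_1 by metis
      qed
    next
      assume "pev x f = 0"
      then show "Const (pev x f) * Var v ^ d \<in> contr q"
        using tideal_0[OF tp] by (simp only: rhom_0[OF rhom_Const] mult_zero_left)
    qed
    finally show ?thesis .
  qed
  have "f \<in> contr q \<longleftrightarrow> f \<in> Ppt x" for f
  proof -
    have "f \<in> contr q \<longleftrightarrow> (\<forall>d. hc d f \<in> contr q)"
      using thomog_memI[OF tp] R.p_props(2) unfolding thomog_def by blast
    also have "\<dots> \<longleftrightarrow> f \<in> Ppt x" unfolding pt_def using key[OF hc_homog] by blast
    finally show ?thesis .
  qed
  then have "contr q = Ppt x" by blast
  moreover then have "x \<in> base_pts" using contr_prime[OF q_prime] by (simp add: Ppt_prime)
  ultimately show thesis using that by blast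
qed

lemma point_imp_rational:
  assumes "contr q = Ppt x"
  shows "cls I ` contr q \<in> rational_points I"
  unfolding rational_iff
proof
  interpret cring R.L by (rule cring_RL)
  fix a assume "a \<in> carrier R.L"
  then obtain f s where a: "a = R.fr f s" and adm: "R.adm f s" by (rule R.carrier_LE)
  then obtain d where d: "f \<in> homog d" "s \<in> homog d" "s \<notin> contr q" by (auto simp: R.adm_def)
  have sx: "pev x s \<noteq> 0" using pt_homog[OF rhom_id d(2)] d(3) assms by blast
  \<comment> \<open>The constant is the value of the fraction at x. After subtracting it the
    numerator vanishes at x, whereas an inverse would make it nonzero there.\<close>
  have "a \<ominus>\<^bsub>R.L\<^esub> R.fr (Const (pev x f / pev x s)) 1 \<notin> Units R.L"
    unfolding a minus_const[OF adm]
  proof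
    let ?g = "f - Const (pev x f / pev x s) * s"
    note admg = minus_const(2)[OF adm, of "pev x f / pev x s"]
    assume "R.fr ?g s \<in> Units R.L"
    then obtain y where y: "y \<in> carrier R.L" "R.fr ?g s \<otimes>\<^bsub>R.L\<^esub> y = \<one>\<^bsub>R.L\<^esub>" unfolding Units_def by blast
    from y(1) obtain h t where h: "y = R.fr h t" "R.adm h t" by (rule R.carrier_LE)
    have adm1: "R.adm 1 1" by (rule R.adm_1) simp
    from y(2) have "R.rel (?g * h) (s * t) 1 1"
      unfolding h(1) R.mult_L[OF admg h(2)] R.one_L R.fr_eq_iff[OF R.adm_mult[OF admg h(2)] adm1] .
    then obtain k u where u: "u \<in> homog k" "u \<notin> contr q" "u * (?g * h * 1 - 1 * (s * t)) \<in> I"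
      unfolding R.rel_def by blast
    from h(2) obtain e where t: "t \<in> homog e" "t \<notin> contr q" by (auto simp: R.adm_def)
    have "u * (?g * h * 1 - 1 * (s * t)) \<in> Ppt x" using u(3) R.p_props(3) assms by blast
    then have "pev x (u * (?g * h * 1 - 1 * (s * t))) = 0" by (rule pt_vanish[OF rhom_id])
    moreover have "pev x ?g = 0" using sx by (simp add: rhom_simps[OF rhom_pev] poly_subst_Const)
    ultimately have "pev x u * (pev x s * pev x t) = 0" by (simp add: rhom_simps[OF rhom_pev])
    moreover have "pev x u \<noteq> 0" "pev x t \<noteq> 0"
      using pt_homog[OF rhom_id u(1)] pt_homog[OF rhom_id t(1)] u(2) t(2) assms by blast+
    ultimately show False using sx by simp
  qed
  then show "\<exists>c. a \<ominus>\<^bsub>R.L\<^esub> R.fr (Const c) 1 \<notin> Units R.L" by blast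
qed

end

section \<open>Dehomogenisation\<close>

definition dle :: "('m, 'c::comm_ring_1) mpoly \<Rightarrow> nat \<Rightarrow> bool" where
  "dle f d \<longleftrightarrow> (\<forall>m\<in>keys f. tdeg m \<le> d)"

text \<open>Homogenisation for the chart where x_w = 1, with \<open>Var w\<close> itself as the
  extra variable, so that no variable is removed from the ring. The subtraction is truncated: the
  result is homogeneous of degree d only under \<open>dle f d\<close>.\<close>

definition hz :: "'m \<Rightarrow> nat \<Rightarrow> ('m, 'c::comm_ring_1) mpoly \<Rightarrow> ('m, 'c) mpoly" where
  "hz w d f = (\<Sum>m\<in>keys f. single (m + single w (d - tdeg m)) (lookup f m))"

lemma dle_ex: "\<exists>d. dle f d"
  unfolding dle_def using finite_nat_set_iff_bounded_le[of "tdeg ` keys f"] by auto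

lemma dle_mono: "dle f d \<Longrightarrow> d \<le> e \<Longrightarrow> dle f e"
  by (auto simp: dle_def)

lemma dle_add: "dle f d \<Longrightarrow> dle g d \<Longrightarrow> dle (f + g) d"
  using Poly_Mapping.keys_add[of f g] by (auto simp: dle_def)

lemma dle_mult: assumes "dle f d" "dle g e" shows "dle (f * g) (d + e)"
  unfolding dle_def
proof
  fix m assume "m \<in> keys (f * g)"
  then obtain a b where "m = a + b" "a \<in> keys f" "b \<in> keys g" using Poly_Mapping.keys_mult[of f g] by blast
  then show "tdeg m \<le> d + e" using assms by (simp add: dle_def tdeg_add add_mono)
qed

lemma dle_homog: "f \<in> homog d \<Longrightarrow> dle f d"
  by (simp add: homog_def dle_def)

lemma hz_superset:
  "finite A \<Longrightarrow> keys f \<subseteq> A \<Longrightarrow> hz w d f = (\<Sum>m\<in>A. single (m + single w (d - tdeg m)) (lookup f m))"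
  unfolding hz_def by (rule sum.mono_neutral_left) (auto simp: in_keys_iff)

lemma hz_add: "hz w d (f + g) = hz w d f + hz w d g"
  using Poly_Mapping.keys_add[of f g]
  by (simp add: hz_superset[of "keys f \<union> keys g"] lookup_add single_add sum.distrib)

lemma hz_0 [simp]: "hz w d 0 = 0"
  by (simp add: hz_def)

lemma hz_sum: "hz w d (sum f A) = (\<Sum>a\<in>A. hz w d (f a))"
  by (induction A rule: infinite_finite_induct) (auto simp: hz_add)

lemma hz_single: "hz w d (single m c) = single (m + single w (d - tdeg m)) c"
  by (simp add: hz_def)

lemma hz_mult:
  assumes "dle f d" "dle g e" shows "hz w (d + e) (f * g) = hz w d f * hz w e g"
proof -
  have "f * g = (\<Sum>m\<in>keys f. \<Sum>m'\<in>keys g. single (m + m') (lookup f m * lookup g m'))"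
    by (subst poly_mapping_sum_single[of f], subst poly_mapping_sum_single[of g])
       (simp add: sum_product mult_single)
  then have "hz w (d + e) (f * g) =
      (\<Sum>m\<in>keys f. \<Sum>m'\<in>keys g. single (m + m' + single w (d + e - tdeg (m + m'))) (lookup f m * lookup g m'))"
    by (simp add: hz_sum hz_single)
  also have "\<dots> = (\<Sum>m\<in>keys f. \<Sum>m'\<in>keys g.
      single (m + single w (d - tdeg m)) (lookup f m) * single (m' + single w (e - tdeg m')) (lookup g m'))"
  proof (intro sum.cong refl)
    fix m m' assume "m \<in> keys f" "m' \<in> keys g"
    then have "tdeg m \<le> d" "tdeg m' \<le> e" using assms by (auto simp: dle_def)
    then have "d + e - tdeg (m + m') = (d - tdeg m) + (e - tdeg m')" by (simp add: tdeg_add)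
    then show "single (m + m' + single w (d + e - tdeg (m + m'))) (lookup f m * lookup g m') =
        single (m + single w (d - tdeg m)) (lookup f m) * single (m' + single w (e - tdeg m')) (lookup g m')"
      by (simp add: mult_single single_add add_ac)
  qed
  finally show ?thesis by (simp add: hz_def sum_product)
qed

lemma hz_homog: "dle f d \<Longrightarrow> hz w d f \<in> homog d"
  unfolding hz_def by (rule homog_sum) (auto simp: homog_def dle_def tdeg_add)

lemma hz_of_homog: "f \<in> homog d \<Longrightarrow> hz w d f = f"
  unfolding hz_def homog_def by (subst (3) poly_mapping_sum_single) simp

lemma hz_1 [simp]: "hz w 0 1 = 1"
  by (rule hz_of_homog) simp

lemma dle_1 [simp]: "dle 1 d"
  by (simp add: dle_def)

lemma hz_raise:
  fixes f :: "('m, 'c::comm_ring_1) mpoly"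
  assumes "dle f d" shows "hz w (d + e) f = Var w ^ e * hz w d f"
proof -
  have "hz w (d + e) (f * 1) = hz w d f * hz w e 1" by (rule hz_mult[OF assms dle_1])
  moreover have "hz w e (1 :: ('m, 'c) mpoly) = Var w ^ e"
    by (simp add: hz_def Var_power)
  ultimately show ?thesis by (simp add: mult.commute)
qed

text \<open>Only the homogeneous components of f and powers of \<open>Var w\<close> enter, so a
  homogeneous ideal is closed under homogenisation.\<close>

lemma hz_components:
  assumes "dle f d" shows "hz w d f = (\<Sum>k\<le>d. Var w ^ (d - k) * hc k f)"
proof -
  have f: "f = (\<Sum>k\<le>d. hc k f)"
  proof (rule poly_mapping_eqI)
    fix m show "lookup f m = lookup (\<Sum>k\<le>d. hc k f) m"
    proof (cases "m \<in> keys f")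
      case True
      then have "tdeg m \<le> d" using assms by (simp add: dle_def)
      then show ?thesis by (simp add: lookup_sum lookup_hc)
    qed (simp add: lookup_sum lookup_hc in_keys_iff)
  qed
  have "hz w d f = (\<Sum>k\<le>d. hz w d (hc k f))" by (subst f) (simp add: hz_sum)
  also have "\<dots> = (\<Sum>k\<le>d. Var w ^ (d - k) * hc k f)"
  proof (intro sum.cong refl)
    fix k assume "k \<in> {..d}"
    then show "hz w d (hc k f) = Var w ^ (d - k) * hc k f"
      using hz_raise[OF dle_homog[OF hc_homog[of k f]], of w "d - k"] by (simp add: hz_of_homog)
  qed
  finally show ?thesis .
qed

lemma hz_in_ideal: "tideal J \<Longrightarrow> thomog J \<Longrightarrow> f \<in> J \<Longrightarrow> dle f d \<Longrightarrow> hz w d f \<in> J"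
  by (simp add: hz_components thomog_def tideal_sum tideal_mult)

lemma poly_subst_hz:
  assumes "rhom \<psi>" "x w = 1" shows "poly_subst \<psi> x (hz w d f) = poly_subst \<psi> x f"
proof -
  have "poly_subst \<psi> x (hz w d f) = (\<Sum>m\<in>keys f. \<psi> (lookup f m) * mval x m)"
    by (simp add: hz_def poly_subst_sum[OF assms(1)] poly_subst_single rhom_0[OF assms(1)] mval_add assms(2))
  then show ?thesis by (simp add: poly_subst_mval)
qed

lemma keys_extend_coeffs: "keys (extend_coeffs f) = keys f"
  by (auto simp: in_keys_iff lookup_extend_coeffs)

lemma hz_extend_coeffs: "hz w d (extend_coeffs f) = extend_coeffs (hz w d f)"
proof -
  have 1: "extend_coeffs (single m c) = single m (Const c)" for m c
    by (rule poly_mapping_eqI) (auto simp: lookup_extend_coeffs lookup_single when_def rhom_0[OF rhom_Const])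
  show ?thesis by (simp add: hz_def keys_extend_coeffs lookup_extend_coeffs rhom_sum[OF rhom_extend_coeffs] 1)
qed

lemma dle_extend_coeffs: "dle (extend_coeffs f) d \<longleftrightarrow> dle f d"
  by (simp add: dle_def keys_extend_coeffs)

text \<open>A K-point inside the chart where x_w = 1. The locale serves both X, with
  \<open>\<psi>\<close> the identity of K, and \<Sigma>, with \<open>\<psi>\<close> the evaluation
  of K[y] at b.\<close>

locale proj_pt = proj_prime J p for J :: "('m, 'c::comm_ring_1) mpoly set" and p +
  fixes \<psi> :: "'c \<Rightarrow> 'k::field" and x :: "'m \<Rightarrow> 'k" and w :: 'm
  assumes p_eq: "p = pt \<psi> x" and \<psi>: "rhom \<psi>" and xw: "x w = 1"
begin

abbreviation "ev \<equiv> poly_subst \<psi> x"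

lemma rhom_ev: "rhom ev"
  by (rule rhom_poly_subst[OF \<psi>])

lemma homog_p_iff: "f \<in> homog d \<Longrightarrow> f \<in> p \<longleftrightarrow> ev f = 0"
  unfolding p_eq by (rule pt_homog[OF \<psi>])

lemma p_ev: "f \<in> p \<Longrightarrow> ev f = 0"
  unfolding p_eq by (rule pt_vanish[OF \<psi>])

lemma Var_w: "Var w \<notin> p"
  unfolding p_eq using xw by (simp add: pt_Var \<psi>)

lemma Var_w_power: "Var w ^ d \<notin> p" "Var w ^ d \<in> homog d"
proof -
  show "Var w ^ d \<notin> p" using Var_w tprime_power[OF p_props(1)] by blast
  show "Var w ^ d \<in> homog d" using homog_power[OF homog_Var, of w d] by (simp only: mult_Suc_right mult_0_right add_0_right)
qed

definition deg :: "('m, 'c) mpoly \<Rightarrow> nat" where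
  "deg f = (SOME d. dle f d)"

lemma dle_deg: "dle f (deg f)"
  unfolding deg_def using dle_ex by (rule someI_ex)

text \<open>The map from the chart to the local ring. The bound \<open>deg f\<close> is an arbitrary
  choice; by \<open>dhom_eq\<close> any other bound gives the same fraction.\<close>

definition dhom :: "('m, 'c) mpoly \<Rightarrow> (('m, 'c) mpoly set \<times> ('m, 'c) mpoly set) set" where
  "dhom f = fr (hz w (deg f) f) (Var w ^ deg f)"

lemma adm_hz: "dle f d \<Longrightarrow> adm (hz w d f) (Var w ^ d)"
  unfolding adm_def by (intro exI[of _ d] conjI hz_homog Var_w_power)

lemma rel_of_eq: "f * t = g * s \<Longrightarrow> rel f s g t"
  unfolding rel_def using p_1 tideal_0[OF tJ] by (intro exI[of _ 0] bexI[of _ 1]) auto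

lemma dhom_eq: assumes "dle f d" shows "dhom f = fr (hz w d f) (Var w ^ d)"
proof -
  have "hz w (deg f) f * Var w ^ d = hz w d f * Var w ^ deg f"
    using hz_raise[OF dle_deg, of w f d] hz_raise[OF assms, of w "deg f"] by (simp add: mult.commute add.commute)
  then show ?thesis unfolding dhom_def
    by (subst fr_eq_iff[OF adm_hz[OF dle_deg] adm_hz[OF assms]]) (rule rel_of_eq)
qed

lemma dhom_carrier: "dhom f \<in> carrier L"
  unfolding dhom_def by (rule fr_in_carrier[OF adm_hz[OF dle_deg]])

lemma dhom_add: "dhom (f + g) = dhom f \<oplus>\<^bsub>L\<^esub> dhom g"
proof -
  define d where "d = max (deg f) (deg g)"
  have d: "dle f d" "dle g d" using dle_mono[OF dle_deg] by (auto simp: d_def)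
  show ?thesis
    unfolding dhom_eq[OF d(1)] dhom_eq[OF d(2)] dhom_eq[OF dle_add[OF d]] hz_add add_L_same[OF adm_hz[OF d(1)] adm_hz[OF d(2)]] ..
qed

lemma dhom_mult: "dhom (f * g) = dhom f \<otimes>\<^bsub>L\<^esub> dhom g"
proof -
  have "dhom (f * g) = fr (hz w (deg f) f * hz w (deg g) g) (Var w ^ deg f * Var w ^ deg g)"
    using dhom_eq[OF dle_mult[OF dle_deg dle_deg]] by (simp only: hz_mult[OF dle_deg dle_deg] power_add)
  then show ?thesis unfolding dhom_def mult_L[OF adm_hz[OF dle_deg] adm_hz[OF dle_deg]] .
qed

lemma dhom_1: "dhom 1 = \<one>\<^bsub>L\<^esub>"
  using dhom_eq[OF dle_1[of 0]] by (simp add: one_L)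

lemma dhom_0: "dhom 0 = \<zero>\<^bsub>L\<^esub>"
  using dhom_eq[of 0 0] by (simp add: zero_L dle_def)

lemma dhom_eq_zero_iff:
  assumes "dle f d" shows "dhom f = \<zero>\<^bsub>L\<^esub> \<longleftrightarrow> (\<exists>k. \<exists>u\<in>homog k. u \<notin> p \<and> u * hz w d f \<in> J)"
  unfolding dhom_eq[OF assms] zero_L fr_eq_iff[OF adm_hz[OF assms] adm_1[OF homog_0]] rel_def by simp

lemma dhom_J: "j \<in> J \<Longrightarrow> dhom j = \<zero>\<^bsub>L\<^esub>"
  unfolding dhom_eq_zero_iff[OF dle_deg]
  using p_1 hz_in_ideal[OF tJ hJ _ dle_deg] by (intro exI[of _ 0] bexI[of _ 1]) auto

text \<open>The local ring is the localisation of the chart at the point: each fraction is a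
  quotient of chart elements whose denominator is nonzero there.\<close>

lemma dhom_frac:
  assumes "adm f s" shows "dhom s \<otimes>\<^bsub>L\<^esub> fr f s = dhom f" "ev s \<noteq> 0"
proof -
  obtain d where d: "f \<in> homog d" "s \<in> homog d" "s \<notin> p" using assms by (auto simp: adm_def)
  show "ev s \<noteq> 0" using homog_p_iff d by blast
  have a: "adm s (Var w ^ d)" "adm f (Var w ^ d)"
    unfolding adm_def by (intro exI[of _ d] conjI d Var_w_power)+
  have "dhom s \<otimes>\<^bsub>L\<^esub> fr f s = fr (s * f) (Var w ^ d * s)"
    unfolding dhom_eq[OF dle_homog[OF d(2)]] hz_of_homog[OF d(2)] by (rule mult_L[OF a(1) assms])
  also have "\<dots> = fr f (Var w ^ d)"
    unfolding fr_eq_iff[OF adm_mult[OF a(1) assms] a(2)] by (rule rel_of_eq) (simp add: mult_ac)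
  also have "\<dots> = dhom f" unfolding dhom_eq[OF dle_homog[OF d(1)]] hz_of_homog[OF d(1)] ..
  finally show "dhom s \<otimes>\<^bsub>L\<^esub> fr f s = dhom f" .
qed

text \<open>The residue map onto K. It does not depend on the representation, since J vanishes at
  the point; see \<open>val_fr\<close>.\<close>

definition val :: "(('m, 'c) mpoly set \<times> ('m, 'c) mpoly set) set \<Rightarrow> 'k" where
  "val y = (SOME c. \<exists>f s. y = fr f s \<and> adm f s \<and> c = ev f / ev s)"

lemma val_fr: assumes "adm f s" shows "val (fr f s) = ev f / ev s"
proof -
  have "\<exists>c f' s'. fr f s = fr f' s' \<and> adm f' s' \<and> c = ev f' / ev s'" using assms by blast
  then have "\<exists>f' s'. fr f s = fr f' s' \<and> adm f' s' \<and> val (fr f s) = ev f' / ev s'"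
    unfolding val_def by (rule someI_ex)
  then obtain f' s' where 1: "fr f s = fr f' s'" "adm f' s'" "val (fr f s) = ev f' / ev s'" by blast
  from 1(1) have "rel f s f' s'" unfolding fr_eq_iff[OF assms 1(2)] .
  then obtain k u where u: "u \<in> homog k" "u \<notin> p" "u * (f * s' - f' * s) \<in> J" unfolding rel_def by blast
  have "ev (u * (f * s' - f' * s)) = 0" using p_ev p_props(3) u(3) by blast
  moreover have "ev u \<noteq> 0" using homog_p_iff u by blast
  ultimately have "ev f * ev s' = ev f' * ev s" by (simp add: rhom_simps[OF rhom_ev])
  then show ?thesis using dhom_frac(2)[OF assms] dhom_frac(2)[OF 1(2)] by (simp add: 1(3) frac_eq_eq)
qed

lemma val_dhom: "val (dhom f) = ev f"
  unfolding dhom_def val_fr[OF adm_hz[OF dle_deg]]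
  by (simp add: poly_subst_hz[where \<psi> = \<psi> and x = x and w = w, OF \<psi> xw] rhom_power[OF rhom_ev] poly_subst_Var[OF \<psi>] xw)

lemma val_add: assumes "y \<in> carrier L" "z \<in> carrier L" shows "val (y \<oplus>\<^bsub>L\<^esub> z) = val y + val z"
proof -
  obtain f s where y: "y = fr f s" "adm f s" using assms(1) by (rule carrier_LE)
  obtain g t where z: "z = fr g t" "adm g t" using assms(2) by (rule carrier_LE)
  show ?thesis unfolding y(1) z(1) add_L[OF y(2) z(2)] val_fr[OF adm_add[OF y(2) z(2)]] val_fr[OF y(2)] val_fr[OF z(2)]
    using dhom_frac(2)[OF y(2)] dhom_frac(2)[OF z(2)] by (simp add: rhom_simps[OF rhom_ev] field_simps)
qed

lemma val_mult: assumes "y \<in> carrier L" "z \<in> carrier L" shows "val (y \<otimes>\<^bsub>L\<^esub> z) = val y * val z"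
proof -
  obtain f s where y: "y = fr f s" "adm f s" using assms(1) by (rule carrier_LE)
  obtain g t where z: "z = fr g t" "adm g t" using assms(2) by (rule carrier_LE)
  show ?thesis unfolding y(1) z(1) mult_L[OF y(2) z(2)] val_fr[OF adm_mult[OF y(2) z(2)]] val_fr[OF y(2)] val_fr[OF z(2)]
    by (simp add: rhom_simps[OF rhom_ev])
qed

lemma val_1: "val \<one>\<^bsub>L\<^esub> = 1"
  using val_dhom[of 1] by (simp add: dhom_1 rhom_1[OF rhom_ev])

end

section \<open>Coefficientwise ideals\<close>

lemma tideal_coeffs:
  assumes J: "tideal J" shows "tideal {f :: ('v, 'c::comm_ring_1) mpoly. \<forall>m. lookup f m \<in> J}"
  unfolding tideal_def
proof (intro conjI ballI allI CollectI)
  fix r f :: "('v, 'c) mpoly" and m assume f: "f \<in> {f. \<forall>m. lookup f m \<in> J}"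
  have "r * f = (\<Sum>k\<in>keys r. \<Sum>l\<in>keys f. single (k + l) (lookup r k * lookup f l))"
    by (subst poly_mapping_sum_single[of r], subst poly_mapping_sum_single[of f])
       (simp add: sum_product mult_single)
  then have "lookup (r * f) m = (\<Sum>k\<in>keys r. \<Sum>l\<in>keys f. if k + l = m then lookup r k * lookup f l else 0)"
    by (simp add: lookup_sum lookup_single when_def)
  also have "\<dots> \<in> J" using f by (intro tideal_sum[OF J]) (auto simp: tideal_0[OF J] tideal_mult[OF J])
  finally show "lookup (r * f) m \<in> J" .
qed (auto simp: lookup_add tideal_0[OF J] tideal_add[OF J])

lemma lookup_Const_mult: "lookup (Const c * f) m = c * lookup f m"
proof -
  have "Const c * f = (\<Sum>l\<in>keys f. single l (c * lookup f l))"
    by (subst poly_mapping_sum_single[of f]) (simp add: sum_distrib_left Const_def mult_single)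
  then show ?thesis by (simp add: lookup_sum lookup_single when_def sum.delta' in_keys_iff)
qed

lemma coeffs_in_ideal:
  assumes A: "tideal A" "Const ` J \<subseteq> A" and f: "\<And>m. lookup f m \<in> J" shows "f \<in> A"
proof -
  have "f = (\<Sum>m\<in>keys f. mval Var m * Const (lookup f m))"
    by (subst poly_mapping_sum_single) (simp add: single_eq_Const_mult mult.commute)
  also have "\<dots> \<in> A" using A(2) f by (intro tideal_sum[OF A(1)] tideal_mult[OF A(1)]) blast
  finally show ?thesis .
qed

section \<open>Elimination of one point by flatness\<close>

text \<open>The prime ideal of the chart \<open>x\<^sub>w = 1\<close> that corresponds to \<open>\<eta>\<close>; it contains \<open>x\<^sub>w - 1\<close>.\<close>

definition dehom_prime :: "'m \<Rightarrow> ('m, 'c::comm_ring_1) mpoly set \<Rightarrow> ('m, 'c) mpoly set" where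
  "dehom_prime w \<eta> = {f. \<exists>d. dle f d \<and> hz w d f \<in> \<eta>}"

text \<open>Raising the bound multiplies the homogenisation by a power of \<open>Var w\<close>,
  which the prime does not contain; so one bound is as good as any other.\<close>

lemma dehom_prime_iff:
  assumes \<eta>: "tprime \<eta>" "Var w \<notin> \<eta>" and f: "dle f d" shows "f \<in> dehom_prime w \<eta> \<longleftrightarrow> hz w d f \<in> \<eta>"
proof
  assume "f \<in> dehom_prime w \<eta>"
  then obtain e where e: "dle f e" "hz w e f \<in> \<eta>" by (auto simp: dehom_prime_def)
  have "Var w ^ e * hz w d f = Var w ^ d * hz w e f"
    using hz_raise[OF f, of w e] hz_raise[OF e(1), of w d] by (simp add: add.commute)
  also have "\<dots> \<in> \<eta>" by (rule tideal_mult[OF tprime_tideal[OF \<eta>(1)] e(2)])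
  finally show "hz w d f \<in> \<eta>" using tprime_mult[OF \<eta>(1)] tprime_power[OF \<eta>(1)] \<eta>(2) by blast
qed (use f in \<open>auto simp: dehom_prime_def\<close>)

lemma tprime_dehom_prime:
  assumes \<eta>: "tprime \<eta>" "Var w \<notin> \<eta>" shows "tprime (dehom_prime w \<eta>)"
proof -
  note iff = dehom_prime_iff[OF \<eta>] and t = tprime_tideal[OF \<eta>(1)]
  have mult: "f * g \<in> dehom_prime w \<eta> \<longleftrightarrow> f \<in> dehom_prime w \<eta> \<or> g \<in> dehom_prime w \<eta>" for f g
  proof -
    obtain d e where d: "dle f d" "dle g e" using dle_ex by metis
    show ?thesis
      unfolding iff[OF d(1)] iff[OF d(2)] iff[OF dle_mult[OF d]] hz_mult[OF d] by (rule tprime_mult_iff[OF \<eta>(1)])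
  qed
  have add: "f + g \<in> dehom_prime w \<eta>" if fg: "f \<in> dehom_prime w \<eta>" "g \<in> dehom_prime w \<eta>" for f g
  proof -
    obtain d0 e0 where d0: "dle f d0" "dle g e0" using dle_ex by metis
    define d where "d = max d0 e0"
    have d: "dle f d" "dle g d" using dle_mono[OF d0(1)] dle_mono[OF d0(2)] by (auto simp: d_def)
    have "hz w d f \<in> \<eta>" "hz w d g \<in> \<eta>" using fg iff d by auto
    then show ?thesis unfolding iff[OF dle_add[OF d]] hz_add by (rule tideal_add[OF t])
  qed
  have "0 \<in> dehom_prime w \<eta>" unfolding dehom_prime_def dle_def using tideal_0[OF t] by auto
  moreover have "1 \<notin> dehom_prime w \<eta>" using iff[OF dle_1[of 0]] tprime_1[OF \<eta>(1)] by simp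
  ultimately show ?thesis unfolding tprime_def tideal_def using mult add by blast
qed

lemma dehom_prime_vanish:
  assumes "f \<in> dehom_prime w \<eta>" "\<And>f. f \<in> \<eta> \<Longrightarrow> pev x f = 0" "x w = 1" shows "pev x f = 0"
proof -
  obtain d where "hz w d f \<in> \<eta>" using assms(1) by (auto simp: dehom_prime_def)
  then have "pev x (hz w d f) = 0" by (rule assms(2))
  then show ?thesis by (simp add: poly_subst_hz[OF rhom_id, of x w, OF assms(3)])
qed

text \<open>Polynomials in the coordinates \<open>y\<^sub>i\<^sub>j\<close> of several points, over \<open>K[x]\<close> and over \<open>K[y][x]\<close>:
  \<open>emb i\<close> puts \<open>y = y\<^sub>i\<close>, and \<open>splt i\<close> moves the coordinates of the \<open>i\<close>-th point to the coefficients.\<close>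

definition emb :: "nat \<Rightarrow> ('m, ('n, 'k::comm_ring_1) mpoly) mpoly \<Rightarrow> (nat \<times> 'n, ('m, 'k) mpoly) mpoly" where
  "emb i = poly_subst (poly_subst (\<lambda>c. Const (Const c)) (\<lambda>j. Var (i, j))) (\<lambda>v. Const (Var v))"

definition extS :: "(nat \<times> 'n, ('m, 'k::comm_ring_1) mpoly) mpoly \<Rightarrow> (nat \<times> 'n, ('m, ('n, 'k) mpoly) mpoly) mpoly" where
  "extS = poly_subst (\<lambda>c. Const (extend_coeffs c)) Var"

definition splt :: "nat \<Rightarrow> (nat \<times> 'n, ('m, 'k::comm_ring_1) mpoly) mpoly \<Rightarrow> (nat \<times> 'n, ('m, ('n, 'k) mpoly) mpoly) mpoly" where
  "splt i = poly_subst (\<lambda>c. Const (extend_coeffs c)) (\<lambda>(k, j). if k = i then Const (Const (Var j)) else Var (k, j))"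

lemma rhom_CC: "rhom (\<lambda>c. Const (Const c))"
  by (rule rhom_comp[of Const Const]) simp_all

lemma rhom_Cext: "rhom (\<lambda>c. Const (extend_coeffs c))"
  by (rule rhom_comp[OF rhom_Const rhom_extend_coeffs])

lemma rhom_emb: "rhom (emb i)" and rhom_extS: "rhom extS" and rhom_splt: "rhom (splt i)"
  unfolding emb_def extS_def splt_def by (intro rhom_poly_subst rhom_CC rhom_Cext)+

lemma emb_simps [simp]: "emb i (Const (Const c)) = Const (Const c)" "emb i (Const (Var j)) = Var (i, j)"
  "emb i (Var v) = Const (Var v)"
  by (simp_all add: emb_def poly_subst_Const poly_subst_Var rhom_CC rhom_poly_subst rhom_0[OF rhom_CC]
      rhom_0[OF rhom_poly_subst[OF rhom_CC]])

lemma extS_simps [simp]: "extS (Const c) = Const (extend_coeffs c)" "extS (Var v) = Var v"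
  by (simp_all add: extS_def poly_subst_Const poly_subst_Var rhom_Cext rhom_0[OF rhom_Cext])

lemma splt_simps [simp]: "splt i (Const c) = Const (extend_coeffs c)"
  "splt i (Var (k, j)) = (if k = i then Const (Const (Var j)) else Var (k, j))"
  by (simp_all add: splt_def poly_subst_Const poly_subst_Var rhom_Cext rhom_0[OF rhom_Cext])

lemma rhom_eqI2:
  fixes F G :: "('m, ('n, 'k::comm_ring_1) mpoly) mpoly \<Rightarrow> 'd::comm_ring_1"
  assumes "rhom F" "rhom G" "\<And>c. F (Const (Const c)) = G (Const (Const c))"
    "\<And>v. F (Const (Var v)) = G (Const (Var v))" "\<And>v. F (Var v) = G (Var v)"
  shows "F f = G f"
proof (rule rhom_eqI[OF assms(1,2)])
  fix c show "F (Const c) = G (Const c)"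
    by (rule rhom_eqI[OF rhom_comp[OF assms(1) rhom_Const] rhom_comp[OF assms(2) rhom_Const]]) (rule assms)+
qed (rule assms)

lemma splt_emb_same: "splt i (emb i f) = Const f"
  by (rule rhom_eqI2[OF rhom_comp[OF rhom_splt rhom_emb] rhom_Const])
     (simp_all add: extend_coeffs_Const extend_coeffs_Var)

lemma splt_emb_other: "k \<noteq> i \<Longrightarrow> splt i (emb k f) = extS (emb k f)"
  by (rule rhom_eqI2[OF rhom_comp[OF rhom_splt rhom_emb] rhom_comp[OF rhom_extS rhom_emb]]) simp_all

lemma lookup_extS: "lookup (extS f) m = extend_coeffs (lookup f m)"
proof -
  have "extS f = (\<Sum>l\<in>keys f. single l (extend_coeffs (lookup f l)))"
    unfolding extS_def poly_subst_mval by (simp flip: single_eq_Const_mult)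
  then show ?thesis
    by (simp add: lookup_sum lookup_single when_def sum.delta' in_keys_iff rhom_0[OF rhom_extend_coeffs])
qed

lemma extS_single: "extS (single m 1) = single m 1"
  by (rule poly_mapping_eqI)
     (simp add: lookup_extS lookup_single when_def rhom_0[OF rhom_extend_coeffs] rhom_1[OF rhom_extend_coeffs])

definition S_eval :: "('m \<Rightarrow> 'k) \<Rightarrow> (nat \<Rightarrow> 'n \<Rightarrow> 'k) \<Rightarrow> (nat \<times> 'n, ('m, 'k::comm_ring_1) mpoly) mpoly \<Rightarrow> 'k" where
  "S_eval x p = poly_subst (pev x) (\<lambda>(i, j). p i j)"

lemma rhom_S_eval: "rhom (S_eval x p)"
  unfolding S_eval_def by (intro rhom_poly_subst rhom_pev)

lemma S_eval_simps [simp]: "S_eval x p (Const c) = pev x c" "S_eval x p (Var (i, j)) = p i j"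
  by (simp_all add: S_eval_def poly_subst_Const poly_subst_Var rhom_0[OF rhom_pev])

lemma S_eval_emb: "S_eval x p (emb i f) = poly_subst (pev (p i)) x f"
  by (rule rhom_eqI2[OF rhom_comp[OF rhom_S_eval rhom_emb] rhom_poly_subst[OF rhom_pev]])
     (simp_all add: poly_subst_Const poly_subst_Var rhom_0[OF rhom_pev])

lemma S_eval_splt:
  "poly_subst (poly_subst (pev (p i)) x) (\<lambda>(k, j). p k j) (splt i f) = S_eval x p f" (is "?E (splt i f) = _")
proof -
  have r: "rhom (poly_subst (pev (p i)) x)" by (rule rhom_poly_subst) simp
  have E: "rhom ?E" by (rule rhom_poly_subst[OF r])
  have EC: "?E (Const c) = poly_subst (pev (p i)) x c" and EV: "?E (Var v) = (case v of (k, j) \<Rightarrow> p k j)" for c v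
    by (simp_all add: poly_subst_Const poly_subst_Var r rhom_0[OF r])
  show ?thesis
    by (rule rhom_eqI[OF rhom_comp[OF E rhom_splt] rhom_S_eval])
       (auto simp: EC EV pev_extend_coeffs poly_subst_Const poly_subst_Var rhom_0[OF rhom_pev])
qed

text \<open>The ideal of the fibre power over K[x]/P whose factors are indexed by F. Coordinates of
  points outside F remain free variables.\<close>

definition fib_ideal :: "('m, ('n, 'k::comm_ring_1) mpoly) mpoly set \<Rightarrow> ('m, 'k) mpoly set \<Rightarrow> nat set
    \<Rightarrow> (nat \<times> 'n, ('m, 'k) mpoly) mpoly set" where
  "fib_ideal J P F = tgen (Const ` P \<union> (\<Union>i\<in>F. emb i ` J))"

text \<open>The elements that are torsion over \<open>K[x]/P\<close> modulo \<open>fib_ideal\<close>.\<close>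

definition fib_closure :: "('m, ('n, 'k::comm_ring_1) mpoly) mpoly set \<Rightarrow> ('m, 'k) mpoly set \<Rightarrow> nat set
    \<Rightarrow> (nat \<times> 'n, ('m, 'k) mpoly) mpoly set" where
  "fib_closure J P F = {g. \<exists>a. a \<notin> P \<and> Const a * g \<in> fib_ideal J P F}"

lemma tideal_fib_ideal: "tideal (fib_ideal J P F)"
  unfolding fib_ideal_def by (rule tideal_tgen)

lemma Const_fib_ideal: "Const ` P \<subseteq> fib_ideal J P F"
  unfolding fib_ideal_def by (rule order_trans[OF _ tgen_superset]) blast

lemma fib_ideal_subset_closure: assumes "tprime P" shows "fib_ideal J P F \<subseteq> fib_closure J P F"
  unfolding fib_closure_def
  by (auto simp: rhom_1[OF rhom_Const] intro!: exI[of _ 1] tprime_1[OF assms])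

lemma tideal_fib_closure: assumes P: "tprime P" shows "tideal (fib_closure J P F)"
  unfolding tideal_def
proof (intro conjI ballI allI)
  note t = tideal_fib_ideal[of J P F]
  show "0 \<in> fib_closure J P F" using fib_ideal_subset_closure[OF P] tideal_0[OF t] by blast
  fix f g assume "f \<in> fib_closure J P F" "g \<in> fib_closure J P F"
  then obtain a b where ab: "a \<notin> P" "Const a * f \<in> fib_ideal J P F" "b \<notin> P" "Const b * g \<in> fib_ideal J P F"
    by (auto simp: fib_closure_def)
  have "Const (a * b) * (f + g) = Const b * (Const a * f) + Const a * (Const b * g)"
    by (simp add: rhom_mult[OF rhom_Const] algebra_simps)
  also have "\<dots> \<in> fib_ideal J P F" by (rule tideal_add[OF t tideal_mult[OF t ab(2)] tideal_mult[OF t ab(4)]])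
  finally show "f + g \<in> fib_closure J P F"
    unfolding fib_closure_def using tprime_mult[OF P] ab by blast
next
  note t = tideal_fib_ideal[of J P F]
  fix r f assume "f \<in> fib_closure J P F"
  then obtain a where a: "a \<notin> P" "Const a * f \<in> fib_ideal J P F" by (auto simp: fib_closure_def)
  have "Const a * (r * f) = r * (Const a * f)" by (simp add: mult_ac)
  also have "\<dots> \<in> fib_ideal J P F" by (rule tideal_mult[OF t a(2)])
  finally show "r * f \<in> fib_closure J P F" unfolding fib_closure_def using a(1) by blast
qed

lemma fib_closure_cancel:
  assumes P: "tprime P" and "a \<notin> P" "Const a * f \<in> fib_closure J P F" shows "f \<in> fib_closure J P F"
proof -
  obtain b where b: "b \<notin> P" "Const b * (Const a * f) \<in> fib_ideal J P F" using assms(3) by (auto simp: fib_closure_def)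
  have "Const (b * a) * f \<in> fib_ideal J P F" using b(2) by (simp add: rhom_mult[OF rhom_Const] mult_ac)
  then show ?thesis unfolding fib_closure_def using tprime_mult[OF P] assms(2) b(1) by blast
qed

text \<open>With the coordinates of the i-th point among the coefficients, the ideal is the
  extension of that for F plus the polynomials with coefficients in J. The products
  \<open>extS t * Const c\<close> have the shape of tensors: t is an equation for the remaining
  points and c represents a function on \<Sigma>. This is the input for
  \<open>flat_module_relation\<close>.\<close>

lemma split_decomposition:
  assumes J: "tideal J" and g: "g \<in> fib_ideal J P (insert i F)" and iF: "i \<notin> F"
  shows "\<exists>xs r. fst ` set xs \<subseteq> fib_ideal J P F \<and> (\<forall>m. lookup r m \<in> J) \<and>
    splt i g = (\<Sum>(t, c)\<leftarrow>xs. extS t * Const c) + r"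
proof -
  define H where "H = {h. \<exists>xs r. fst ` set xs \<subseteq> fib_ideal J P F \<and> (\<forall>m. lookup r m \<in> J) \<and>
    h = (\<Sum>(t, c)\<leftarrow>xs. extS t * Const c) + r}"
  have HI: "(\<Sum>(t, c)\<leftarrow>xs. extS t * Const c) + r \<in> H" if "fst ` set xs \<subseteq> fib_ideal J P F" "\<And>m. lookup r m \<in> J" for xs r
    unfolding H_def using that by blast
  note tc = tideal_coeffs[OF J] and t = tideal_fib_ideal[of J P F]
  have H0: "0 \<in> H" using HI[of "[]" 0] tideal_0[OF J] by simp
  have Hadd: "f + g \<in> H" if fg: "f \<in> H" "g \<in> H" for f g
  proof -
    from fg obtain xs r ys s where 1: "fst ` set xs \<subseteq> fib_ideal J P F" "\<forall>m. lookup r m \<in> J" "f = (\<Sum>(t, c)\<leftarrow>xs. extS t * Const c) + r"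
      "fst ` set ys \<subseteq> fib_ideal J P F" "\<forall>m. lookup s m \<in> J" "g = (\<Sum>(t, c)\<leftarrow>ys. extS t * Const c) + s"
      unfolding H_def by blast
    have "(\<Sum>(t, c)\<leftarrow>xs @ ys. extS t * Const c) + (r + s) \<in> H"
      using 1 by (intro HI) (auto simp: lookup_add tideal_add[OF J])
    also have "(\<Sum>(t, c)\<leftarrow>xs @ ys. extS t * Const c) + (r + s) = f + g" by (simp add: 1(3,6) algebra_simps)
    finally show ?thesis .
  qed
  have Hsum: "sum f A \<in> H" if "\<And>a. a \<in> A \<Longrightarrow> f a \<in> H" for f and A :: "(nat \<times> 'b \<Rightarrow>\<^sub>0 nat) set"
    using that by (induction A rule: infinite_finite_induct) (auto simp: H0 Hadd)
  have Hmono: "single m c * f \<in> H" if f: "f \<in> H" for m c f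
  proof -
    from f obtain xs r where 1: "fst ` set xs \<subseteq> fib_ideal J P F" "\<forall>m. lookup r m \<in> J" "f = (\<Sum>(t, c)\<leftarrow>xs. extS t * Const c) + r"
      unfolding H_def by blast
    \<comment> \<open>Multiplication by a term is distributed over the two factors: the monomial m
      goes to t, the coefficient c to the other one.\<close>
    let ?ys = "map (\<lambda>(t, d). (single m 1 * t, c * d)) xs"
    have s: "single m c = single m 1 * Const c" by (simp add: Const_def mult_single)
    have "(\<Sum>(t, d)\<leftarrow>?ys. extS t * Const d) + single m c * r \<in> H"
    proof (rule HI)
      show "fst ` set ?ys \<subseteq> fib_ideal J P F" using 1(1) tideal_mult[OF t] by (auto simp: split_beta)
      show "lookup (single m c * r) k \<in> J" for k using tideal_mult[OF tc, of r "single m c"] 1(2) by simp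
    qed
    also have "(\<Sum>(t, d)\<leftarrow>?ys. extS t * Const d) = single m c * (\<Sum>(t, d)\<leftarrow>xs. extS t * Const d)"
      unfolding s by (induction xs) (auto simp: rhom_mult[OF rhom_extS] extS_single rhom_mult[OF rhom_Const] algebra_simps)
    finally show ?thesis by (simp add: 1(3) distrib_left)
  qed
  have "tideal H"
    unfolding tideal_def
  proof (intro conjI ballI allI H0 Hadd)
    fix r f assume "f \<in> H"
    have "r * f = (\<Sum>m\<in>keys r. single m (lookup r m) * f)"
      by (subst poly_mapping_sum_single[of r]) (simp add: sum_distrib_right)
    also have "\<dots> \<in> H" by (intro Hsum Hmono \<open>f \<in> H\<close>)
    finally show "r * f \<in> H" .
  qed
  then have "tideal {g. splt i g \<in> H}" by (rule tideal_vimage[OF rhom_splt])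
  moreover have extH: "extS f \<in> H" if "f \<in> fib_ideal J P F" for f
    using HI[of "[(f, 1)]" 0] that tideal_0[OF J] by (simp add: rhom_1[OF rhom_Const])
  have "Const ` P \<union> (\<Union>k\<in>insert i F. emb k ` J) \<subseteq> {g. splt i g \<in> H}"
  proof (intro Un_least UN_least image_subsetI CollectI)
    fix c assume "c \<in> P"
    then have "Const c \<in> fib_ideal J P F" using Const_fib_ideal by blast
    from extH[OF this] show "splt i (Const c) \<in> H" by simp
  next
    fix k j assume k: "k \<in> insert i F" and j: "j \<in> J"
    show "splt i (emb k j) \<in> H"
    proof (cases "k = i")
      case True
      have "\<And>m. lookup (Const j) m \<in> J" using j tideal_0[OF J] by (simp add: Const_def lookup_single when_def)
      from HI[of "[]", OF _ this] show ?thesis by (simp add: True splt_emb_same)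
    next
      case False
      then have "emb k j \<in> fib_ideal J P F"
        unfolding fib_ideal_def using k j tgen_superset by fastforce
      from extH[OF this] show ?thesis by (simp add: splt_emb_other[OF False])
    qed
  qed
  ultimately have "fib_ideal J P (insert i F) \<subseteq> {g. splt i g \<in> H}"
    unfolding fib_ideal_def by (intro tgen_minimal)
  with g show ?thesis unfolding H_def by blast
qed

context field_family
begin

text \<open>As far as values at x can tell, h is g with the i-th point frozen at b, up to the
  nonzero scalar e(x). As g and h have coefficients in different rings after splitting, they are
  compared coefficient by coefficient; e comes from the denominators in the local ring at x.\<close>

lemma elimination_step:
  assumes flat: "Proj_flat (projective_ring I) (projective_ring J) (pr1_hom J)"
    and xw: "x w = 1" and b: "b \<in> fib x"
    and \<eta>: "tprime \<eta>" "I \<subseteq> \<eta>" "\<And>f. f \<in> \<eta> \<Longrightarrow> pev x f = 0"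
    and iF: "i \<notin> F" and g: "g \<in> fib_closure J (dehom_prime w \<eta>) (insert i F)"
  shows "\<exists>h e. h \<in> fib_closure J (dehom_prime w \<eta>) F \<and> pev x e \<noteq> 0 \<and>
    (\<forall>m. pev x (lookup h m) = pev x e * poly_subst (pev b) x (lookup (splt i g) m))"
proof -
  let ?P = "dehom_prime w \<eta>"
  have w\<eta>: "Var w \<notin> \<eta>" using \<eta>(3)[of "Var w"] xw by (auto simp: poly_subst_Var)
  have P: "tprime ?P" by (rule tprime_dehom_prime[OF \<eta>(1) w\<eta>])
  have P_iff: "dle f d \<Longrightarrow> f \<in> ?P \<longleftrightarrow> hz w d f \<in> \<eta>" for f d by (rule dehom_prime_iff[OF \<eta>(1) w\<eta>])
  have P_van: "pev x f = 0" if "f \<in> ?P" for f by (rule dehom_prime_vanish[OF that \<eta>(3) xw])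
  have nP: "f \<notin> ?P" if "pev x f \<noteq> 0" for f using P_van that by blast
  note tCl = tideal_fib_closure[OF P, of J F] and tFi = tideal_fib_ideal[of J ?P F]
  have q: "Qpt x b \<in> J.proj_primes" by (rule Qpt_prime[of x w, OF _ b]) (simp add: xw)
  interpret R: proj_pt I "contr (Qpt x b)" "\<lambda>c. c" x w
    by unfold_locales (rule contr_prime[OF q], simp_all add: contr_Qpt xw)
  interpret B: proj_pt J "Qpt x b" "pev b" x w
    by unfold_locales (rule q, simp_all add: xw)
  interpret fp: flat_family_point I J "Qpt x b"
    by unfold_locales (rule q, rule flat)
  define N where "N = restrict_scalars B.L fp.\<phi>"
  have flatN: "flat_module R.L N" unfolding N_def by (rule fp.flat_at(1)[OF flat])
  have md: "module R.L N" using flatN by (simp add: flat_module_def)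
  interpret RL: cring R.L by (rule fp.cring_RL)
  interpret N: module R.L N by (rule md)
  have N_simps: "carrier N = carrier B.L" "\<And>y z. y \<oplus>\<^bsub>N\<^esub> z = y \<oplus>\<^bsub>B.L\<^esub> z" "\<zero>\<^bsub>N\<^esub> = \<zero>\<^bsub>B.L\<^esub>"
    "\<And>r y. r \<odot>\<^bsub>N\<^esub> y = fp.\<phi> r \<otimes>\<^bsub>B.L\<^esub> y"
    by (simp_all add: N_def)
  have \<phi>_dhom: "fp.\<phi> (R.dhom f) = B.dhom (extend_coeffs f)" for f
  proof -
    have d: "dle (extend_coeffs f) (R.deg f)" using R.dle_deg by (simp add: dle_extend_coeffs)
    show ?thesis
      unfolding B.dhom_eq[OF d] unfolding R.dhom_def fp.local_map_fr[OF R.adm_hz[OF R.dle_deg]]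
      by (simp add: hz_extend_coeffs rhom_power[OF rhom_extend_coeffs] extend_coeffs_Var)
  qed
  have smult_dhom: "R.dhom f \<odot>\<^bsub>N\<^esub> B.dhom h = B.dhom (extend_coeffs f * h)" for f h
    by (simp add: N_simps \<phi>_dhom B.dhom_mult)
  have val_smult: "B.val (r \<odot>\<^bsub>N\<^esub> y) = R.val r * B.val y" if r: "r \<in> carrier R.L" and y: "y \<in> carrier N" for r y
  proof -
    obtain f s where f: "r = R.fr f s" "R.adm f s" using r by (rule R.carrier_LE)
    have a: "B.adm (extend_coeffs f) (extend_coeffs s)" by (rule fp.adm_ext[OF f(2)])
    have \<phi>: "fp.\<phi> r = B.fr (extend_coeffs f) (extend_coeffs s)" unfolding f(1) by (rule fp.local_map_fr[OF f(2)])
    have "B.val (fp.\<phi> r) = R.val r"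
      unfolding \<phi> B.val_fr[OF a] unfolding f(1) R.val_fr[OF f(2)] by (simp add: pev_extend_coeffs)
    moreover have "fp.\<phi> r \<in> carrier B.L" unfolding \<phi> by (rule B.fr_in_carrier[OF a])
    ultimately show ?thesis using B.val_mult y by (simp add: N_simps)
  qed
  obtain a where a: "a \<notin> ?P" "Const a * g \<in> fib_ideal J ?P (insert i F)" using g by (auto simp: fib_closure_def)
  obtain xs r where xs: "fst ` set xs \<subseteq> fib_ideal J ?P F" and r: "\<And>m. lookup r m \<in> J"
    and dec: "splt i (Const a * g) = (\<Sum>(t, c)\<leftarrow>xs. extS t * Const c) + r"
    using split_decomposition[OF J.tJ a(2) iF] by blast
  \<comment> \<open>Finitely many monomials support \<open>splt i g\<close> and all left factors of
    the decomposition, so that polynomials over \<open>\<Omega>\<close> become vectors of length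
    s.\<close>
  define \<Omega> where "\<Omega> = keys (splt i g) \<union> (\<Union>t\<in>fst ` set xs. keys t)"
  have fin\<Omega>: "finite \<Omega>" by (simp add: \<Omega>_def)
  define s where "s = card \<Omega>"
  obtain \<mu> where \<mu>: "bij_betw \<mu> {..<s} \<Omega>"
    using ex_bij_betw_nat_finite[OF fin\<Omega>] by (auto simp: s_def atLeast0LessThan)
  have \<mu>_in: "\<mu> i \<in> \<Omega>" if "i < s" for i using \<mu> that by (auto simp: bij_betw_def)
  have \<mu>_surj: "\<exists>i<s. m = \<mu> i" if "m \<in> \<Omega>" for m using \<mu> that by (auto simp: bij_betw_def)
  have \<mu>_inj: "\<mu> i = \<mu> k \<longleftrightarrow> i = k" if "i < s" "k < s" for i k
    using \<mu> that by (auto simp: bij_betw_def inj_on_def)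
  define V where "V = {f. \<forall>i. (i < s \<longrightarrow> f i \<in> carrier R.L) \<and> (i \<ge> s \<longrightarrow> f i = \<zero>\<^bsub>R.L\<^esub>)}"
  \<comment> \<open>The torsion closure localised at x, as a module of coefficient vectors; e is a
    denominator of the vector f.\<close>
  define T where "T = {f\<in>V. \<exists>e h. pev x e \<noteq> 0 \<and> h \<in> fib_closure J ?P F \<and> keys h \<subseteq> \<Omega> \<and>
      (\<forall>i<s. R.dhom e \<otimes>\<^bsub>R.L\<^esub> f i = R.dhom (lookup h (\<mu> i)))}"
  have TI: "f \<in> T" if "f \<in> V" "pev x e \<noteq> 0" "h \<in> fib_closure J ?P F" "keys h \<subseteq> \<Omega>"
      "\<And>i. i < s \<Longrightarrow> R.dhom e \<otimes>\<^bsub>R.L\<^esub> f i = R.dhom (lookup h (\<mu> i))" for f e h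
    unfolding T_def using that by blast
  have Vc: "f i \<in> carrier R.L" if "f \<in> V" for f i
    using that RL.zero_closed unfolding V_def by (cases "i < s") auto
  have keysC: "keys (Const c * h) \<subseteq> keys h" for c :: "('m, 'k) mpoly" and h :: "(nat \<times> 'n, ('m, 'k) mpoly) mpoly"
    by (auto simp: in_keys_iff lookup_Const_mult)
  let ?t = "\<lambda>j i. if i < s then R.dhom (lookup (fst (xs ! j)) (\<mu> i)) else \<zero>\<^bsub>R.L\<^esub>"
  let ?n = "\<lambda>i. B.dhom (lookup (splt i g) (\<mu> i))"
  \<comment> \<open>Flatness is used for the local ring of \<Sigma> at (x, b) over that of X at x.
    The elements \<open>n\<close> are the coefficients of \<open>splt i g\<close>; multiplied by a,
    they become combinations of vectors from T by the decomposition above, since its part r dies in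
    the local ring of \<Sigma>.\<close>
  have "\<exists>t\<in>T. \<forall>k<s. R.val (t k) = B.val (B.dhom (lookup (splt i g) (\<mu> k)))"
  proof (rule flat_module_relation[OF flatN V_def, where L = "{..<length xs}" and a = "R.dhom a" and
        t = ?t and m = "\<lambda>j. B.dhom (snd (xs ! j))"])
    show "T \<subseteq> V" by (auto simp: T_def)
    show "(\<lambda>_. \<zero>\<^bsub>R.L\<^esub>) \<in> T"
    proof (rule TI[of _ 1 0])
      show "(\<lambda>_. \<zero>\<^bsub>R.L\<^esub>) \<in> V" by (auto simp: V_def)
    qed (simp_all add: rhom_1 tideal_0[OF tCl] R.dhom_0 R.dhom_1)
  next
    fix f g assume "f \<in> T" "g \<in> T"
    then obtain e h e' h' where 1: "f \<in> V" "pev x e \<noteq> 0" "h \<in> fib_closure J ?P F" "keys h \<subseteq> \<Omega>"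
      "\<And>i. i < s \<Longrightarrow> R.dhom e \<otimes>\<^bsub>R.L\<^esub> f i = R.dhom (lookup h (\<mu> i))"
      and 2: "g \<in> V" "pev x e' \<noteq> 0" "h' \<in> fib_closure J ?P F" "keys h' \<subseteq> \<Omega>"
      "\<And>i. i < s \<Longrightarrow> R.dhom e' \<otimes>\<^bsub>R.L\<^esub> g i = R.dhom (lookup h' (\<mu> i))"
      unfolding T_def by blast
    show "(\<lambda>i. f i \<oplus>\<^bsub>R.L\<^esub> g i) \<in> T"
    proof (rule TI[of _ "e * e'" "Const e' * h + Const e * h'"])
      show "(\<lambda>i. f i \<oplus>\<^bsub>R.L\<^esub> g i) \<in> V" using 1(1) 2(1) by (auto simp: V_def)
      show "pev x (e * e') \<noteq> 0" using 1(2) 2(2) by (simp add: rhom_mult)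
      show "Const e' * h + Const e * h' \<in> fib_closure J ?P F"
        by (rule tideal_add[OF tCl tideal_mult[OF tCl 1(3)] tideal_mult[OF tCl 2(3)]])
      show "keys (Const e' * h + Const e * h') \<subseteq> \<Omega>"
        using Poly_Mapping.keys_add[of "Const e' * h" "Const e * h'"] keysC[of e' h] keysC[of e h'] 1(4) 2(4) by blast
      fix i assume i: "i < s"
      note c = R.dhom_carrier[of e] R.dhom_carrier[of e'] Vc[OF 1(1), of i] Vc[OF 2(1), of i]
      have "R.dhom (e * e') \<otimes>\<^bsub>R.L\<^esub> (f i \<oplus>\<^bsub>R.L\<^esub> g i) =
          R.dhom e' \<otimes>\<^bsub>R.L\<^esub> (R.dhom e \<otimes>\<^bsub>R.L\<^esub> f i) \<oplus>\<^bsub>R.L\<^esub> R.dhom e \<otimes>\<^bsub>R.L\<^esub> (R.dhom e' \<otimes>\<^bsub>R.L\<^esub> g i)"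
        using c by (simp add: R.dhom_mult RL.r_distr RL.m_ac)
      then show "R.dhom (e * e') \<otimes>\<^bsub>R.L\<^esub> (f i \<oplus>\<^bsub>R.L\<^esub> g i) = R.dhom (lookup (Const e' * h + Const e * h') (\<mu> i))"
        by (simp add: 1(5)[OF i] 2(5)[OF i] lookup_add lookup_Const_mult R.dhom_add R.dhom_mult)
    qed
  next
    fix y f assume y: "y \<in> carrier R.L" and "f \<in> T"
    then obtain e h where 1: "f \<in> V" "pev x e \<noteq> 0" "h \<in> fib_closure J ?P F" "keys h \<subseteq> \<Omega>"
      "\<And>i. i < s \<Longrightarrow> R.dhom e \<otimes>\<^bsub>R.L\<^esub> f i = R.dhom (lookup h (\<mu> i))"
      unfolding T_def by blast
    obtain u d where d: "y = R.fr u d" "R.adm u d" using y by (rule R.carrier_LE)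
    note fr = R.dhom_frac[OF d(2), folded d(1)]
    show "(\<lambda>i. y \<otimes>\<^bsub>R.L\<^esub> f i) \<in> T"
    proof (rule TI[of _ "d * e" "Const u * h"])
      show "(\<lambda>i. y \<otimes>\<^bsub>R.L\<^esub> f i) \<in> V" using 1(1) y by (auto simp: V_def)
      show "pev x (d * e) \<noteq> 0" using 1(2) fr(2) by (simp add: rhom_mult)
      show "Const u * h \<in> fib_closure J ?P F" by (rule tideal_mult[OF tCl 1(3)])
      show "keys (Const u * h) \<subseteq> \<Omega>" using keysC[of u h] 1(4) by blast
      fix i assume i: "i < s"
      note c = R.dhom_carrier[of e] R.dhom_carrier[of d] Vc[OF 1(1), of i] y
      have "R.dhom (d * e) \<otimes>\<^bsub>R.L\<^esub> (y \<otimes>\<^bsub>R.L\<^esub> f i) = (R.dhom d \<otimes>\<^bsub>R.L\<^esub> y) \<otimes>\<^bsub>R.L\<^esub> (R.dhom e \<otimes>\<^bsub>R.L\<^esub> f i)"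
        using c by (simp add: R.dhom_mult RL.m_ac)
      then show "R.dhom (d * e) \<otimes>\<^bsub>R.L\<^esub> (y \<otimes>\<^bsub>R.L\<^esub> f i) = R.dhom (lookup (Const u * h) (\<mu> i))"
        by (simp add: 1(5)[OF i] fr(1) lookup_Const_mult R.dhom_mult)
    qed
  next
    show "R.dhom a \<in> carrier R.L" by (rule R.dhom_carrier)
  next
    fix v assume v: "v \<in> V" and "(\<lambda>i. R.dhom a \<otimes>\<^bsub>R.L\<^esub> v i) \<in> T"
    then obtain e h where 1: "pev x e \<noteq> 0" "h \<in> fib_closure J ?P F" "keys h \<subseteq> \<Omega>"
      "\<And>i. i < s \<Longrightarrow> R.dhom e \<otimes>\<^bsub>R.L\<^esub> (R.dhom a \<otimes>\<^bsub>R.L\<^esub> v i) = R.dhom (lookup h (\<mu> i))"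
      unfolding T_def by blast
    have "\<exists>c d. pev x d \<noteq> 0 \<and> R.dhom d \<otimes>\<^bsub>R.L\<^esub> v i = R.dhom c" for i
    proof -
      from Vc[OF v, of i] obtain f s where "v i = R.fr f s" "R.adm f s" by (rule R.carrier_LE)
      with R.dhom_frac[of f s] show ?thesis by metis
    qed
    then obtain c d where cd: "\<And>i. pev x (d i) \<noteq> 0" "\<And>i. R.dhom (d i) \<otimes>\<^bsub>R.L\<^esub> v i = R.dhom (c i)" by metis
    \<comment> \<open>A common denominator of the entries of v; \<open>c' i\<close> is the numerator
      of the i-th entry over it.\<close>
    define D where "D = (\<Prod>i<s. d i)"
    define c' where "c' i = (\<Prod>k\<in>{..<s} - {i}. d k) * c i" for i
    have D0: "pev x D \<noteq> 0" unfolding D_def using cd(1) by (simp add: rhom_prod)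
    have Dv: "R.dhom D \<otimes>\<^bsub>R.L\<^esub> v i = R.dhom (c' i)" if "i < s" for i
    proof -
      have "D = (\<Prod>k\<in>{..<s} - {i}. d k) * d i" unfolding D_def using that by (subst prod.remove[of _ i]) (auto simp: mult.commute)
      then have "R.dhom D \<otimes>\<^bsub>R.L\<^esub> v i = R.dhom (\<Prod>k\<in>{..<s} - {i}. d k) \<otimes>\<^bsub>R.L\<^esub> (R.dhom (d i) \<otimes>\<^bsub>R.L\<^esub> v i)"
        using R.dhom_carrier Vc[OF v] by (simp add: R.dhom_mult RL.m_assoc)
      then show ?thesis by (simp add: cd(2) c'_def R.dhom_mult)
    qed
    \<comment> \<open>Equality in the local ring at x becomes membership in the prime of the chart
      after multiplication by some u with u(x) nonzero, because I is contained in \<eta>.\<close>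
    have "\<exists>u. pev x u \<noteq> 0 \<and> u * (e * a * c' i - D * lookup h (\<mu> i)) \<in> ?P" if i: "i < s" for i
    proof -
      let ?f = "e * a * c' i" and ?g = "D * lookup h (\<mu> i)"
      have "R.dhom ?f = R.dhom e \<otimes>\<^bsub>R.L\<^esub> R.dhom a \<otimes>\<^bsub>R.L\<^esub> (R.dhom D \<otimes>\<^bsub>R.L\<^esub> v i)" by (simp add: R.dhom_mult Dv[OF i])
      also have "\<dots> = R.dhom D \<otimes>\<^bsub>R.L\<^esub> (R.dhom e \<otimes>\<^bsub>R.L\<^esub> (R.dhom a \<otimes>\<^bsub>R.L\<^esub> v i))"
        using R.dhom_carrier Vc[OF v] by (simp add: RL.m_ac)
      also have "\<dots> = R.dhom ?g" by (simp add: 1(4)[OF i] R.dhom_mult)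
      finally have eq: "R.dhom ?f = R.dhom ?g" .
      have "R.dhom (?f - ?g) \<oplus>\<^bsub>R.L\<^esub> R.dhom ?g = R.dhom ?g" by (simp add: eq flip: R.dhom_add)
      then have "R.dhom (?f - ?g) = \<zero>\<^bsub>R.L\<^esub>" using R.dhom_carrier by (metis RL.add.l_cancel_one RL.add.m_comm RL.zero_closed)
      then obtain k u where u: "u \<in> homog k" "u \<notin> contr (Qpt x b)" "u * hz w (R.deg (?f - ?g)) (?f - ?g) \<in> I"
        unfolding R.dhom_eq_zero_iff[OF R.dle_deg] by blast
      have "hz w (k + R.deg (?f - ?g)) (u * (?f - ?g)) \<in> \<eta>"
        using u(3) \<eta>(2) by (auto simp: hz_mult[OF dle_homog[OF u(1)] R.dle_deg] hz_of_homog[OF u(1)])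
      then have "u * (?f - ?g) \<in> ?P" using P_iff[OF dle_mult[OF dle_homog[OF u(1)] R.dle_deg]] by blast
      moreover have "pev x u \<noteq> 0" using R.homog_p_iff[OF u(1)] u(2) by blast
      ultimately show ?thesis by blast
    qed
    then obtain u where u: "\<And>i. i < s \<Longrightarrow> pev x (u i) \<noteq> 0"
      "\<And>i. i < s \<Longrightarrow> u i * (e * a * c' i - D * lookup h (\<mu> i)) \<in> ?P" by metis
    define U where "U = (\<Prod>i<s. u i)"
    have U0: "pev x U \<noteq> 0" unfolding U_def using u(1) by (simp add: rhom_prod)
    have Uu: "U * (e * a * c' i - D * lookup h (\<mu> i)) \<in> ?P" if i: "i < s" for i
    proof -
      have "U = (\<Prod>k\<in>{..<s} - {i}. u k) * u i" unfolding U_def using i by (subst prod.remove[of _ i]) (auto simp: mult.commute)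
      then show ?thesis using tideal_mult[OF tprime_tideal[OF P] u(2)[OF i]] by (simp add: mult.assoc)
    qed
    define h' where "h' = (\<Sum>i<s. single (\<mu> i) (c' i))"
    have lh': "lookup h' (\<mu> i) = c' i" if "i < s" for i
    proof -
      have "lookup h' (\<mu> i) = (\<Sum>k<s. if k = i then c' k else 0)"
        unfolding h'_def lookup_sum lookup_single using \<mu>_inj that by (intro sum.cong) (auto simp: when_def)
      then show ?thesis using that by simp
    qed
    have kh': "keys h' \<subseteq> \<Omega>" unfolding h'_def using keys_sum[of "\<lambda>i. single (\<mu> i) (c' i)" "{..<s}"] \<mu>_in by fastforce
    \<comment> \<open>Modulo the prime, U e a h' equals U D h, which lies in the torsion closure.
      The factor U e a is outside the prime, since U and e are nonzero at x, and can be
      cancelled.\<close>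
    let ?diff = "Const (U * e * a) * h' - Const (U * D) * h"
    have "lookup ?diff m \<in> ?P" for m
    proof (cases "m \<in> \<Omega>")
      case True
      then obtain i where i: "i < s" "m = \<mu> i" using \<mu>_surj by blast
      have "lookup ?diff m = U * (e * a * c' i - D * lookup h (\<mu> i))"
        unfolding lookup_minus lookup_Const_mult i(2) lh'[OF i(1)] by (simp add: algebra_simps)
      then show ?thesis using Uu[OF i(1)] by simp
    next
      case False
      then have "lookup h' m = 0" "lookup h m = 0" using kh' 1(3) by (auto simp: in_keys_iff)
      then show ?thesis by (simp add: lookup_minus lookup_Const_mult tideal_0[OF tprime_tideal[OF P]])
    qed
    then have "?diff \<in> fib_closure J ?P F"
      using coeffs_in_ideal[OF tFi Const_fib_ideal] fib_ideal_subset_closure[OF P] by blast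
    from tideal_add[OF tCl this tideal_mult[OF tCl 1(2), of "Const (U * D)"]]
    have "Const (U * e * a) * h' \<in> fib_closure J ?P F" by simp
    then have "h' \<in> fib_closure J ?P F"
      using tprime_mult[OF P] nP[OF U0] nP[OF 1(1)] a(1) by (intro fib_closure_cancel[OF P, of "U * e * a" h']) blast+
    then show "v \<in> T" using lh' Dv by (intro TI[OF v D0 _ kh']) auto
  next
    fix k assume k: "k < s"
    show "B.dhom (lookup (splt i g) (\<mu> k)) \<in> carrier N" unfolding N_simps by (rule B.dhom_carrier)
  next
    show "finite {..<length xs}" by simp
  next
    fix j assume "j \<in> {..<length xs}"
    then have j: "xs ! j \<in> set xs" by simp
    show "?t j \<in> T"
    proof (rule TI[of _ 1 "fst (xs ! j)"])
      show "?t j \<in> V" using R.dhom_carrier by (auto simp: V_def)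
      show "pev x 1 \<noteq> 0" by (simp add: rhom_1)
      show "fst (xs ! j) \<in> fib_closure J ?P F" using j xs fib_ideal_subset_closure[OF P] by blast
      show "keys (fst (xs ! j)) \<subseteq> \<Omega>" using j by (auto simp: \<Omega>_def)
      fix i assume "i < s"
      then show "R.dhom 1 \<otimes>\<^bsub>R.L\<^esub> ?t j i = R.dhom (lookup (fst (xs ! j)) (\<mu> i))"
        using R.dhom_carrier by (simp add: R.dhom_1)
    qed
    show "B.dhom (snd (xs ! j)) \<in> carrier N" unfolding N_simps by (rule B.dhom_carrier)
  next
    fix k assume k: "k < s"
    let ?c = "\<lambda>j. extend_coeffs (lookup (fst (xs ! j)) (\<mu> k)) * snd (xs ! j)"
    have sum: "B.dhom (\<Sum>j\<in>A. ?c j) = (\<Oplus>\<^bsub>N\<^esub>j\<in>A. B.dhom (?c j))" if "finite A" for A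
      using that
    proof induction
      case empty
      then show ?case by (simp add: B.dhom_0 N_simps)
    next
      case (insert j A)
      have c: "(\<lambda>j. B.dhom (?c j)) \<in> A \<rightarrow> carrier N" "B.dhom (?c j) \<in> carrier N"
        by (auto simp: N_simps B.dhom_carrier)
      show ?case using insert by (simp add: N.M.finsum_insert[OF insert.hyps c] B.dhom_add N_simps)
    qed
    have "lookup (splt i (Const a * g)) (\<mu> k) = (\<Sum>j<length xs. ?c j) + lookup r (\<mu> k)"
    proof -
      have "(\<Sum>(t, c)\<leftarrow>xs. extS t * Const c) = (\<Sum>j<length xs. Const (snd (xs ! j)) * extS (fst (xs ! j)))"
        by (simp add: sum_list_sum_nth atLeast0LessThan split_beta mult.commute)
      then show ?thesis unfolding dec
        by (simp add: lookup_add lookup_sum lookup_Const_mult lookup_extS mult.commute)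
    qed
    moreover have "lookup (splt i (Const a * g)) (\<mu> k) = extend_coeffs a * lookup (splt i g) (\<mu> k)"
      by (simp add: rhom_mult[OF rhom_splt] lookup_Const_mult)
    ultimately have "B.dhom (extend_coeffs a * lookup (splt i g) (\<mu> k)) = B.dhom (\<Sum>j<length xs. ?c j) \<oplus>\<^bsub>N\<^esub> B.dhom (lookup r (\<mu> k))"
      by (simp only: B.dhom_add N_simps)
    then have "R.dhom a \<odot>\<^bsub>N\<^esub> B.dhom (lookup (splt i g) (\<mu> k)) = B.dhom (\<Sum>j<length xs. ?c j) \<oplus>\<^bsub>N\<^esub> B.dhom (lookup r (\<mu> k))"
      unfolding smult_dhom .
    also have "B.dhom (lookup r (\<mu> k)) = \<zero>\<^bsub>N\<^esub>" unfolding N_simps by (rule B.dhom_J[OF r])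
    also have "B.dhom (\<Sum>j<length xs. ?c j) \<oplus>\<^bsub>N\<^esub> \<zero>\<^bsub>N\<^esub> = B.dhom (\<Sum>j<length xs. ?c j)"
      using B.dhom_carrier by (simp flip: N_simps(1))
    also have "\<dots> = (\<Oplus>\<^bsub>N\<^esub>j\<in>{..<length xs}. B.dhom (?c j))" by (rule sum) simp
    also have "\<dots> = (\<Oplus>\<^bsub>N\<^esub>j\<in>{..<length xs}. ?t j k \<odot>\<^bsub>N\<^esub> B.dhom (snd (xs ! j)))"
      using k by (simp add: smult_dhom)
    finally show "R.dhom a \<odot>\<^bsub>N\<^esub> B.dhom (lookup (splt i g) (\<mu> k)) = (\<Oplus>\<^bsub>N\<^esub>j\<in>{..<length xs}. ?t j k \<odot>\<^bsub>N\<^esub> B.dhom (snd (xs ! j)))" .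
  next
    show "R.val (y \<oplus>\<^bsub>R.L\<^esub> z) = R.val y + R.val z" "R.val (y \<otimes>\<^bsub>R.L\<^esub> z) = R.val y * R.val z"
      if "y \<in> carrier R.L" "z \<in> carrier R.L" for y z
      using that by (rule R.val_add, rule R.val_mult)
    show "R.val \<one>\<^bsub>R.L\<^esub> = 1" by (rule R.val_1)
    show "\<exists>y\<in>carrier R.L. R.val y = c" for c
      using R.dhom_carrier R.val_dhom[of "Const c"] by (intro bexI[of _ "R.dhom (Const c)"]) (simp_all add: poly_subst_Const)
    show "B.val (y \<oplus>\<^bsub>N\<^esub> z) = B.val y + B.val z" if "y \<in> carrier N" "z \<in> carrier N" for y z
      using that unfolding N_simps by (rule B.val_add)
    show "B.val (y \<odot>\<^bsub>N\<^esub> z) = R.val y * B.val z" if "y \<in> carrier R.L" "z \<in> carrier N" for y z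
      using that by (rule val_smult)
  qed
  then obtain t where t: "t \<in> T" "\<And>k. k < s \<Longrightarrow> R.val (t k) = poly_subst (pev b) x (lookup (splt i g) (\<mu> k))"
    unfolding B.val_dhom by blast
  from t(1) obtain e h where e: "t \<in> V" "pev x e \<noteq> 0" "h \<in> fib_closure J ?P F" "keys h \<subseteq> \<Omega>"
    "\<And>i. i < s \<Longrightarrow> R.dhom e \<otimes>\<^bsub>R.L\<^esub> t i = R.dhom (lookup h (\<mu> i))" unfolding T_def by blast
  have "pev x (lookup h m) = pev x e * poly_subst (pev b) x (lookup (splt i g) m)" for m
  proof (cases "m \<in> \<Omega>")
    case True
    then obtain k where k: "k < s" "m = \<mu> k" using \<mu>_surj by blast
    have "pev x (lookup h m) = R.val (R.dhom e \<otimes>\<^bsub>R.L\<^esub> t k)" by (simp add: e(5)[OF k(1)] R.val_dhom k)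
    also have "\<dots> = pev x e * R.val (t k)" by (simp add: R.val_mult R.dhom_carrier Vc[OF e(1)] R.val_dhom)
    finally show ?thesis by (simp add: t(2)[OF k(1)] k)
  next
    case False
    then have "m \<notin> keys h" "m \<notin> keys (splt i g)" using e(4) unfolding \<Omega>_def by blast+
    then have "lookup h m = 0" "lookup (splt i g) m = 0" by (simp_all add: in_keys_iff)
    then show ?thesis by (simp add: rhom_0 rhom_0[OF rhom_poly_subst[OF rhom_pev]])
  qed
  with e show ?thesis by blast
qed

end

section \<open>Openness\<close>

definition liftS :: "(nat \<times> 'n, 'k::comm_ring_1) mpoly \<Rightarrow> (nat \<times> 'n, ('m, 'k) mpoly) mpoly" where
  "liftS = poly_subst (\<lambda>c. Const (Const c)) Var"

abbreviation seq_eval :: "(nat \<Rightarrow> 'n \<Rightarrow> 'k) \<Rightarrow> (nat \<times> 'n, 'k::comm_ring_1) mpoly \<Rightarrow> 'k" where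
  "seq_eval p \<equiv> pev (\<lambda>(i, j). p i j)"

lemma S_eval_liftS: "S_eval x p (liftS f) = seq_eval p f"
proof -
  have "S_eval x p (liftS f) = poly_subst (\<lambda>c. S_eval x p (Const (Const c))) (\<lambda>v. S_eval x p (Var v)) f"
    unfolding liftS_def by (rule rhom_comp_poly_subst[OF rhom_S_eval])
  also have "\<dots> = seq_eval p f"
    by (intro arg_cong3[where f = poly_subst] ext refl) (auto simp: poly_subst_Const)
  finally show ?thesis .
qed

lemma restrict_vars_liftS:
  assumes "mvars f \<subseteq> W" shows "restrict_vars W (liftS f) = liftS f"
proof -
  have "restrict_vars W (liftS f) = poly_subst (\<lambda>c. Const (Const c)) (\<lambda>v. restrict_vars W (Var v)) f"
    unfolding liftS_def by (subst rhom_comp_poly_subst[OF rhom_restrict_vars]) simp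
  also have "\<dots> = liftS f" unfolding liftS_def using assms by (intro poly_subst_cong_mvars) auto
  finally show ?thesis .
qed

lemma restrict_vars_emb: assumes "{i} \<times> UNIV \<subseteq> W" shows "restrict_vars W (emb i f) = emb i f"
  by (rule rhom_eqI2[OF rhom_comp[OF rhom_restrict_vars rhom_emb] rhom_emb]) (use assms in auto)

context field_family
begin

lemma fib_closure_vanish:
  assumes flat: "Proj_flat (projective_ring I) (projective_ring J) (pr1_hom J)"
    and xw: "x w = 1" and \<eta>: "tprime \<eta>" "I \<subseteq> \<eta>" "\<And>f. f \<in> \<eta> \<Longrightarrow> pev x f = 0"
    and F: "finite F" and p: "\<And>i. i \<in> F \<Longrightarrow> p i \<in> fib x"
    and g: "g \<in> fib_closure J (dehom_prime w \<eta>) F"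
  shows "S_eval x p g = 0"
  using F p g
proof (induction F arbitrary: g rule: finite_induct)
  case empty
  let ?P = "dehom_prime w \<eta>"
  have w\<eta>: "Var w \<notin> \<eta>" using \<eta>(3)[of "Var w"] xw by (auto simp: poly_subst_Var)
  have P: "tprime ?P" by (rule tprime_dehom_prime[OF \<eta>(1) w\<eta>])
  note tP = tprime_tideal[OF P]
  \<comment> \<open>Without factors the ideal lies in the extension of the prime to polynomials,
    which has no torsion modulo it.\<close>
  have "fib_ideal J ?P {} \<subseteq> {f. \<forall>m. lookup f m \<in> ?P}"
    unfolding fib_ideal_def
    by (rule tgen_minimal[OF tideal_coeffs[OF tP]]) (auto simp: Const_def lookup_single when_def tideal_0[OF tP])
  then obtain a where "a \<notin> ?P" "\<And>m. a * lookup g m \<in> ?P"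
    using empty(2) by (auto simp: fib_closure_def lookup_Const_mult)
  then have "lookup g m \<in> ?P" for m using tprime_mult[OF P] by blast
  then have "pev x (lookup g m) = 0" for m using dehom_prime_vanish[OF _ \<eta>(3) xw] by blast
  then show ?case by (simp add: S_eval_def poly_subst_mval)
next
  case (insert i F)
  have pi: "p i \<in> fib x" by (rule insert.prems) simp
  obtain h e where h: "h \<in> fib_closure J (dehom_prime w \<eta>) F" "pev x e \<noteq> 0"
    "\<And>m. pev x (lookup h m) = pev x e * poly_subst (pev (p i)) x (lookup (splt i g) m)"
    using elimination_step[OF flat xw pi \<eta> insert.hyps(2) insert.prems(2)] by blast
  let ?A = "keys h \<union> keys (splt i g)" and ?p = "\<lambda>(k, j). p k j"
  have r: "rhom (poly_subst (pev (p i)) x)" by (rule rhom_poly_subst) simp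
  \<comment> \<open>Both polynomials are summed over their joint support; at x their coefficients
    differ by the factor e(x), which is nonzero.\<close>
  have "S_eval x p h = (\<Sum>m\<in>?A. pev x (lookup h m) * mval ?p m)"
    unfolding S_eval_def by (rule poly_subst_superset) (auto simp: rhom_0[OF rhom_pev])
  also have "\<dots> = pev x e * (\<Sum>m\<in>?A. poly_subst (pev (p i)) x (lookup (splt i g) m) * mval ?p m)"
    by (simp add: h(3) sum_distrib_left mult.assoc)
  also have "(\<Sum>m\<in>?A. poly_subst (pev (p i)) x (lookup (splt i g) m) * mval ?p m) = S_eval x p g"
    unfolding S_eval_splt[symmetric, of x p g i] by (rule poly_subst_superset[symmetric]) (auto simp: rhom_0[OF r])
  finally show ?case using insert.IH[OF _ h(1)] insert.prems(1) h(2) by simp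
qed

end

locale alg_closed_family = field_family I J
  for I :: "('m::finite, 'k::alg_closed_field) mpoly set" and J :: "('m, ('n::finite, 'k) mpoly) mpoly set" +
  assumes infK: "infinite (UNIV :: 'k set)"
begin

lemma nonvanishing_open:
  fixes f :: "(nat \<times> 'n, 'k) mpoly"
  assumes flat: "Proj_flat (projective_ring I) (projective_ring J) (pr1_hom J)"
    and \<eta>: "tprime \<eta>" "I \<subseteq> \<eta>" "\<forall>x\<in>base_pts. \<eta> \<subseteq> Ppt x"
    and x: "x \<in> base_pts" and p: "\<And>i. p i \<in> fib x" and f: "seq_eval p f \<noteq> 0" and N: "mvars f \<subseteq> {..<N} \<times> UNIV"
  shows "\<exists>a. a \<notin> \<eta> \<and> (\<forall>x'. (\<forall>f\<in>\<eta>. pev x' f = 0) \<and> pev x' a \<noteq> 0 \<longrightarrow>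
    (\<exists>p'. (\<forall>i<N. p' i \<in> fib x') \<and> seq_eval p' f \<noteq> 0))"
proof -
  obtain w where w: "x w \<noteq> 0" using x by (auto simp: base_pts_def)
  \<comment> \<open>Scaling moves x into the chart where x_w = 1 and keeps its fibre.\<close>
  define x1 where "x1 = (\<lambda>v. inverse (x w) * x v)"
  have x1w: "x1 w = 1" using w by (simp add: x1_def)
  have fib1: "fib x1 = fib x" unfolding x1_def by (rule fib_scale) (use w in simp)
  have \<eta>1: "pev x1 g = 0" if "g \<in> \<eta>" for g
  proof -
    have "Ppt x1 = Ppt x" unfolding x1_def by (rule pt_scale[OF rhom_id]) (use w in simp)
    then show ?thesis using bspec[OF \<eta>(3) x] that pt_vanish[OF rhom_id, of g x1] by blast
  qed
  have w\<eta>: "Var w \<notin> \<eta>" using \<eta>1[of "Var w"] x1w by (auto simp: poly_subst_Var)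
  let ?P = "dehom_prime w \<eta>"
  have P: "tprime ?P" by (rule tprime_dehom_prime[OF \<eta>(1) w\<eta>])
  let ?f = "liftS f :: (nat \<times> 'n, ('m, 'k) mpoly) mpoly"
  define M where "M = {Const a * ?f ^ k | a k. a \<notin> ?P}"
  have MI: "Const a * ?f ^ k \<in> M" if "a \<notin> ?P" for a k using that by (auto simp: M_def)
  have "\<exists>Q. tprime Q \<and> fib_ideal J ?P {..<N} \<subseteq> Q \<and> Q \<inter> M = {}"
  proof (rule prime_avoiding_exists[OF tideal_fib_ideal])
    show "1 \<in> M" using MI[of 1 0] tprime_1[OF P] by (simp add: rhom_1[OF rhom_Const])
    fix g h assume "g \<in> M" "h \<in> M"
    then obtain a k b l where 1: "g = Const a * ?f ^ k" "h = Const b * ?f ^ l" "a \<notin> ?P" "b \<notin> ?P" by (auto simp: M_def)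
    have "g * h = Const (a * b) * ?f ^ (k + l)" by (simp add: 1 rhom_mult[OF rhom_Const] power_add mult_ac)
    then show "g * h \<in> M" using MI[of "a * b"] tprime_mult[OF P] 1 by auto
  next
    show "fib_ideal J ?P {..<N} \<inter> M = {}"
    proof (rule ccontr)
      assume "fib_ideal J ?P {..<N} \<inter> M \<noteq> {}"
      then obtain a k where "a \<notin> ?P" "Const a * ?f ^ k \<in> fib_ideal J ?P {..<N}" by (auto simp: M_def)
      \<comment> \<open>The given p excludes this: elements of the torsion closure vanish there, but
        no power of f does.\<close>
      then have "?f ^ k \<in> fib_closure J ?P {..<N}" unfolding fib_closure_def by blast
      then have "S_eval x1 p (?f ^ k) = 0"
        by (intro fib_closure_vanish[OF flat x1w \<eta>(1,2) \<eta>1]) (auto simp: fib1 p)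
      then show False using f by (simp add: rhom_power[OF rhom_S_eval] S_eval_liftS)
    qed
  qed
  then obtain Q where Q: "tprime Q" "fib_ideal J ?P {..<N} \<subseteq> Q" "Q \<inter> M = {}" by blast
  \<comment> \<open>The exponent 0 in M: constants in Q belong to the prime of the chart, so
    evaluation at any of its zeros may be extended along Q.\<close>
  have QC: "c \<in> ?P" if "Const c \<in> Q" for c
  proof (rule ccontr)
    assume "c \<notin> ?P"
    from MI[OF this, of 0] that Q(3) show False by auto
  qed
  have "restrict_vars ({..<N} \<times> UNIV) ?f \<notin> Q"
    using MI[of 1 1] tprime_1[OF P] Q(3) by (auto simp: restrict_vars_liftS[OF N] rhom_1[OF rhom_Const])
  from restrict_vars_extension[OF infK Q(1) _ this]
  obtain a where a: "Const a \<notin> Q" and ext: "\<forall>\<psi> :: ('m, 'k) mpoly \<Rightarrow> 'k. rhom \<psi> \<longrightarrow> (\<forall>c. Const c \<in> Q \<longrightarrow> \<psi> c = 0) \<longrightarrow> \<psi> a \<noteq> 0 \<longrightarrow>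
    (\<exists>p. (\<forall>h. restrict_vars ({..<N} \<times> UNIV) h \<in> Q \<longrightarrow> poly_subst \<psi> p h = 0) \<and> poly_subst \<psi> p ?f \<noteq> 0)"
    by auto
  have "a \<notin> ?P" using a Q(2) Const_fib_ideal[of ?P J "{..<N}"] by blast
  obtain d where d: "dle a d" using dle_ex by blast
  show ?thesis
  \<comment> \<open>The factor \<open>Var w\<close> keeps x' in the chart, so that it can be scaled
    to x2. Homogenising a lets its nonvanishing survive this scaling.\<close>
  proof (intro exI[of _ "Var w * hz w d a"] conjI allI impI)
    show "Var w * hz w d a \<notin> \<eta>"
      using \<open>a \<notin> ?P\<close> dehom_prime_iff[OF \<eta>(1) w\<eta> d] w\<eta> tprime_mult[OF \<eta>(1)] by blast
    fix x' assume "(\<forall>f\<in>\<eta>. pev x' f = 0) \<and> pev x' (Var w * hz w d a) \<noteq> 0"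
    then have x': "\<And>f. f \<in> \<eta> \<Longrightarrow> pev x' f = 0" "pev x' (Var w * hz w d a) \<noteq> 0" by auto
    then have x'w: "x' w \<noteq> 0" "pev x' (hz w d a) \<noteq> 0" by (auto simp: rhom_mult[OF rhom_pev] poly_subst_Var)
    then have x'b: "x' \<in> base_pts" using x'(1) \<eta>(2) by (auto simp: base_pts_def)
    define x2 where "x2 = (\<lambda>v. inverse (x' w) * x' v)"
    have x2w: "x2 w = 1" using x'w by (simp add: x2_def)
    have fib2: "fib x2 = fib x'" unfolding x2_def by (rule fib_scale) (use x'w in simp)
    have \<eta>2: "pev x2 g = 0" if "g \<in> \<eta>" for g
    proof -
      have "Ppt x2 = Ppt x'" unfolding x2_def by (rule pt_scale[OF rhom_id]) (use x'w in simp)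
      then show ?thesis using bspec[OF \<eta>(3) x'b] that pt_vanish[OF rhom_id, of g x2] by blast
    qed
    have "pev x2 a = pev x2 (hz w d a)" by (simp add: poly_subst_hz[OF rhom_id, of x2 w, OF x2w])
    also have "\<dots> \<noteq> 0" unfolding x2_def poly_subst_scale[OF rhom_id hz_homog[OF d]] using x'w by simp
    finally have a2: "pev x2 a \<noteq> 0" .
    have "\<forall>c. Const c \<in> Q \<longrightarrow> pev x2 c = 0" using QC dehom_prime_vanish[OF _ \<eta>2 x2w] by blast
    with ext a2 have "\<exists>p. (\<forall>h. restrict_vars ({..<N} \<times> UNIV) h \<in> Q \<longrightarrow> poly_subst (pev x2) p h = 0) \<and> poly_subst (pev x2) p ?f \<noteq> 0"
      using rhom_pev by blast
    then obtain s where s: "\<And>h. restrict_vars ({..<N} \<times> UNIV) h \<in> Q \<Longrightarrow> poly_subst (pev x2) s h = 0"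
      "poly_subst (pev x2) s ?f \<noteq> 0" by blast
    define p' where "p' i j = s (i, j)" for i j
    have s_eq: "s = (\<lambda>(i, j). p' i j)" by (auto simp: p'_def)
    have "p' i \<in> fib x2" if "i < N" for i
      unfolding fib_def
    proof (intro CollectI ballI)
      fix j assume j: "j \<in> J"
      have "emb i j \<in> fib_ideal J ?P {..<N}"
        unfolding fib_ideal_def by (rule subsetD[OF tgen_superset]) (use that j in blast)
      then have "emb i j \<in> Q" using Q(2) by blast
      moreover have "restrict_vars ({..<N} \<times> UNIV) (emb i j) = emb i j" by (rule restrict_vars_emb) (use that in auto)
      ultimately have "poly_subst (pev x2) s (emb i j) = 0" using s(1)[of "emb i j"] by simp
      then show "poly_subst (pev (p' i)) x2 j = 0" unfolding s_eq S_eval_def[symmetric] S_eval_emb .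
    qed
    moreover have "seq_eval p' f \<noteq> 0"
      using s(2) unfolding s_eq S_eval_def[symmetric] S_eval_liftS .
    ultimately show "\<exists>p'. (\<forall>i<N. p' i \<in> fib x') \<and> seq_eval p' f \<noteq> 0" unfolding fib2 by blast
  qed
qed

end

section \<open>Irreducible spaces and the Zariski topology\<close>

lemma irreducible_space_iff_opens:
  "irreducible_space T \<longleftrightarrow> topspace T \<noteq> {} \<and>
    (\<forall>A B. openin T A \<and> openin T B \<and> A \<noteq> {} \<and> B \<noteq> {} \<longrightarrow> A \<inter> B \<noteq> {})"
proof (intro iffI conjI allI impI)
  assume irr: "irreducible_space T"
  then show "topspace T \<noteq> {}" by (simp add: irreducible_space_def)
  fix A B assume AB: "openin T A \<and> openin T B \<and> A \<noteq> {} \<and> B \<noteq> {}"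
  show "A \<inter> B \<noteq> {}"
  proof
    assume "A \<inter> B = {}"
    then have "topspace T = (topspace T - A) \<union> (topspace T - B)" by blast
    then have "topspace T - A = topspace T \<or> topspace T - B = topspace T"
      using irr AB unfolding irreducible_space_def by (metis closedin_diff closedin_topspace)
    then show False using AB openin_subset by blast
  qed
next
  assume 1: "topspace T \<noteq> {} \<and> (\<forall>A B. openin T A \<and> openin T B \<and> A \<noteq> {} \<and> B \<noteq> {} \<longrightarrow> A \<inter> B \<noteq> {})"
  show "irreducible_space T" unfolding irreducible_space_def
  proof (intro conjI allI impI)
    show "topspace T \<noteq> {}" using 1 by simp
    fix C D assume CD: "closedin T C \<and> closedin T D \<and> topspace T = C \<union> D"
    then have "openin T (topspace T - C)" "openin T (topspace T - D)" by (auto simp only: closedin_def)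
    moreover have "(topspace T - C) \<inter> (topspace T - D) = {}" using CD by blast
    ultimately have "topspace T - C = {} \<or> topspace T - D = {}" using 1 by blast
    then show "C = topspace T \<or> D = topspace T" using CD closedin_subset by blast
  qed
qed

lemma irreducible_space_meet:
  "irreducible_space T \<Longrightarrow> openin T A \<Longrightarrow> openin T B \<Longrightarrow> A \<noteq> {} \<Longrightarrow> B \<noteq> {} \<Longrightarrow> A \<inter> B \<noteq> {}"
  by (simp add: irreducible_space_iff_opens)

lemma zariski_basic: "f \<in> carrier A \<Longrightarrow> openin (zariski A pts) {P \<in> pts. f \<notin> P}"
  unfolding zariski_def by (rule topology_generated_by_Basis) blast

text \<open>The sets D(f) form a base and not only a subbase: as the points are prime ideals, D(f)
  and D(g) intersect in D(fg).\<close>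

lemma zariski_base:
  assumes A: "cring A" and pts: "\<And>P. P \<in> pts \<Longrightarrow> primeideal P A"
    and "openin (zariski A pts) O'" "P \<in> O'"
  shows "\<exists>f\<in>carrier A. P \<in> pts \<and> f \<notin> P \<and> {P \<in> pts. f \<notin> P} \<subseteq> O'"
proof -
  interpret cring A by fact
  have "generate_topology_on ((\<lambda>f. {P \<in> pts. f \<notin> P}) ` carrier A) O'"
    using assms(3) unfolding zariski_def by (rule openin_topology_generated_by)
  then show ?thesis using assms(4)
  proof (induction arbitrary: P rule: generate_topology_on.induct)
    case (Int U V)
    then obtain f g where f: "f \<in> carrier A" "P \<in> pts" "f \<notin> P" "{P \<in> pts. f \<notin> P} \<subseteq> U"
      and g: "g \<in> carrier A" "g \<notin> P" "{P \<in> pts. g \<notin> P} \<subseteq> V" by blast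
    have "f \<otimes>\<^bsub>A\<^esub> g \<notin> P" using primeideal.I_prime[OF pts[OF f(2)] f(1) g(1)] f(3) g(2) by blast
    moreover have "{P \<in> pts. f \<otimes>\<^bsub>A\<^esub> g \<notin> P} \<subseteq> U \<inter> V"
    proof
      fix Q assume Q: "Q \<in> {P \<in> pts. f \<otimes>\<^bsub>A\<^esub> g \<notin> P}"
      then interpret Q: primeideal Q A using pts by blast
      have "f \<notin> Q" "g \<notin> Q" using Q Q.I_r_closed[of f g] Q.I_l_closed[of g f] f(1) g(1) by auto
      then show "Q \<in> U \<inter> V" using Q f(4) g(3) by blast
    qed
    ultimately show ?case using f(1,2) g(1) by blast
  next
    case (UN K)
    then obtain U where "U \<in> K" "P \<in> U" by blast
    with UN.IH show ?case by blast
  qed auto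
qed

lemma topspace_zariski:
  assumes A: "cring A" and pts: "\<And>P. P \<in> pts \<Longrightarrow> primeideal P A"
  shows "topspace (zariski A pts) = pts"
proof -
  interpret cring A by fact
  have "\<one>\<^bsub>A\<^esub> \<notin> P" if "P \<in> pts" for P
  proof -
    interpret P: primeideal P A by (rule pts[OF that])
    show ?thesis using P.one_imp_carrier P.I_notcarr by auto
  qed
  then show ?thesis unfolding zariski_def topology_generated_by_topspace using one_closed by blast
qed

section \<open>Irreducible fibres and their powers\<close>

context alg_closed_family
begin

text \<open>The contraction of q to K[y] contains the equations of the fibre, by
  \<open>spec_in\<close>, so all its zeros lie in \<open>fib x\<close>. The Nullstellensatz supplies
  one at which h does not vanish.\<close>

lemma fib_point:
  assumes q: "q \<in> J.proj_primes" "contr q = Ppt x" and h: "Const h \<notin> q"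
  shows "\<exists>b\<in>fib x. pev b h \<noteq> 0"
proof -
  have "tprime q" using q(1) by (simp add: J.proj_primes_def)
  then have z: "tprime {g. Const g \<in> q}" by (rule tprime_vimage[OF rhom_Const])
  have "h \<notin> {g. Const g \<in> q}" using h by simp
  from Nullstellensatz[OF infK z this] obtain b where
    b: "\<And>g. g \<in> {g. Const g \<in> q} \<Longrightarrow> pev b g = 0" "pev b h \<noteq> 0" by blast
  have "b \<in> fib x" unfolding fib_def
  proof (intro CollectI ballI)
    fix j assume "j \<in> J"
    then have "Const (spec x j) \<in> q" by (rule spec_in[OF q])
    then show "poly_subst (pev b) x j = 0" using b(1)[of "spec x j"] by (simp add: pev_spec)
  qed
  with b(2) show ?thesis by blast
qed

text \<open>Irreducibility concerns all points of the scheme fibre, the claim only its K-points: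
  \<open>Qpt\<close> carries the given points into the fibre, and \<open>fib_point\<close> turns a
  common point of the two open sets back into a K-point.\<close>

lemma fiber_nonvanishing:
  assumes irr: "irreducible_space (subtopology (Proj J.A) (pr1_fiber I J (cls I ` Ppt x)))" and x: "x \<in> base_pts"
    and b: "b1 \<in> fib x" "b2 \<in> fib x" "pev b1 h1 \<noteq> 0" "pev b2 h2 \<noteq> 0"
  shows "\<exists>b\<in>fib x. pev b h1 \<noteq> 0 \<and> pev b h2 \<noteq> 0"
proof -
  let ?F = "pr1_fiber I J (cls I ` Ppt x)"
  let ?D = "\<lambda>h. {P \<in> Proj_points J.A. cls J (Const h) \<notin> P}"
  have op: "openin (subtopology (Proj J.A) ?F) (?D h \<inter> ?F)" for h
    unfolding Proj_def openin_subtopology using zariski_basic[of "cls J (Const h)" J.A] by (auto simp: J.A_simps)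
  obtain v where v: "x v \<noteq> 0" using x by (auto simp: base_pts_def)
  have xP: "Ppt x \<in> I.proj_primes" using x by (simp add: Ppt_prime)
  have ne: "cls J ` Qpt x b \<in> ?D h \<inter> ?F" if "b \<in> fib x" "pev b h \<noteq> 0" for b h
  proof -
    note q = Qpt_prime[OF v that(1)]
    have "cls J ` Qpt x b \<in> ?F" unfolding fiber_iff[OF xP] by (intro bexI[OF _ q] conjI refl contr_Qpt)
    moreover have "Const h \<notin> Qpt x b"
      using that(2) by (simp add: pt_homog[OF rhom_pev homog_Const] poly_subst_Const rhom_0[OF rhom_pev])
    then have "cls J (Const h) \<notin> cls J ` Qpt x b" using in_image_J[OF q] by blast
    moreover have "cls J ` Qpt x b \<in> Proj_points J.A" unfolding J.Proj_points_eq using q by blast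
    ultimately show ?thesis by blast
  qed
  have "(?D h1 \<inter> ?F) \<inter> (?D h2 \<inter> ?F) \<noteq> {}"
  proof (rule irreducible_space_meet[OF irr op op])
    show "?D h1 \<inter> ?F \<noteq> {}" using ne[OF b(1,3)] by blast
    show "?D h2 \<inter> ?F \<noteq> {}" using ne[OF b(2,4)] by blast
  qed
  then obtain z where z: "z \<in> ?D h1" "z \<in> ?D h2" "z \<in> ?F" by blast
  from z(3) obtain q where q: "q \<in> J.proj_primes" "z = cls J ` q" "contr q = Ppt x" unfolding fiber_iff[OF xP] by blast
  have h: "Const h1 \<notin> q" "Const h2 \<notin> q" using z(1,2) in_image_J[OF q(1)] q(2) by auto
  have qp: "tprime q" using q(1) by (simp add: J.proj_primes_def)
  have "Const (h1 * h2) \<notin> q" using h tprime_mult[OF qp] by (auto simp: rhom_mult[OF rhom_Const])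
  from fib_point[OF q(1,3) this] show ?thesis by (auto simp: rhom_mult[OF rhom_pev])
qed

lemma product_nonvanishing:
  assumes irr: "irreducible_space (subtopology (Proj J.A) (pr1_fiber I J (cls I ` Ppt x)))" and x: "x \<in> base_pts"
    and p: "\<And>i. p i \<in> fib x" "seq_eval p f \<noteq> 0" and q: "\<And>i. q i \<in> fib x" "seq_eval q g \<noteq> 0"
  shows "\<exists>r. (\<forall>i. r i \<in> fib x) \<and> seq_eval r f \<noteq> 0 \<and> seq_eval r g \<noteq> 0"
proof -
  have agree: "\<exists>p q. (\<forall>i. p i \<in> fib x) \<and> (\<forall>i. q i \<in> fib x) \<and> seq_eval p f \<noteq> 0 \<and> seq_eval q g \<noteq> 0 \<and> (\<forall>i\<in>F. p i = q i)"
    if "finite F" for F :: "nat set"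
    using that
  proof (induction F rule: finite_induct)
    case empty
    then show ?case using p q by blast
  next
    case (insert i F)
    then obtain p q where pq: "\<And>i. p i \<in> fib x" "\<And>i. q i \<in> fib x" "seq_eval p f \<noteq> 0" "seq_eval q g \<noteq> 0" "\<And>i. i \<in> F \<Longrightarrow> p i = q i"
      by blast
    \<comment> \<open>The polynomial as a function of the i-th point alone, with the other points
      fixed as in s.\<close>
    define coord where "coord s = poly_subst Const (\<lambda>(k, j). if k = i then Var j else Const (s k j))" for s :: "nat \<Rightarrow> 'n \<Rightarrow> 'k"
    have coord: "pev b (coord s h) = seq_eval (s(i := b)) h" for b s h
    proof -
      have "pev b (coord s h) = poly_subst (\<lambda>c. pev b (Const c)) (\<lambda>v. pev b (case v of (k, j) \<Rightarrow> if k = i then Var j else Const (s k j))) h"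
        unfolding coord_def by (rule rhom_comp_poly_subst[OF rhom_pev])
      also have "\<dots> = seq_eval (s(i := b)) h"
        by (intro arg_cong3[where f = poly_subst] ext refl) (auto simp: poly_subst_Const poly_subst_Var)
      finally show ?thesis .
    qed
    have "\<exists>b\<in>fib x. pev b (coord p f) \<noteq> 0 \<and> pev b (coord q g) \<noteq> 0"
      by (rule fiber_nonvanishing[OF irr x pq(1)[of i] pq(2)[of i]]) (simp_all add: coord pq)
    then obtain b where b: "b \<in> fib x" "seq_eval (p(i := b)) f \<noteq> 0" "seq_eval (q(i := b)) g \<noteq> 0" by (auto simp: coord)
    then show ?case using pq by (intro exI[of _ "p(i := b)"] exI[of _ "q(i := b)"]) auto
  qed
  \<comment> \<open>Agreement at the indices that occur in g is enough, since then p may take the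
    place of q.\<close>
  have "finite (fst ` mvars g)" by simp
  from agree[OF this] obtain p q where pq: "\<And>i. p i \<in> fib x" "seq_eval p f \<noteq> 0" "seq_eval q g \<noteq> 0"
    "\<And>i. i \<in> fst ` mvars g \<Longrightarrow> p i = q i" by blast
  have "seq_eval p g = seq_eval q g" by (rule poly_subst_cong_mvars) (use pq(4) in force)
  with pq(3) have "seq_eval p g \<noteq> 0" by simp
  with pq(1,2) show ?thesis by blast
qed

end

section \<open>Points of infinite affine space\<close>

lemma type_ring_simps [simp]:
  "carrier ring_of_type_algebra = UNIV" "x \<otimes>\<^bsub>ring_of_type_algebra\<^esub> y = x * y"
  "x \<oplus>\<^bsub>ring_of_type_algebra\<^esub> y = x + y" "\<zero>\<^bsub>ring_of_type_algebra\<^esub> = 0" "\<one>\<^bsub>ring_of_type_algebra\<^esub> = 1"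
  by (simp_all add: ring_of_type_algebra_def)

lemma primeideal_type_ring:
  fixes P :: "'a::comm_ring_1 set"
  shows "primeideal P ring_of_type_algebra \<longleftrightarrow> tprime P"
proof
  interpret cring "ring_of_type_algebra :: 'a ring" by (rule cring_from_type_algebra)
  show "tprime P" if "primeideal P ring_of_type_algebra"
  proof -
    interpret P: primeideal P ring_of_type_algebra by fact
    have 0: "0 \<in> P" using additive_subgroup.zero_closed[OF P.additive_subgroup_axioms] by simp
    have add: "x + y \<in> P" if "x \<in> P" "y \<in> P" for x y
      using additive_subgroup.a_closed[OF P.additive_subgroup_axioms that] by simp
    have mult: "r * x \<in> P" if "x \<in> P" for r x using P.I_l_closed[OF that, of r] by simp
    have "1 \<notin> P" using P.one_imp_carrier P.I_notcarr by auto
    moreover have "x \<in> P \<or> y \<in> P" if "x * y \<in> P" for x y using P.I_prime[of x y] that by simp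
    ultimately show ?thesis unfolding tprime_def tideal_def using 0 add mult by blast
  qed
  show "primeideal P ring_of_type_algebra" if P: "tprime P"
  proof -
    note t = tprime_tideal[OF P]
    show ?thesis
    proof (rule primeidealI)
      show "ideal P ring_of_type_algebra"
      proof (rule idealI)
        show "subgroup P (add_monoid ring_of_type_algebra)"
        proof (rule add.subgroupI)
          fix a assume a: "a \<in> P"
          have "\<ominus>\<^bsub>ring_of_type_algebra\<^esub> a = - a" by (rule minus_equality) auto
          then show "\<ominus>\<^bsub>ring_of_type_algebra\<^esub> a \<in> P" using tideal_minus[OF t a] by simp
        qed (use t in \<open>auto simp: tideal_add dest: tideal_0\<close>)
      qed (use t in \<open>auto simp: tideal_mult tideal_mult' intro: ring_axioms\<close>)
      show "cring (ring_of_type_algebra :: 'a ring)" by (rule cring_from_type_algebra)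
      show "carrier ring_of_type_algebra \<noteq> P" using tprime_1[OF P] by auto
    qed (use tprime_mult[OF P] in auto)
  qed
qed

lemma topspace_A_inf: "topspace A_inf = {P. tprime P}"
  unfolding A_inf_def Spec_def by (subst topspace_zariski) (auto simp: cring_from_type_algebra primeideal_type_ring)

lemma A_inf_basic: "openin A_inf {P. tprime P \<and> f \<notin> P}"
  using zariski_basic[of f ring_of_type_algebra "{P. primeideal P ring_of_type_algebra}"]
  by (simp add: A_inf_def Spec_def primeideal_type_ring)

lemma A_inf_base:
  assumes "openin A_inf O'" "P \<in> O'"
  obtains f where "tprime P" "f \<notin> P" "{P. tprime P \<and> f \<notin> P} \<subseteq> O'"
proof -
  have "\<exists>f\<in>carrier ring_of_type_algebra. P \<in> {P. primeideal P ring_of_type_algebra} \<and> f \<notin> P \<and>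
      {P \<in> {P. primeideal P ring_of_type_algebra}. f \<notin> P} \<subseteq> O'"
    using assms unfolding A_inf_def Spec_def by (intro zariski_base[OF cring_from_type_algebra]) simp_all
  then obtain f where f: "tprime P" "f \<notin> P" "{P. tprime P \<and> f \<notin> P} \<subseteq> O'"
    unfolding mem_Collect_eq primeideal_type_ring by blast
  then show thesis by (rule that)
qed

lemma A_inf_closure:
  assumes S: "\<And>P. P \<in> S \<Longrightarrow> tprime P"
  shows "A_inf closure_of S = {P. tprime P \<and> \<Inter>S \<subseteq> P}"
proof (intro equalityI subsetI)
  fix P assume P: "P \<in> A_inf closure_of S"
  then have tP: "tprime P" using closure_of_subset_topspace[of A_inf S] topspace_A_inf by blast
  have "f \<in> P" if f: "f \<in> \<Inter>S" for f
  proof (rule ccontr)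
    assume "f \<notin> P"
    then have "P \<in> {P. tprime P \<and> f \<notin> P}" using tP by simp
    note mem = conjI[OF this A_inf_basic]
    have "\<forall>T. P \<in> T \<and> openin A_inf T \<longrightarrow> (\<exists>y. y \<in> S \<and> y \<in> T)"
      using P unfolding in_closure_of by (rule conjunct2)
    from this[THEN spec, THEN mp, OF mem] obtain Q where Q: "Q \<in> S" "Q \<in> {P. tprime P \<and> f \<notin> P}"
      by (elim exE conjE)
    from Q(2) InterD[OF f Q(1)] show False by simp
  qed
  with tP show "P \<in> {P. tprime P \<and> \<Inter>S \<subseteq> P}" by blast
next
  fix P assume P: "P \<in> {P. tprime P \<and> \<Inter>S \<subseteq> P}"
  show "P \<in> A_inf closure_of S" unfolding in_closure_of
  proof (intro conjI allI impI)
    show "P \<in> topspace A_inf" using P by (simp add: topspace_A_inf)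
    fix T assume T: "P \<in> T \<and> openin A_inf T"
    then obtain f where f: "f \<notin> P" "{P. tprime P \<and> f \<notin> P} \<subseteq> T" by (elim conjE A_inf_base)
    from f(1) P obtain Q where "Q \<in> S" "f \<notin> Q" by blast
    with S f(2) show "\<exists>y. y \<in> S \<and> y \<in> T" by blast
  qed
qed

text \<open>A generic point of the closure is the least prime in it, so there is only one; this
  justifies the definite description in \<open>sq\<close>.\<close>

lemma generic_point_A_inf:
  assumes S: "\<And>P. P \<in> S \<Longrightarrow> tprime P" and pr: "tprime (\<Inter>S)"
  shows "generic_point A_inf (A_inf closure_of S) \<eta> \<longleftrightarrow> \<eta> = \<Inter>S"
proof
  assume "generic_point A_inf (A_inf closure_of S) \<eta>"
  then have \<eta>: "tprime \<eta>" and eq: "A_inf closure_of {\<eta>} = A_inf closure_of S"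
    by (auto simp: generic_point_def topspace_A_inf)
  have sets: "{P. tprime P \<and> \<eta> \<subseteq> P} = {P. tprime P \<and> \<Inter>S \<subseteq> P}"
  proof -
    have "A_inf closure_of {\<eta>} = {P. tprime P \<and> \<Inter>{\<eta>} \<subseteq> P}" by (rule A_inf_closure) (use \<eta> in simp)
    moreover have "A_inf closure_of S = {P. tprime P \<and> \<Inter>S \<subseteq> P}" by (rule A_inf_closure[OF S])
    ultimately show ?thesis using eq by simp
  qed
  show "\<eta> = \<Inter>S"
  proof (rule equalityI)
    have "\<Inter>S \<in> {P. tprime P \<and> \<eta> \<subseteq> P}" unfolding sets using pr by (intro CollectI conjI order_refl)
    then show "\<eta> \<subseteq> \<Inter>S" by (elim CollectE conjE)
    have "\<eta> \<in> {P. tprime P \<and> \<Inter>S \<subseteq> P}" unfolding sets[symmetric] using \<eta> by (intro CollectI conjI order_refl)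
    then show "\<Inter>S \<subseteq> \<eta>" by (elim CollectE conjE)
  qed
next
  assume "\<eta> = \<Inter>S"
  moreover have "A_inf closure_of {\<Inter>S} = {P. tprime P \<and> \<Inter>{\<Inter>S} \<subseteq> P}" by (rule A_inf_closure) (use pr in simp)
  moreover have "A_inf closure_of S = {P. tprime P \<and> \<Inter>S \<subseteq> P}" by (rule A_inf_closure[OF S])
  ultimately show "generic_point A_inf (A_inf closure_of S) \<eta>"
    using pr by (simp add: generic_point_def topspace_A_inf)
qed

lemma seq_point_eq: "seq_point p = {f. seq_eval (\<lambda>i j. p i $ j) f = 0}"
  by (simp add: seq_point_def affine_point_def)

lemma tprime_seq_point: "tprime (seq_point (p :: nat \<Rightarrow> 'k::field ^ 'n))"
  unfolding seq_point_eq by (rule tprime_ker) simp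

lemma rhom_sym_act: "rhom (sym_act \<sigma>)"
  unfolding sym_act_def by (rule rhom_poly_subst) simp

lemma seq_eval_sym_act: "seq_eval p (sym_act \<sigma> f) = seq_eval (\<lambda>i. p (\<sigma> i)) f"
proof -
  have "seq_eval p (sym_act \<sigma> f) = poly_subst (\<lambda>c. seq_eval p (Const c)) (\<lambda>v. seq_eval p (case v of (i, j) \<Rightarrow> Var (\<sigma> i, j))) f"
    unfolding sym_act_def by (rule rhom_comp_poly_subst[OF rhom_pev])
  also have "\<dots> = seq_eval (\<lambda>i. p (\<sigma> i)) f"
    by (intro arg_cong3[where f = poly_subst] ext refl) (auto simp: poly_subst_Const poly_subst_Var)
  finally show ?thesis .
qed

lemma sym_act_inverse:
  assumes "\<And>i. \<sigma> (\<tau> i) = i" shows "sym_act \<sigma> (sym_act \<tau> f) = f"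
proof (rule rhom_eqI[OF rhom_comp[OF rhom_sym_act rhom_sym_act] rhom_id])
  show "sym_act \<sigma> (sym_act \<tau> (Const c)) = Const c" for c
    by (simp add: sym_act_def poly_subst_Const rhom_0[OF rhom_Const])
  show "sym_act \<sigma> (sym_act \<tau> (Var v)) = Var v" for v
    by (cases v) (simp add: sym_act_def poly_subst_Var assms)
qed

lemma Sym_inf_bij: assumes "\<sigma> \<in> Sym_inf" shows "bij \<sigma>"
  using assms by (auto simp: Sym_inf_def intro: permutes_bij)

lemma sym_act_invariant:
  fixes S :: "(nat \<Rightarrow> 'k::field ^ 'n) set"
  assumes inv: "\<And>p \<sigma>. p \<in> S \<Longrightarrow> (\<lambda>i. p (\<sigma> i)) \<in> S" and \<sigma>: "\<sigma> \<in> Sym_inf"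
  shows "sym_act_point \<sigma> (\<Inter>(seq_point ` S)) = \<Inter>(seq_point ` S)"
proof -
  have stable: "sym_act \<tau> f \<in> \<Inter>(seq_point ` S)" if f: "f \<in> \<Inter>(seq_point ` S)" for \<tau> f
  proof (rule InterI)
    fix P assume "P \<in> seq_point ` S"
    then obtain p where p: "p \<in> S" "P = seq_point p" by blast
    have "f \<in> seq_point (\<lambda>i. p (\<tau> i))" using f inv[OF p(1), of \<tau>] by blast
    then show "sym_act \<tau> f \<in> P" by (simp add: p(2) seq_point_eq seq_eval_sym_act)
  qed
  \<comment> \<open>Stability gives one inclusion. The other holds because each f is the image under
    \<sigma> of its image under the inverse, which is again in the intersection.\<close>
  have "\<sigma> (inv_into UNIV \<sigma> i) = i" for i using Sym_inf_bij[OF \<sigma>] by (simp add: bij_is_surj surj_f_inv_f)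
  then have "f = sym_act \<sigma> (sym_act (inv_into UNIV \<sigma>) f)" for f :: "(nat \<times> 'n, 'k) mpoly" by (simp add: sym_act_inverse)
  then show ?thesis unfolding sym_act_point_def using stable by blast
qed

section \<open>The space of sequences\<close>

context alg_closed_family
begin

lemma vec_nth_lambda: "($) (vec_lambda b) = b"
  by (rule ext) simp

definition seqs :: "(nat \<Rightarrow> 'k ^ 'n) set" where
  "seqs = {p. \<exists>x\<in>base_pts. \<forall>i. ($) (p i) \<in> fib x}"

context
  assumes flat: "Proj_flat (projective_ring I) (projective_ring J) (pr1_hom J)"
begin

text \<open>The point z gives access to the local ring of X at P, which is handled through flatness
  at a point of \<Sigma> over P.\<close>

lemma rational_with_fiber:
  assumes "P \<in> rational_points I" "z \<in> pr1_fiber I J P"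
  obtains x where "x \<in> base_pts" "P = cls I ` Ppt x"
proof -
  obtain q where q: "q \<in> J.proj_primes" "P = cls I ` contr q"
    using assms(2) unfolding pr1_fiber_def J.Proj_points_eq by (auto simp: pr1_eq)
  interpret fp: flat_family_point I J q by unfold_locales (rule q(1), rule flat)
  obtain x where "x \<in> base_pts" "contr q = Ppt x" using fp.rational_imp_point assms(1) q(2) by metis
  then show thesis using that q(2) by blast
qed

lemma rational_of_fiber:
  assumes x: "x \<in> base_pts" and b: "b \<in> fib x" shows "cls I ` Ppt x \<in> rational_points I"
proof -
  obtain v where "x v \<noteq> 0" using x by (auto simp: base_pts_def)
  note q = Qpt_prime[OF this b]
  interpret fp: flat_family_point I J "Qpt x b" by unfold_locales (rule q, rule flat)
  show ?thesis using fp.point_imp_rational[OF contr_Qpt] unfolding contr_Qpt .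
qed

lemma Seq_eq: "Seq I J = seqs"
proof (intro equalityI subsetI)
  fix p assume "p \<in> Seq I J"
  then obtain P where P: "P \<in> rational_points I" "\<And>i. affine_point (\<lambda>j. p i $ j) \<in> pr2 J ` pr1_fiber I J P"
    by (auto simp: Seq_def)
  then obtain z where "z \<in> pr1_fiber I J P" by blast
  with P(1) obtain x where x: "x \<in> base_pts" "P = cls I ` Ppt x" using rational_with_fiber by blast
  have "($) (p i) \<in> fib x" for i
    using P(2)[of i] affine_point_fiber_iff[OF x(1), of "($) (p i)"] unfolding x(2) by simp
  with x(1) show "p \<in> seqs" by (auto simp: seqs_def)
next
  fix p assume "p \<in> seqs"
  then obtain x where x: "x \<in> base_pts" "\<And>i. ($) (p i) \<in> fib x" by (auto simp: seqs_def)
  have "cls I ` Ppt x \<in> rational_points I" by (rule rational_of_fiber[OF x(1) x(2)[of 0]])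
  moreover have "affine_point (\<lambda>j. p i $ j) \<in> pr2 J ` pr1_fiber I J (cls I ` Ppt x)" for i
    using affine_point_fiber_iff[OF x(1), of "($) (p i)"] x(2) by simp
  ultimately show "p \<in> Seq I J" unfolding Seq_def by blast
qed

context
  fixes U
  assumes irrX: "irreducible_space (Proj (projective_ring I))"
    and U: "openin (subtopology (Proj (projective_ring I)) (rational_points I)) U" "U \<noteq> {}"
    and irrF: "\<And>P. P \<in> U \<Longrightarrow> irreducible_space (subtopology (Proj (projective_ring J)) (pr1_fiber I J P))"
begin

text \<open>The homogeneous prime of the generic point of X. Its primality is the irreducibility of
  X: for f and g outside it, D(f) and D(g) are nonempty open sets of X and meet.\<close>

definition eta :: "('m, 'k) mpoly set" where
  "eta = \<Inter>I.proj_primes"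

lemma Proj_points_prime: "P \<in> Proj_points I.A \<Longrightarrow> primeideal P I.A"
  by (simp add: Proj_points_def)

lemma topspace_Proj: "topspace (Proj I.A) = Proj_points I.A"
  unfolding Proj_def by (rule topspace_zariski[OF I.cring_A Proj_points_prime])

lemma proj_primes_nonempty: "I.proj_primes \<noteq> {}"
  using irrX topspace_Proj unfolding I.Proj_points_eq by (auto simp: irreducible_space_def)

lemma tprime_eta: "tprime eta"
  unfolding tprime_def
proof (intro conjI allI impI)
  have pr: "tprime p" if "p \<in> I.proj_primes" for p using that by (simp add: I.proj_primes_def)
  show "tideal eta" unfolding eta_def tideal_def
    using tideal_0[OF tprime_tideal[OF pr]] tideal_add[OF tprime_tideal[OF pr]] tideal_mult[OF tprime_tideal[OF pr]] by auto
  show "1 \<notin> eta" unfolding eta_def using proj_primes_nonempty tprime_1[OF pr] by auto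
  fix f g assume fg: "f * g \<in> eta"
  show "f \<in> eta \<or> g \<in> eta"
  proof (rule ccontr)
    assume "\<not> ?thesis"
    then obtain p q where p: "p \<in> I.proj_primes" "f \<notin> p" and q: "q \<in> I.proj_primes" "g \<notin> q" by (auto simp: eta_def)
    let ?D = "\<lambda>h. {P \<in> Proj_points I.A. cls I h \<notin> P}"
    have op: "openin (Proj I.A) (?D h)" for h unfolding Proj_def by (rule zariski_basic) (simp add: I.A_simps)
    have ne: "cls I ` p \<in> ?D h" if "p \<in> I.proj_primes" "h \<notin> p" for p h
      using that in_image_I[OF that(1)] by (simp add: I.Proj_points_eq)
    have "?D f \<inter> ?D g \<noteq> {}" using ne[OF p] ne[OF q] by (intro irreducible_space_meet[OF irrX op op]) blast+
    then obtain P where "P \<in> ?D f" "P \<in> ?D g" by blast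
    then obtain r where r: "r \<in> I.proj_primes" "cls I f \<notin> cls I ` r" "cls I g \<notin> cls I ` r"
      by (auto simp: I.Proj_points_eq)
    then have "f \<notin> r" "g \<notin> r" by auto
    then have "f * g \<notin> r" using tprime_mult[OF pr[OF r(1)]] by blast
    with fg r(1) show False by (auto simp: eta_def)
  qed
qed

lemma I_eta: "I \<subseteq> eta"
  by (auto simp: eta_def I.proj_primes_def)

lemma eta_Ppt: "\<forall>x\<in>base_pts. eta \<subseteq> Ppt x"
proof
  fix x assume "x \<in> base_pts"
  then show "eta \<subseteq> Ppt x" unfolding eta_def Ppt_prime by (rule Inter_lower)
qed

lemma Var_eta: "\<exists>v. Var v \<notin> eta"
  using proj_primes_nonempty unfolding eta_def I.proj_primes_def by auto

text \<open>Rationality stays a premise, because \<open>rational_of_fiber\<close> provides it only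
  where the fibre has a K-point.\<close>

lemma base_open:
  "\<exists>u. u \<notin> eta \<and>
    (\<forall>x\<in>base_pts. pev x u \<noteq> 0 \<longrightarrow> cls I ` Ppt x \<in> rational_points I \<longrightarrow> cls I ` Ppt x \<in> U)"
proof -
  from U(1) obtain O' where O': "openin (Proj I.A) O'" "U = O' \<inter> rational_points I" by (auto simp: openin_subtopology)
  from U(2) obtain P where P: "P \<in> U" by blast
  then have "P \<in> O'" using O' by blast
  then have "\<exists>f\<in>carrier I.A. P \<in> Proj_points I.A \<and> f \<notin> P \<and> {P \<in> Proj_points I.A. f \<notin> P} \<subseteq> O'"
    using O'(1) unfolding Proj_def by (intro zariski_base[OF I.cring_A Proj_points_prime])
  then obtain u where u: "P \<in> Proj_points I.A" "cls I u \<notin> P" "{P \<in> Proj_points I.A. cls I u \<notin> P} \<subseteq> O'"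
    by (auto simp: I.A_simps)
  show ?thesis
  proof (intro exI[of _ u] conjI ballI impI)
    from u(1) obtain p where p: "p \<in> I.proj_primes" "P = cls I ` p" by (auto simp: I.Proj_points_eq)
    then show "u \<notin> eta" using u(2) by (auto simp: eta_def)
    fix x assume x: "x \<in> base_pts" "pev x u \<noteq> 0" "cls I ` Ppt x \<in> rational_points I"
    then have pts: "cls I ` Ppt x \<in> Proj_points I.A" by (simp add: rational_points_def)
    have "u \<notin> Ppt x" using x(2) pt_vanish[OF rhom_id] by blast
    then have "cls I u \<notin> cls I ` Ppt x" using in_image_I x(1) unfolding Ppt_prime by blast
    then show "cls I ` Ppt x \<in> U" using pts u(3) x(3) O'(2) by blast
  qed
qed

lemma seqs_meet:
  assumes p: "p \<in> seqs" "f \<notin> seq_point p" and q: "q \<in> seqs" "g \<notin> seq_point q"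
  obtains r where "r \<in> seqs" "f \<notin> seq_point r" "g \<notin> seq_point r"
proof -
  obtain x y where x: "x \<in> base_pts" "\<And>i. ($) (p i) \<in> fib x" and y: "y \<in> base_pts" "\<And>i. ($) (q i) \<in> fib y"
    using p(1) q(1) by (auto simp: seqs_def)
  have fp: "seq_eval (\<lambda>i. ($) (p i)) f \<noteq> 0" and gq: "seq_eval (\<lambda>i. ($) (q i)) g \<noteq> 0"
    using p(2) q(2) by (simp_all add: seq_point_eq)
  obtain n where n: "\<And>i. i \<in> fst ` (mvars f \<union> mvars g) \<Longrightarrow> i \<le> n"
    using finite_nat_set_iff_bounded_le[of "fst ` (mvars f \<union> mvars g)"] by auto
  \<comment> \<open>N is positive, so that \<open>p' 0\<close> below is a point of the fibre even if
    f and g are constants.\<close>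
  define N where "N = Suc n"
  have "mvars f \<subseteq> {..<N} \<times> UNIV" "mvars g \<subseteq> {..<N} \<times> UNIV"
    using n by (force simp: N_def less_Suc_eq_le)+
  note N = this
  obtain a where a: "a \<notin> eta" and a': "\<forall>x'. (\<forall>f\<in>eta. pev x' f = 0) \<and> pev x' a \<noteq> 0 \<longrightarrow>
      (\<exists>p'. (\<forall>i<N. p' i \<in> fib x') \<and> seq_eval p' f \<noteq> 0)"
    using nonvanishing_open[OF flat tprime_eta I_eta eta_Ppt x fp N(1)] by (elim exE conjE)
  obtain b where b: "b \<notin> eta" and b': "\<forall>x'. (\<forall>f\<in>eta. pev x' f = 0) \<and> pev x' b \<noteq> 0 \<longrightarrow>
      (\<exists>p'. (\<forall>i<N. p' i \<in> fib x') \<and> seq_eval p' g \<noteq> 0)"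
    using nonvanishing_open[OF flat tprime_eta I_eta eta_Ppt y gq N(2)] by (elim exE conjE)
  obtain u where u: "u \<notin> eta"
    "\<forall>x\<in>base_pts. pev x u \<noteq> 0 \<longrightarrow> cls I ` Ppt x \<in> rational_points I \<longrightarrow> cls I ` Ppt x \<in> U"
    using base_open by (elim exE conjE)
  obtain v where v: "Var v \<notin> eta" using Var_eta by blast
  \<comment> \<open>The zero x' of \<open>eta\<close> should satisfy all three open conditions at
    once; the factor \<open>Var v\<close> makes it a point of projective space.\<close>
  have "a * (b * (u * Var v)) \<notin> eta" using a b u(1) v by (simp add: tprime_mult_iff[OF tprime_eta])
  from Nullstellensatz[OF infK tprime_eta this] obtain x' where
    x': "\<And>f. f \<in> eta \<Longrightarrow> pev x' f = 0" "pev x' (a * (b * (u * Var v))) \<noteq> 0" by blast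
  then have nz: "pev x' a \<noteq> 0" "pev x' b \<noteq> 0" "pev x' u \<noteq> 0" "x' v \<noteq> 0"
    by (auto simp: rhom_mult[OF rhom_pev] poly_subst_Var)
  have x'b: "x' \<in> base_pts" using nz(4) x'(1) I_eta by (auto simp: base_pts_def)
  obtain p' where p': "\<And>i. i < N \<Longrightarrow> p' i \<in> fib x'" "seq_eval p' f \<noteq> 0" using a'[THEN spec, of x'] x'(1) nz(1) by auto
  obtain q' where q': "\<And>i. i < N \<Longrightarrow> q' i \<in> fib x'" "seq_eval q' g \<noteq> 0" using b'[THEN spec, of x'] x'(1) nz(2) by auto
  have p0: "p' 0 \<in> fib x'" by (rule p'(1)) (simp add: N_def)
  have "cls I ` Ppt x' \<in> U" using u(2) x'b nz(3) rational_of_fiber[OF x'b p0] by blast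
  note irr = irrF[OF this]
  \<comment> \<open>Neither f nor g involves a position from N on, so these may be filled with any
    point of the fibre.\<close>
  define p1 where "p1 i = (if i < N then p' i else p' 0)" for i
  define q1 where "q1 i = (if i < N then q' i else p' 0)" for i
  have 1: "p1 i \<in> fib x'" "q1 i \<in> fib x'" for i using p'(1) q'(1) p0 by (auto simp: p1_def q1_def)
  have "seq_eval p1 f = seq_eval p' f" by (rule poly_subst_cong_mvars) (use N(1) in \<open>force simp: p1_def\<close>)
  moreover have "seq_eval q1 g = seq_eval q' g" by (rule poly_subst_cong_mvars) (use N(2) in \<open>force simp: q1_def\<close>)
  ultimately have 2: "seq_eval p1 f \<noteq> 0" "seq_eval q1 g \<noteq> 0" using p'(2) q'(2) by simp_all
  obtain r where r: "\<And>i. r i \<in> fib x'" "seq_eval r f \<noteq> 0" "seq_eval r g \<noteq> 0"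
    using product_nonvanishing[OF irr x'b 1(1) 2(1) 1(2) 2(2)] by blast
  show thesis
  proof (rule that[of "\<lambda>i. vec_lambda (r i)"])
    show "(\<lambda>i. vec_lambda (r i)) \<in> seqs"
      unfolding seqs_def using r(1) by (intro CollectI bexI[OF _ x'b]) (simp add: vec_nth_lambda)
  qed (use r(2,3) in \<open>simp_all add: seq_point_eq\<close>)
qed

lemma seqs_nonempty: "seqs \<noteq> {}"
proof -
  from U(2) obtain P where P: "P \<in> U" by blast
  have "pr1_fiber I J P \<noteq> {}" using irrF[OF P] by (auto simp: irreducible_space_def)
  then obtain z where z: "z \<in> pr1_fiber I J P" by blast
  have rat: "P \<in> rational_points I" using U(1) P by (auto simp: openin_subtopology)
  obtain x where x: "x \<in> base_pts" "P = cls I ` Ppt x" by (rule rational_with_fiber[OF rat z])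
  have xP: "Ppt x \<in> I.proj_primes" using x(1) by (simp add: Ppt_prime)
  from z obtain q where q: "q \<in> J.proj_primes" "contr q = Ppt x" unfolding x(2) fiber_iff[OF xP] by blast
  have "Const 1 \<notin> q" using q(1) tprime_1 by (auto simp: J.proj_primes_def rhom_1[OF rhom_Const])
  from fib_point[OF q this] obtain b where "b \<in> fib x" by blast
  then have "(\<lambda>_. vec_lambda b) \<in> seqs"
    unfolding seqs_def by (intro CollectI bexI[OF _ x(1)]) (simp add: vec_nth_lambda)
  then show ?thesis by blast
qed

text \<open>Primality of the vanishing ideal and irreducibility of the space are two readings of
  \<open>seqs_meet\<close>.\<close>

lemma tprime_seqs: "tprime (\<Inter>(seq_point ` seqs))"
  unfolding tprime_def
proof (intro conjI allI impI)
  have t: "tideal (seq_point p)" for p :: "nat \<Rightarrow> 'k ^ 'n" by (rule tprime_tideal[OF tprime_seq_point])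
  show "tideal (\<Inter>(seq_point ` seqs))" unfolding tideal_def
    using tideal_0[OF t] tideal_add[OF t] tideal_mult[OF t] by auto
  show "1 \<notin> \<Inter>(seq_point ` seqs)" using seqs_nonempty tprime_1[OF tprime_seq_point] by blast
  fix f g assume fg: "f * g \<in> \<Inter>(seq_point ` seqs)"
  show "f \<in> \<Inter>(seq_point ` seqs) \<or> g \<in> \<Inter>(seq_point ` seqs)"
  proof (rule ccontr)
    assume "\<not> ?thesis"
    then obtain p q where "p \<in> seqs" "f \<notin> seq_point p" "q \<in> seqs" "g \<notin> seq_point q" by blast
    then obtain r where r: "r \<in> seqs" "f \<notin> seq_point r" "g \<notin> seq_point r" by (rule seqs_meet)
    have "f * g \<in> seq_point r" using fg r(1) by (rule InterD[OF _ imageI])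
    with tprime_mult[OF tprime_seq_point] r(2,3) show False by metis
  qed
qed

lemma irreducible_seqs: "irreducible_space (subtopology A_inf_K seqs)"
  unfolding irreducible_space_iff_opens
proof (intro conjI allI impI)
  have "topspace A_inf_K = (UNIV :: (nat \<Rightarrow> 'k ^ 'n) set)"
    unfolding A_inf_K_def topspace_pullback_topology by (auto simp: topspace_A_inf tprime_seq_point)
  then show "topspace (subtopology A_inf_K seqs) \<noteq> {}" using seqs_nonempty by simp
  have base: "\<exists>p f. p \<in> seqs \<and> f \<notin> seq_point p \<and> {p \<in> seqs. f \<notin> seq_point p} \<subseteq> A"
    if A: "openin (subtopology A_inf_K seqs) A" "A \<noteq> {}" for A
  proof -
    from A(1) obtain O' where O': "openin A_inf O'" "A = seq_point -` O' \<inter> seqs"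
      unfolding A_inf_K_def openin_subtopology openin_pullback_topology by auto
    from A(2) obtain p where p: "p \<in> A" by blast
    then have "seq_point p \<in> O'" using O'(2) by blast
    with O'(1) obtain f where "f \<notin> seq_point p" "{P. tprime P \<and> f \<notin> P} \<subseteq> O'" by (rule A_inf_base)
    then show ?thesis using O'(2) p tprime_seq_point by (intro exI[of _ p] exI[of _ f]) auto
  qed
  fix A B :: "(nat \<Rightarrow> 'k ^ 'n) set"
  assume AB: "openin (subtopology A_inf_K seqs) A \<and> openin (subtopology A_inf_K seqs) B \<and> A \<noteq> {} \<and> B \<noteq> {}"
  from base[of A] AB obtain p f where p: "p \<in> seqs" "f \<notin> seq_point p" "{p \<in> seqs. f \<notin> seq_point p} \<subseteq> A" by blast
  from base[of B] AB obtain q g where q: "q \<in> seqs" "g \<notin> seq_point q" "{p \<in> seqs. g \<notin> seq_point p} \<subseteq> B" by blast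
  obtain r where "r \<in> seqs" "f \<notin> seq_point r" "g \<notin> seq_point r" by (rule seqs_meet[OF p(1,2) q(1,2)])
  then show "A \<inter> B \<noteq> {}" using p(3) q(3) by blast
qed

lemma sequence_space:
  "irreducible_space (subtopology A_inf_K (Seq I J)) \<and>
   generic_point A_inf (A_inf closure_of (seq_point ` Seq I J)) (sq I J) \<and>
   (\<forall>\<sigma>\<in>Sym_inf. sym_act_point \<sigma> (sq I J) = sq I J)"
proof -
  have gp: "generic_point A_inf (A_inf closure_of (seq_point ` seqs)) \<eta> \<longleftrightarrow> \<eta> = \<Inter>(seq_point ` seqs)" for \<eta>
    by (rule generic_point_A_inf) (auto simp: tprime_seq_point tprime_seqs)
  have sq: "sq I J = \<Inter>(seq_point ` seqs)"
    unfolding sq_def Seq_eq gp by simp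
  show ?thesis
    unfolding sq Seq_eq gp
  proof (intro conjI irreducible_seqs refl ballI)
    fix \<sigma> assume \<sigma>: "\<sigma> \<in> Sym_inf"
    show "sym_act_point \<sigma> (\<Inter>(seq_point ` seqs)) = \<Inter>(seq_point ` seqs)"
    proof (rule sym_act_invariant[OF _ \<sigma>])
      \<comment> \<open>The same x serves after any reindexing of the terms.\<close>
      show "(\<lambda>i. p (\<tau> i)) \<in> seqs" if "p \<in> seqs" for p \<tau> using that by (auto simp: seqs_def)
    qed
  qed
qed

end

end

end

theorem theorem3p18:
  fixes I :: "('m::finite, 'k::alg_closed_field) mpoly set"
    and J :: "('m, ('n::finite, 'k) mpoly) mpoly set"
    and U :: "('m, 'k) mpoly set set set"
  assumes "uncountable (UNIV :: 'k set)"
    and "homogeneous_ideal poly_gring I"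
    and "irreducible_space (Proj (projective_ring I))"
    and "closed_in_product I J"
    and "Proj_flat (projective_ring I) (projective_ring J) (pr1_hom J)"
    and "openin (subtopology (Proj (projective_ring I)) (rational_points I)) U"
    and "U \<noteq> {}"
    and "\<And>x. x \<in> U \<Longrightarrow>
           irreducible_space (subtopology (Proj (projective_ring J)) (pr1_fiber I J x))"
  shows "irreducible_space (subtopology A_inf_K (Seq I J)) \<and>
         generic_point A_inf (A_inf closure_of (seq_point ` Seq I J)) (sq I J) \<and>
         (\<forall>\<sigma>\<in>Sym_inf. sym_act_point \<sigma> (sq I J) = sq I J)"
proof -
  interpret alg_closed_family I J
    using assms(1,2,4) uncountable_infinite by unfold_locales (auto simp: closed_in_product_def)
  show ?thesis by (rule sequence_space[OF assms(5,3,6,7,8)])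
qed

end
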